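(* Suppose Assumptions $(\mathbf{W^*})$ and $(\mathbf{B})$ hold. Let $u$ be the function $u(x)=\liminf_{\alpha\uparrow1,\,y\to x}u_\alpha(y)$, $x\in\mathbb{X}$, and let $A^*(x)$, $A_*(x)$ be the associated sets of actions (all defined in the context). Then there exists a stationary policy $\phi$ satisfying $$\overline{w}+u(x)\ \ge\ c(x,\phi(x))+\int_{\mathbb{X}}u(y)\,q(dy|x,\phi(x)),\qquad x\in\mathbb{X},\qquad( * )$$ this policy is average-cost optimal, and $$w(x)=w^{\phi}(x)=\limsup_{\alpha\uparrow1}(1-\alpha)v_\alpha(x)=\overline{w}=w^*,\qquad x\in\mathbb{X}.$$ Furthermore: (a) the function $u:\mathbb{X}\to[0,\infty)$ is lower semi-continuous; (b) the sets $A^*(x)$, $x\in\mathbb{X}$, are nonempty and compact, and the graph $\mathrm{Gr}(A^* )=\{(x,a):x\in\mathbb{X},\ a\in A^*(x)\}$ is a Borel subset of $\mathbb{X}\times\mathbb{A}$; (c) a stationary policy $\phi$ is average-cost optimal and satisfies $( * )$ if $\phi(x)\in A^*(x)$ for all $x\in\mathbb{X}$; (d) there exists a stationary policy $\phi$ with $\phi(x)\in A_*(x)\subseteq A^*(x)$ for all $x\in\mathbb{X}$; (e) if, in addition, Assumption $(\mathbf{Wu})$ holds, then $u$ is inf-compact on $\mathbb{X}$. In addition, for a stationary policy $\phi$ satisfying $( * )$, $$w^\phi(x)=\underline{w}=\lim_{\alpha\uparrow1}(1-\alpha)v_\alpha(x)=\lim_{N\to\infty}\frac1N v_N^\phi(x),\qquad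 x\in\mathbb{X}.$$
   Context: **MDP.** The state space $\mathbb{X}$ and the action space $\mathbb{A}$ are Borel subsets of Polish spaces, with metrics $\rho$ and $\gamma$ respectively. For each $x\in\mathbb{X}$ a nonempty Borel set $A(x)\subseteq\mathbb{A}$ of available actions is given; $\mathrm{Gr}(A)=\{(x,a):x\in\mathbb{X},a\in A(x)\}$ is a Borel subset of $\mathbb{X}\times\mathbb{A}$, and there exists a Borel map $\phi:\mathbb{X}\to\mathbb{A}$ with $\phi(x)\in A(x)$ for all $x$. The one-step cost $c:\mathrm{Gr}(A)\to(-\infty,+\infty]$ is Borel and bounded below. The transition kernel $q$ is such that $q(\cdot|x,a)$ is a Borel probability measure on $\mathbb{X}$ for each $(x,a)$ and $q(B|\cdot,\cdot)$ is Borel on $\mathrm{Gr}(A)$ for each Borel $B\subseteq\mathbb{X}$. **Policies.** A policy $\pi=\{\pi_n\}_{n\ge0}$ is a sequence of regular transition probabilities $\pi_n$ from histories $h_n=(\xi_0,u_0,\dots,u_{n-1},\xi_n)\in(\mathbb{X}\times\mathbb{A})^n\times\mathbb{X}$ to $\mathbb{A}$ with $\pi_n(A(\xi_n)|h_n)=1$; $\Pi$ is the set of all policies. A stationary policy is a Borel map $\phi:\mathbb{X}\to\mathbb{A}$ with $\phi(x)\in A(x)$ for all $x$ (the action $\phi(\xi_n)$ is used at every time $n$). An initial state $x$ and a policy $\pi$ define a probability $P_x^\pi$ on trajectories $(\xi_0,u_0,\xi_1,u_1,\dots)$ with expectation $\mathbb{E}_x^\pi$. **Costs.** $v_{N,\alpha}^\pi(x)=\mathbb{E}_x^\pi\sum_{n=0}^{N-1}\alpha^n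 c(\xi_n,u_n)$ (with $\alpha^0=1$), $v_N^\pi=v_{N,1}^\pi$; for $\alpha\in[0,1)$, $v_\alpha^\pi(x)=\mathbb{E}_x^\pi\sum_{n=0}^{\infty}\alpha^n c(\xi_n,u_n)$; $w^\pi(x)=\limsup_{N\to\infty}\frac1N v_N^\pi(x)$. Optimal values: $v_\alpha(x)=\inf_{\pi\in\Pi}v_\alpha^\pi(x)$, $w(x)=\inf_{\pi\in\Pi}w^\pi(x)$. A policy $\pi$ is average-cost optimal if $w^\pi(x)=w(x)$ for all $x\in\mathbb{X}$. Set $w^*=\inf_{x\in\mathbb{X}}w(x)$ and, for $\alpha\in[0,1)$, $m_\alpha=\inf_{x\in\mathbb{X}}v_\alpha(x)$, $u_\alpha(x)=v_\alpha(x)-m_\alpha$, and $\underline{w}=\liminf_{\alpha\uparrow1}(1-\alpha)m_\alpha$, $\overline{w}=\limsup_{\alpha\uparrow1}(1-\alpha)m_\alpha$. **Semicontinuity.** An extended-real-valued function $f$ on a set $U$ is lower semi-continuous (resp. inf-compact) on $U$ if for every $\lambda\in\mathbb{R}$ the level set $\{y\in U:f(y)\le\lambda\}$ is closed in $U$ (resp. compact). **Assumption $(\mathbf{W^*})$:** (i) $c$ is lower semi-continuous and bounded below on $\mathrm{Gr}(A)$; (ii) if a sequence $\{x_n\}$ in $\mathbb{X}$ converges to $x\in\mathbb{X}$, then any sequence $\{a_n\}$ with $a_n\in A(x_n)$, such that $\{c(x_n,a_n)\}$ is bounded above, has a limit point (limit of a subsequence) $a\in A(x)$; (iii) $q(\cdot|x,a)$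 is weakly continuous in $(x,a)\in\mathrm{Gr}(A)$, i.e. $\int f(z)q(dz|x_k,a_k)\to\int f(z)q(dz|x,a)$ for every bounded continuous $f:\mathbb{X}\to\mathbb{R}$ whenever $(x_k,a_k)\to(x,a)$ in $\mathrm{Gr}(A)$. **Assumption $(\mathbf{Wu})$:** (i) $c$ is inf-compact on $\mathrm{Gr}(A)$; (ii) $q(\cdot|x,a)$ is weakly continuous in $(x,a)\in\mathrm{Gr}(A)$. **Assumption $(\mathbf{B})$:** (i) $w^*<+\infty$; (ii) $\sup_{\alpha\in[0,1)}u_\alpha(x)<\infty$ for all $x\in\mathbb{X}$. **The function $u$ and the action sets.** $$u(x)=\liminf_{\alpha\uparrow1,\,y\to x}u_\alpha(y):=\sup_{\beta\in[0,1),\,R>0}\ \inf\{u_\alpha(y):\alpha\in[\beta,1),\ y\in\mathbb{X},\ \rho(y,x)<R\},$$ $$A^*(x)=\Big\{a\in A(x):\ \overline{w}+u(x)\ge c(x,a)+\int_{\mathbb{X}}u(y)q(dy|x,a)\Big\},$$ $$A_*(x)=\Big\{a\in A(x):\ \inf_{b\in A(x)}\Big[c(x,b)+\int_{\mathbb{X}}u(y)q(dy|x,b)\Big]=c(x,a)+\int_{\mathbb{X}}u(y)q(dy|x,a)\Big\}.$$ *)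

theory Defs
  imports "HOL-Probability.Probability"
begin

text \<open>
  State and action spaces are Borel subsets of Polish spaces, given as sets over types of class
  \<^class>\<open>polish_space\<close>; the metrics are the restrictions of \<^const>\<open>dist\<close>.
\<close>

record ('x, 'a) mdp =
  states  :: "'x set"
  actions :: "'a set"
  avail   :: "'x \<Rightarrow> 'a set"
  cost    :: "'x \<times> 'a \<Rightarrow> ereal"
  kernel  :: "'x \<times> 'a \<Rightarrow> 'x measure"

abbreviation stateM :: "('x::polish_space, 'a::polish_space) mdp \<Rightarrow> 'x measure" where
  "stateM M \<equiv> restrict_space borel (states M)"

abbreviation actM :: "('x::polish_space, 'a::polish_space) mdp \<Rightarrow> 'a measure" where
  "actM M \<equiv> restrict_space borel (actions M)"

definition Gr :: "('x::polish_space, 'a::polish_space) mdp \<Rightarrow> ('x \<Rightarrow> 'a set) \<Rightarrow> ('x \<times> 'a) set" where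
  "Gr M B = {(x, a). x \<in> states M \<and> a \<in> B x}"

definition bounded_below_on :: "'b set \<Rightarrow> ('b \<Rightarrow> ereal) \<Rightarrow> bool" where
  "bounded_below_on U f \<longleftrightarrow> (\<exists>K::real. \<forall>y\<in>U. ereal K \<le> f y)"

definition lsc_on :: "'b::topological_space set \<Rightarrow> ('b \<Rightarrow> ereal) \<Rightarrow> bool" where
  "lsc_on U f \<longleftrightarrow> (\<forall>l::real. closedin (top_of_set U) {y \<in> U. f y \<le> ereal l})"

definition inf_compact_on :: "'b::topological_space set \<Rightarrow> ('b \<Rightarrow> ereal) \<Rightarrow> bool" where
  "inf_compact_on U f \<longleftrightarrow> (\<forall>l::real. compact {y \<in> U. f y \<le> ereal l})"

text \<open>
  Integral of an extended-real function, as integral of the positive part minus integral of the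
  negative part (\<^const>\<open>e2ennreal\<close> maps negative values to 0). In all uses the integrand
  is almost everywhere bounded below and the measure is finite, so the subtrahend is finite.
\<close>

definition eintegral :: "'b measure \<Rightarrow> ('b \<Rightarrow> ereal) \<Rightarrow> ereal" where
  "eintegral N f = enn2ereal (\<integral>\<^sup>+ y. e2ennreal (f y) \<partial>N) - enn2ereal (\<integral>\<^sup>+ y. e2ennreal (- f y) \<partial>N)"

definition stationary :: "('x::polish_space, 'a::polish_space) mdp \<Rightarrow> ('x \<Rightarrow> 'a) \<Rightarrow> bool" where
  "stationary M \<phi> \<longleftrightarrow> \<phi> \<in> stateM M \<rightarrow>\<^sub>M actM M \<and> (\<forall>x\<in>states M. \<phi> x \<in> avail M x)"

definition is_mdp :: "('x::polish_space, 'a::polish_space) mdp \<Rightarrow> bool" where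
  "is_mdp M \<longleftrightarrow>
     states M \<in> sets borel \<and> actions M \<in> sets borel \<and>
     (\<forall>x\<in>states M. avail M x \<noteq> {} \<and> avail M x \<subseteq> actions M \<and> avail M x \<in> sets borel) \<and>
     Gr M (avail M) \<in> sets (restrict_space borel (states M \<times> actions M)) \<and>
     (\<exists>\<phi>. stationary M \<phi>) \<and>
     cost M \<in> borel_measurable (restrict_space borel (Gr M (avail M))) \<and>
     bounded_below_on (Gr M (avail M)) (cost M) \<and>
     kernel M \<in> restrict_space borel (Gr M (avail M)) \<rightarrow>\<^sub>M prob_algebra (stateM M)"

text \<open>
  A history \<open>(\<xi>\<^sub>0, u\<^sub>0, \<dots>, u\<^bsub>n-1\<^esub>, \<xi>\<^sub>n)\<close> is a pair of the function
  \<open>i \<mapsto> (\<xi>\<^sub>i, u\<^sub>i)\<close> on \<open>{0..<n}\<close> and the current state \<open>\<xi>\<^sub>n\<close>.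
\<close>

type_synonym ('x, 'a) policy = "nat \<Rightarrow> (nat \<Rightarrow> 'x \<times> 'a) \<times> 'x \<Rightarrow> 'a measure"

definition histM :: "('x::polish_space, 'a::polish_space) mdp \<Rightarrow> nat \<Rightarrow> ((nat \<Rightarrow> 'x \<times> 'a) \<times> 'x) measure" where
  "histM M n = PiM {0..<n} (\<lambda>_. stateM M \<Otimes>\<^sub>M actM M) \<Otimes>\<^sub>M stateM M"

definition policies :: "('x::polish_space, 'a::polish_space) mdp \<Rightarrow> ('x, 'a) policy set" where
  "policies M = {\<pi>. \<forall>n. \<pi> n \<in> histM M n \<rightarrow>\<^sub>M prob_algebra (actM M) \<and>
     (\<forall>(h, x) \<in> space (histM M n). emeasure (\<pi> n (h, x)) (avail M x) = 1)}"

definition stat_policy :: "('x::polish_space, 'a::polish_space) mdp \<Rightarrow> ('x \<Rightarrow> 'a) \<Rightarrow> ('x, 'a) policy" where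
  "stat_policy M \<phi> = (\<lambda>n (h, x). return (actM M) (\<phi> x))"

lemma stat_policy_in_policies:
  fixes M :: "('x::polish_space, 'a::polish_space) mdp"
  assumes "is_mdp M" "stationary M \<phi>"
  shows "stat_policy M \<phi> \<in> policies M"
proof -
  have \<phi>: "\<phi> \<in> stateM M \<rightarrow>\<^sub>M actM M" "\<And>x. x \<in> states M \<Longrightarrow> \<phi> x \<in> avail M x"
    using assms(2) by (auto simp: stationary_def)
  have "stat_policy M \<phi> n \<in> histM M n \<rightarrow>\<^sub>M prob_algebra (actM M)" for n
    unfolding stat_policy_def histM_def case_prod_beta
    by (intro measurable_compose[OF _ measurable_return_prob_space] measurable_compose[OF measurable_snd \<phi>(1)])
  moreover have "emeasure (stat_policy M \<phi> n (h, x)) (avail M x) = 1"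
    if "(h, x) \<in> space (histM M n)" for n h x
  proof -
    have x: "x \<in> states M" using that by (auto simp: histM_def space_pair_measure space_restrict_space)
    then have "avail M x \<in> sets (actM M)"
      using assms(1) by (auto simp: is_mdp_def sets_restrict_space)
    then show ?thesis using \<phi>(2)[OF x] by (simp add: stat_policy_def)
  qed
  ultimately show ?thesis by (auto simp: policies_def)
qed

text \<open>
  The Ionescu Tulcea construction needs kernels on the whole of \<open>states M \<times> actions M\<close>, but the
  transition kernel is given on the graph of \<^const>\<open>avail\<close> only. Outside the graph it is
  replaced by a Dirac measure; no policy reaches such pairs with positive probability.
\<close>

definition ext_kernel :: "('x::polish_space, 'a::polish_space) mdp \<Rightarrow> 'x \<times> 'a \<Rightarrow> 'x measure" where
  "ext_kernel M z = (if z \<in> Gr M (avail M) then kernel M z else return (stateM M) (fst z))"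

definition state_step :: "('x::polish_space, 'a::polish_space) mdp \<Rightarrow> 'x \<Rightarrow> nat \<Rightarrow> (nat \<Rightarrow> 'x \<times> 'a) \<Rightarrow> 'x measure" where
  "state_step M x n h = (if n = 0 then return (stateM M) x else ext_kernel M (h (n - 1)))"

text \<open>Conditional law of \<open>(\<xi>\<^sub>n, u\<^sub>n)\<close> given the first \<open>n\<close> state-action pairs.\<close>

definition step :: "('x::polish_space, 'a::polish_space) mdp \<Rightarrow> ('x, 'a) policy \<Rightarrow> 'x \<Rightarrow>
    nat \<Rightarrow> (nat \<Rightarrow> 'x \<times> 'a) \<Rightarrow> ('x \<times> 'a) measure" where
  "step M \<pi> x n h = bind (state_step M x n h)
     (\<lambda>y. bind (\<pi> n (h, y)) (\<lambda>a. return (stateM M \<Otimes>\<^sub>M actM M) (y, a)))"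

lemma sets_stateM_actM:
  fixes M :: "('x::polish_space, 'a::polish_space) mdp"
  shows "sets (stateM M \<Otimes>\<^sub>M actM M) = sets (restrict_space borel (states M \<times> actions M))"
proof
  have id: "(\<lambda>z. z) \<in> restrict_space borel (states M \<times> actions M) \<rightarrow>\<^sub>M stateM M \<Otimes>\<^sub>M actM M"
    unfolding borel_prod[symmetric]
    by (rule measurable_pair; unfold comp_def; intro measurable_restrict_space2 measurable_restrict_space1)
      (auto simp: space_restrict_space)
  show "sets (stateM M \<Otimes>\<^sub>M actM M) \<subseteq> sets (restrict_space borel (states M \<times> actions M))"
  proof
    fix A assume A: "A \<in> sets (stateM M \<Otimes>\<^sub>M actM M)"
    then have "A \<subseteq> states M \<times> actions M"
      using sets.sets_into_space[OF A] by (simp add: space_pair_measure space_restrict_space)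
    with measurable_sets[OF id A] show "A \<in> sets (restrict_space borel (states M \<times> actions M))"
      by (simp add: space_restrict_space Int_absorb2)
  qed
  have "(\<lambda>z. z) \<in> stateM M \<Otimes>\<^sub>M actM M \<rightarrow>\<^sub>M borel \<Otimes>\<^sub>M borel"
  proof (rule measurable_pair)
    show "fst \<circ> (\<lambda>z. z) \<in> stateM M \<Otimes>\<^sub>M actM M \<rightarrow>\<^sub>M borel"
      using measurable_comp[OF measurable_fst[of "stateM M" "actM M"], of "\<lambda>x. x" borel]
      by (simp add: comp_def measurable_restrict_space1)
    show "snd \<circ> (\<lambda>z. z) \<in> stateM M \<Otimes>\<^sub>M actM M \<rightarrow>\<^sub>M borel"
      using measurable_comp[OF measurable_snd[of "stateM M" "actM M"], of "\<lambda>x. x" borel]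
      by (simp add: comp_def measurable_restrict_space1)
  qed
  then have id': "(\<lambda>z. z) \<in> stateM M \<Otimes>\<^sub>M actM M \<rightarrow>\<^sub>M restrict_space borel (states M \<times> actions M)"
    by (intro measurable_restrict_space2) (auto simp: borel_prod space_pair_measure space_restrict_space)
  show "sets (restrict_space borel (states M \<times> actions M)) \<subseteq> sets (stateM M \<Otimes>\<^sub>M actM M)"
  proof
    fix A assume A: "A \<in> sets (restrict_space borel (states M \<times> actions M))"
    then have "A \<subseteq> states M \<times> actions M"
      using sets.sets_into_space[OF A] by (simp add: space_restrict_space)
    with measurable_sets[OF id' A] show "A \<in> sets (stateM M \<Otimes>\<^sub>M actM M)"
      by (simp add: space_pair_measure space_restrict_space Int_absorb2)
  qed
qed

lemma ext_kernel_measurable: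
  fixes M :: "('x::polish_space, 'a::polish_space) mdp"
  assumes "is_mdp M"
  shows "ext_kernel M \<in> stateM M \<Otimes>\<^sub>M actM M \<rightarrow>\<^sub>M prob_algebra (stateM M)"
proof -
  let ?S = "restrict_space borel (states M \<times> actions M) :: ('x \<times> 'a) measure"
  let ?G = "Gr M (avail M)"
  have G: "?G \<in> sets ?S" and k: "kernel M \<in> restrict_space borel ?G \<rightarrow>\<^sub>M prob_algebra (stateM M)"
    using assms by (auto simp: is_mdp_def)
  have sub: "?G \<subseteq> states M \<times> actions M"
    using sets.sets_into_space[OF G] by (simp add: space_restrict_space)
  have B: "{z \<in> space ?S. z \<in> ?G} = ?G" using sub by (auto simp: space_restrict_space)
  have 1: "kernel M \<in> restrict_space ?S ?G \<rightarrow>\<^sub>M prob_algebra (stateM M)"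
    using k sub by (subst measurable_cong_sets[OF sets_restrict_restrict_space refl])
      (simp add: Int_absorb1)
  have "fst \<in> ?S \<rightarrow>\<^sub>M stateM M"
    by (subst measurable_cong_sets[OF sets_stateM_actM[symmetric] refl]) simp
  then have 2: "(\<lambda>z. return (stateM M) (fst z)) \<in> ?S \<rightarrow>\<^sub>M prob_algebra (stateM M)"
    by (rule measurable_compose[OF _ measurable_return_prob_space])
  have "(\<lambda>z. if z \<in> ?G then kernel M z else return (stateM M) (fst z)) \<in> ?S \<rightarrow>\<^sub>M prob_algebra (stateM M)"
    using 1 2 G by (subst measurable_If_restrict_space_iff) (auto simp: B intro: measurable_restrict_space1)
  then show ?thesis
    by (subst measurable_cong_sets[OF sets_stateM_actM refl])
      (simp add: ext_kernel_def[abs_def])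
qed

lemma step_measurable:
  fixes M :: "('x::polish_space, 'a::polish_space) mdp"
  assumes "is_mdp M" "\<pi> \<in> policies M" "x \<in> states M"
  shows "step M \<pi> x n \<in> PiM {0..<n} (\<lambda>_. stateM M \<Otimes>\<^sub>M actM M) \<rightarrow>\<^sub>M prob_algebra (stateM M \<Otimes>\<^sub>M actM M)"
proof -
  let ?Z = "stateM M \<Otimes>\<^sub>M actM M"
  let ?H = "PiM {0..<n} (\<lambda>_. ?Z)"
  have s: "state_step M x n \<in> ?H \<rightarrow>\<^sub>M prob_algebra (stateM M)"
  proof (cases "n = 0")
    case True
    have "return (stateM M) x \<in> space (prob_algebra (stateM M))"
      using assms(3) by (intro measurable_space[OF measurable_return_prob_space]) (simp add: space_restrict_space)
    then show ?thesis using True by (simp add: state_step_def[abs_def])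
  next
    case False
    then have "(\<lambda>h. h (n - 1)) \<in> ?H \<rightarrow>\<^sub>M ?Z" by (intro measurable_component_singleton) auto
    from measurable_compose[OF this ext_kernel_measurable[OF assms(1)]] False
    show ?thesis by (simp add: state_step_def[abs_def])
  qed
  have p: "\<pi> n \<in> ?H \<Otimes>\<^sub>M stateM M \<rightarrow>\<^sub>M prob_algebra (actM M)"
    using assms(2) by (auto simp: policies_def histM_def)
  have i: "(\<lambda>w. bind (\<pi> n w) (\<lambda>a. return ?Z (snd w, a))) \<in> ?H \<Otimes>\<^sub>M stateM M \<rightarrow>\<^sub>M prob_algebra ?Z"
    by (rule measurable_bind_prob_space2[OF p])
      (auto simp: case_prod_beta intro!: measurable_compose[OF _ measurable_return_prob_space])
  show ?thesis unfolding step_def[abs_def]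
    by (rule measurable_bind_prob_space2[OF s]) (use i in \<open>simp add: case_prod_unfold\<close>)
qed

lemma Ionescu_Tulcea_step:
  fixes M :: "('x::polish_space, 'a::polish_space) mdp"
  assumes "is_mdp M" "\<pi> \<in> policies M" "x \<in> states M"
  shows "Ionescu_Tulcea (step M \<pi> x) (\<lambda>_. stateM M \<Otimes>\<^sub>M actM M)"
  unfolding Ionescu_Tulcea_def
  using step_measurable[OF assms] measurable_space[OF step_measurable[OF assms]]
  by (auto intro!: measurable_prob_algebraD simp: space_prob_algebra)

text \<open>
  The measure \<open>P\<^sub>x\<^sup>\<pi>\<close> on trajectories \<open>n \<mapsto> (\<xi>\<^sub>n, u\<^sub>n)\<close>, i.e. the limit measure of the library's
  locale \<^locale>\<open>Ionescu_Tulcea\<close> for the kernels \<^const>\<open>step\<close>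
  (whose assumptions hold by \<open>Ionescu_Tulcea_step\<close>).
\<close>

definition trajM :: "('x::polish_space, 'a::polish_space) mdp \<Rightarrow> ('x, 'a) policy \<Rightarrow> 'x \<Rightarrow> (nat \<Rightarrow> 'x \<times> 'a) measure" where
  "trajM M \<pi> x = projective_family.lim UNIV
     (Ionescu_Tulcea.CI (step M \<pi> x) (\<lambda>_. stateM M \<Otimes>\<^sub>M actM M)) (\<lambda>_. stateM M \<Otimes>\<^sub>M actM M)"

definition fin_cost :: "('x::polish_space, 'a::polish_space) mdp \<Rightarrow> nat \<Rightarrow> real \<Rightarrow> ('x, 'a) policy \<Rightarrow> 'x \<Rightarrow> ereal" where
  "fin_cost M N \<alpha> \<pi> x = eintegral (trajM M \<pi> x) (\<lambda>\<omega>. \<Sum>n<N. ereal (\<alpha> ^ n) * cost M (\<omega> n))"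

definition disc_cost :: "('x::polish_space, 'a::polish_space) mdp \<Rightarrow> real \<Rightarrow> ('x, 'a) policy \<Rightarrow> 'x \<Rightarrow> ereal" where
  "disc_cost M \<alpha> \<pi> x = eintegral (trajM M \<pi> x) (\<lambda>\<omega>. \<Sum>n. ereal (\<alpha> ^ n) * cost M (\<omega> n))"

definition avg_cost :: "('x::polish_space, 'a::polish_space) mdp \<Rightarrow> ('x, 'a) policy \<Rightarrow> 'x \<Rightarrow> ereal" where
  "avg_cost M \<pi> x = limsup (\<lambda>N. fin_cost M N 1 \<pi> x / ereal (real N))"

definition disc_value :: "('x::polish_space, 'a::polish_space) mdp \<Rightarrow> real \<Rightarrow> 'x \<Rightarrow> ereal" where
  "disc_value M \<alpha> x = (INF \<pi>\<in>policies M. disc_cost M \<alpha> \<pi> x)"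

definition avg_value :: "('x::polish_space, 'a::polish_space) mdp \<Rightarrow> 'x \<Rightarrow> ereal" where
  "avg_value M x = (INF \<pi>\<in>policies M. avg_cost M \<pi> x)"

definition avg_optimal :: "('x::polish_space, 'a::polish_space) mdp \<Rightarrow> ('x, 'a) policy \<Rightarrow> bool" where
  "avg_optimal M \<pi> \<longleftrightarrow> \<pi> \<in> policies M \<and> (\<forall>x\<in>states M. avg_cost M \<pi> x = avg_value M x)"

definition w_star :: "('x::polish_space, 'a::polish_space) mdp \<Rightarrow> ereal" where
  "w_star M = (INF x\<in>states M. avg_value M x)"

definition m_disc :: "('x::polish_space, 'a::polish_space) mdp \<Rightarrow> real \<Rightarrow> ereal" where
  "m_disc M \<alpha> = (INF x\<in>states M. disc_value M \<alpha> x)"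

definition u_disc :: "('x::polish_space, 'a::polish_space) mdp \<Rightarrow> real \<Rightarrow> 'x \<Rightarrow> ereal" where
  "u_disc M \<alpha> x = disc_value M \<alpha> x - m_disc M \<alpha>"

definition w_lower :: "('x::polish_space, 'a::polish_space) mdp \<Rightarrow> ereal" where
  "w_lower M = Liminf (at_left 1) (\<lambda>\<alpha>. ereal (1 - \<alpha>) * m_disc M \<alpha>)"

definition w_upper :: "('x::polish_space, 'a::polish_space) mdp \<Rightarrow> ereal" where
  "w_upper M = Limsup (at_left 1) (\<lambda>\<alpha>. ereal (1 - \<alpha>) * m_disc M \<alpha>)"

definition weakly_continuous_kernel :: "('x::polish_space, 'a::polish_space) mdp \<Rightarrow> bool" where
  "weakly_continuous_kernel M \<longleftrightarrow>
     (\<forall>f::'x \<Rightarrow> real. continuous_on (states M) f \<and> bounded (f ` states M) \<longrightarrow>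
       (\<forall>Z z. (\<forall>k. Z k \<in> Gr M (avail M)) \<and> z \<in> Gr M (avail M) \<and> Z \<longlonglongrightarrow> z \<longrightarrow>
         (\<lambda>k. \<integral>y. f y \<partial>kernel M (Z k)) \<longlonglongrightarrow> (\<integral>y. f y \<partial>kernel M z)))"

definition assumption_W_star :: "('x::polish_space, 'a::polish_space) mdp \<Rightarrow> bool" where
  "assumption_W_star M \<longleftrightarrow>
     lsc_on (Gr M (avail M)) (cost M) \<and> bounded_below_on (Gr M (avail M)) (cost M) \<and>
     (\<forall>X x A. (\<forall>n. X n \<in> states M) \<and> x \<in> states M \<and> X \<longlonglongrightarrow> x \<and>
        (\<forall>n. A n \<in> avail M (X n)) \<and> (\<exists>K::real. \<forall>n. cost M (X n, A n) \<le> ereal K) \<longrightarrow>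
        (\<exists>a\<in>avail M x. \<exists>r::nat \<Rightarrow> nat. strict_mono r \<and> (A \<circ> r) \<longlonglongrightarrow> a)) \<and>
     weakly_continuous_kernel M"

definition assumption_Wu :: "('x::polish_space, 'a::polish_space) mdp \<Rightarrow> bool" where
  "assumption_Wu M \<longleftrightarrow> inf_compact_on (Gr M (avail M)) (cost M) \<and> weakly_continuous_kernel M"

definition assumption_B :: "('x::polish_space, 'a::polish_space) mdp \<Rightarrow> bool" where
  "assumption_B M \<longleftrightarrow> w_star M < \<infinity> \<and> (\<forall>x\<in>states M. (SUP \<alpha>\<in>{0..<1}. u_disc M \<alpha> x) < \<infinity>)"

definition u_fun :: "('x::polish_space, 'a::polish_space) mdp \<Rightarrow> 'x \<Rightarrow> ereal" where
  "u_fun M x = (SUP (\<beta>, R) \<in> {0..<1} \<times> {0<..}.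
     INF (\<alpha>, y) \<in> {\<beta>..<1} \<times> {y \<in> states M. dist y x < R}. u_disc M \<alpha> y)"

definition one_step :: "('x::polish_space, 'a::polish_space) mdp \<Rightarrow> 'x \<Rightarrow> 'a \<Rightarrow> ereal" where
  "one_step M x a = cost M (x, a) + eintegral (kernel M (x, a)) (u_fun M)"

text \<open>\<open>A_sup_star\<close> is \<open>A\<^sup>*(x)\<close> and \<open>A_sub_star\<close> is \<open>A\<^sub>*(x)\<close>.\<close>

definition A_sup_star :: "('x::polish_space, 'a::polish_space) mdp \<Rightarrow> 'x \<Rightarrow> 'a set" where
  "A_sup_star M x = {a \<in> avail M x. w_upper M + u_fun M x \<ge> one_step M x a}"

definition A_sub_star :: "('x::polish_space, 'a::polish_space) mdp \<Rightarrow> 'x \<Rightarrow> 'a set" where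
  "A_sub_star M x = {a \<in> avail M x. (INF b\<in>avail M x. one_step M x b) = one_step M x a}"

text \<open>The average-cost optimality inequality.\<close>

definition acoi :: "('x::polish_space, 'a::polish_space) mdp \<Rightarrow> ('x \<Rightarrow> 'a) \<Rightarrow> bool" where
  "acoi M \<phi> \<longleftrightarrow> (\<forall>x\<in>states M. w_upper M + u_fun M x \<ge> one_step M x (\<phi> x))"

end

theory Submission
  imports Defs
begin

text \<open>
  The proof is by vanishing discount. A lower bound \<open>K\<close> of the cost is subtracted, so that all costs
  become nonnegative and expectations become nonnegative integrals.

  For a discount factor \<open>\<alpha>\<close> the value \<open>v\<^sub>\<alpha>\<close> satisfies \<open>v\<^sub>\<alpha>(x) \<ge> c(x,a) + \<alpha> \<integral> v\<^sub>\<alpha> dq(x,a)\<close> for some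
  action \<open>a\<close>; in terms of \<open>u\<^sub>\<alpha> = v\<^sub>\<alpha> - m\<^sub>\<alpha>\<close> this reads
  \<open>(1 - \<alpha>) m\<^sub>\<alpha> + u\<^sub>\<alpha>(y) \<ge> c(y,a) + \<alpha> \<integral> u\<^sub>\<alpha> dq(y,a)\<close> (\<open>rel_value_superharmonic\<close>).
  Let \<open>\<alpha> \<rightarrow> 1\<close> and \<open>y \<rightarrow> x\<close> so that \<open>u\<^sub>\<alpha>(y) \<rightarrow> u(x)\<close>. The costs of the chosen actions stay bounded, so
  these actions have a limit point in \<open>A(x)\<close>; lower semicontinuity of \<open>c\<close> and a Fatou lemma for weakly
  convergent measures (\<open>weak_liminf_nn_integral\<close>) turn the inequality into the optimality inequality
  with the constant \<open>limsup (1 - \<alpha>) m\<^sub>\<alpha>\<close> (\<open>acoi_rel_lim\<close>).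

  Iterating the optimality inequality along a stationary policy bounds its cost over \<open>N\<close> steps by
  \<open>N w + u(x)\<close>, where \<open>w\<close> is that constant, so its average cost is at most \<open>w\<close>. Conversely Abel means
  are bounded by upper Cesaro means, so \<open>w\<close> is a lower bound of the average cost of every policy
  from every state (\<open>w_upper_le_avg_cost\<close>). Hence all the quantities in question coincide.

  The passage to the limit can be restricted to a set \<open>D\<close> of discount factors that accumulates at 1.
  For \<open>D\<close> consisting of those with \<open>(1 - \<alpha>) m\<^sub>\<alpha> < liminf + \<epsilon>\<close> it yields a stationary policy
  of average cost at most \<open>liminf + \<epsilon>\<close>, and therefore \<open>liminf = limsup\<close> (\<open>w_lower_eq_w_upper\<close>).
  For a stationary policy that satisfies the optimality inequality the Abel means of the expected
  costs then converge to the upper Cesaro limit, and a Karamata type argument (\<open>cesaro_ge_of_abel_ge\<close>) gives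
  convergence of the Cesaro means.

  The discounted inequality is obtained from value iteration started at 0. The comparison with
  arbitrary history dependent policies uses only the law of a single transition, so that
  no conditioning on the first step is needed. All the minima over actions exist, are lower
  semicontinuous in the state and have measurable minimizers, by one compactness property of the
  one-step costs (\<open>K_inf_compact\<close>).
\<close>

section \<open>Lower semicontinuity along sequences\<close>

text \<open>
  The sequential form suits compactness arguments, and on metric spaces it is equivalent to closedness
  of the sublevel sets. Values are in \<^typ>\<open>ennreal\<close> because costs and value functions are nonnegative once the
  lower bound of the cost has been subtracted.
\<close>

definition lsc_seq :: "'b::topological_space set \<Rightarrow> ('b \<Rightarrow> ennreal) \<Rightarrow> bool" where
  "lsc_seq S f \<longleftrightarrow> (\<forall>X x. (\<forall>n. X n \<in> S) \<and> x \<in> S \<and> X \<longlonglongrightarrow> x \<longrightarrow> f x \<le> liminf (\<lambda>n. f (X n)))"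

lemma lsc_seqD:
  "lsc_seq S f \<Longrightarrow> (\<And>n. X n \<in> S) \<Longrightarrow> x \<in> S \<Longrightarrow> X \<longlonglongrightarrow> x \<Longrightarrow> f x \<le> liminf (\<lambda>n. f (X n))"
  unfolding lsc_seq_def by blast

lemma lsc_seqI:
  assumes "\<And>X x t. (\<And>n. X n \<in> S) \<Longrightarrow> x \<in> S \<Longrightarrow> X \<longlonglongrightarrow> x \<Longrightarrow> t < f x \<Longrightarrow> \<forall>\<^sub>F n in sequentially. t < f (X n)"
  shows "lsc_seq S f"
  unfolding lsc_seq_def le_Liminf_iff using assms by blast

lemma lsc_seq_eventually:
  assumes "lsc_seq S f" "\<And>n. X n \<in> S" "x \<in> S" "X \<longlonglongrightarrow> x" "t < f x"
  shows "\<forall>\<^sub>F n in sequentially. t < f (X n)"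
  using lsc_seqD[OF assms(1-4)] assms(5) unfolding le_Liminf_iff by blast

lemma lsc_seq_const: "lsc_seq S (\<lambda>x. c)"
  by (rule lsc_seqI) simp

lemma lsc_seq_SUP:
  assumes "\<And>i. i \<in> I \<Longrightarrow> lsc_seq S (f i)"
  shows "lsc_seq S (\<lambda>x. SUP i\<in>I. f i x)"
proof (rule lsc_seqI)
  fix X x t assume X: "\<And>n. X n \<in> S" "x \<in> S" "X \<longlonglongrightarrow> x" and "t < (SUP i\<in>I. f i x)"
  then obtain i where i: "i \<in> I" "t < f i x" by (auto simp: less_SUP_iff)
  from lsc_seq_eventually[OF assms[OF i(1)] X i(2)]
  show "\<forall>\<^sub>F n in sequentially. t < (SUP i\<in>I. f i (X n))"
    by eventually_elim (use i in \<open>auto simp: less_SUP_iff\<close>)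
qed

lemma lsc_seq_cong: "(\<And>x. x \<in> U \<Longrightarrow> f x = h x) \<Longrightarrow> lsc_seq U f \<longleftrightarrow> lsc_seq U h"
  unfolding lsc_seq_def by simp

lemma liminf_add_le_ennreal:
  fixes f g :: "nat \<Rightarrow> ennreal"
  shows "liminf f + liminf g \<le> liminf (\<lambda>n. f n + g n)"
  including ennreal.lifting
  by transfer (rule Liminf_add_le, auto)

lemma lsc_seq_add:
  assumes "lsc_seq S f" "lsc_seq S g"
  shows "lsc_seq S (\<lambda>x. f x + g x)"
  unfolding lsc_seq_def
proof (intro allI impI)
  fix X x assume "(\<forall>n. X n \<in> S) \<and> x \<in> S \<and> X \<longlonglongrightarrow> x"
  then have "f x + g x \<le> liminf (\<lambda>n. f (X n)) + liminf (\<lambda>n. g (X n))"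
    by (intro add_mono lsc_seqD[OF assms(1)] lsc_seqD[OF assms(2)]) auto
  also have "\<dots> \<le> liminf (\<lambda>n. f (X n) + g (X n))" by (rule liminf_add_le_ennreal)
  finally show "f x + g x \<le> liminf (\<lambda>n. f (X n) + g (X n))" .
qed

lemma lsc_seq_cmult:
  assumes "lsc_seq S f"
  shows "lsc_seq S (\<lambda>x. ennreal c * f x)"
  unfolding lsc_seq_def
proof (intro allI impI)
  fix X x assume "(\<forall>n. X n \<in> S) \<and> x \<in> S \<and> X \<longlonglongrightarrow> x"
  then have "ennreal c * f x \<le> ennreal c * liminf (\<lambda>n. f (X n))"
    by (intro mult_left_mono lsc_seqD[OF assms]) auto
  also have "\<dots> = liminf (\<lambda>n. ennreal c * f (X n))"
    by (rule Liminf_compose_continuous_mono[symmetric])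
      (auto simp: mono_def continuous_on_def mult_left_mono intro!: ennreal_tendsto_cmult)
  finally show "ennreal c * f x \<le> liminf (\<lambda>n. ennreal c * f (X n))" .
qed

lemma lsc_seq_closedin:
  fixes S :: "'b::metric_space set"
  assumes "lsc_seq S f"
  shows "closedin (top_of_set S) {y \<in> S. f y \<le> c}"
proof -
  have "x \<in> {y \<in> S. f y \<le> c}" if x: "x \<in> S" "x \<in> closure {y \<in> S. f y \<le> c}" for x
  proof -
    obtain X where X: "\<And>n. X n \<in> {y \<in> S. f y \<le> c}" "X \<longlonglongrightarrow> x"
      using x(2) unfolding closure_sequential by blast
    then have "f x \<le> liminf (\<lambda>n. f (X n))" by (intro lsc_seqD[OF assms]) (use x in auto)
    also have "\<dots> \<le> liminf (\<lambda>n. c)" by (intro Liminf_mono always_eventually) (use X in auto)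
    finally show ?thesis using x by (simp add: Liminf_const)
  qed
  then have "{y \<in> S. f y \<le> c} = S \<inter> closure {y \<in> S. f y \<le> c}"
    using closure_subset[of "{y \<in> S. f y \<le> c}"] by blast
  then show ?thesis unfolding closedin_closed by blast
qed

lemma closedin_sets_restrict_borel:
  assumes "closedin (top_of_set S) A"
  shows "A \<in> sets (restrict_space borel S)"
  using assms by (auto simp: closedin_closed sets_restrict_space)

lemma lsc_seq_measurable:
  fixes S :: "'b::metric_space set"
  assumes "lsc_seq S f"
  shows "f \<in> borel_measurable (restrict_space borel S)"
proof (rule borel_measurableI_le)
  fix c
  have "{x \<in> space (restrict_space borel S). f x \<le> c} = {y \<in> S. f y \<le> c}"
    by (auto simp: space_restrict_space)
  then show "{x \<in> space (restrict_space borel S). f x \<le> c} \<in> sets (restrict_space borel S)"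
    using closedin_sets_restrict_borel[OF lsc_seq_closedin[OF assms]] by simp
qed

text \<open>
  The largest lower semicontinuous minorant of \<open>f\<close> on \<open>S\<close>. The limit inferior over discount factors
  and nearby states is a supremum of such envelopes.
\<close>

definition lsc_env :: "'b::metric_space set \<Rightarrow> ('b \<Rightarrow> ennreal) \<Rightarrow> 'b \<Rightarrow> ennreal" where
  "lsc_env S f x = (SUP R\<in>{0<..}. INF y\<in>{y\<in>S. dist y x < R}. f y)"

lemma lsc_env_le:
  assumes "x \<in> S"
  shows "lsc_env S f x \<le> f x"
  unfolding lsc_env_def using assms by (intro SUP_least INF_lower) auto

lemma lsc_env_lsc: "lsc_seq S (lsc_env S f)"
proof (rule lsc_seqI)
  fix X x t assume X: "\<And>n. X n \<in> S" "x \<in> S" "X \<longlonglongrightarrow> x" and "t < lsc_env S f x"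
  then obtain R :: real where R: "R > 0" "t < (INF y\<in>{y\<in>S. dist y x < R}. f y)"
    by (auto simp: lsc_env_def less_SUP_iff)
  have "\<forall>\<^sub>F n in sequentially. dist (X n) x < R / 2"
    using tendstoD[OF X(3), of "R/2"] R by simp
  then show "\<forall>\<^sub>F n in sequentially. t < lsc_env S f (X n)"
  proof eventually_elim
    case (elim n)
    have "(INF y\<in>{y\<in>S. dist y x < R}. f y) \<le> (INF y\<in>{y\<in>S. dist y (X n) < R / 2}. f y)"
    proof (rule INF_superset_mono)
      show "{y \<in> S. dist y (X n) < R / 2} \<subseteq> {y \<in> S. dist y x < R}"
      proof
        fix y assume "y \<in> {y \<in> S. dist y (X n) < R / 2}"
        with elim dist_triangle[of y x "X n"] show "y \<in> {y \<in> S. dist y x < R}" by auto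
      qed
    qed simp
    also have "\<dots> \<le> lsc_env S f (X n)"
      unfolding lsc_env_def using R(1) by (intro SUP_upper) auto
    finally show ?case using R by auto
  qed
qed

lemma lsc_env_mono: "(\<And>y. y \<in> S \<Longrightarrow> f y \<le> h y) \<Longrightarrow> lsc_env S f x \<le> lsc_env S h x"
  unfolding lsc_env_def by (intro SUP_mono' INF_mono bexI) auto

section \<open>Weak convergence and lower semicontinuous integrands\<close>

lemma INF_const_add_ennreal:
  fixes f :: "'i \<Rightarrow> ennreal"
  assumes "I \<noteq> {}"
  shows "(INF i\<in>I. c + f i) = c + (INF i\<in>I. f i)"
  using continuous_at_Inf_mono[of "\<lambda>x. c + x" "f ` I"] assms
    continuous_add[of "at_right (Inf (f ` I))" "\<lambda>x. c" "\<lambda>x. x"]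
  by (auto simp: mono_def image_comp add_left_mono)

text \<open>
  Pasch-Hausdorff approximation, truncated at \<open>k\<close> so that it is a bounded Lipschitz function and can
  be used as a test function for weak convergence.
\<close>

definition lip_approx :: "'b::metric_space set \<Rightarrow> ('b \<Rightarrow> ennreal) \<Rightarrow> nat \<Rightarrow> 'b \<Rightarrow> ennreal" where
  "lip_approx S f k x = min (of_nat k) (INF y\<in>S. f y + ennreal (real k * dist x y))"

lemma lip_approx_finite: "lip_approx S f k x < top"
  by (auto simp: lip_approx_def min_less_iff_disj of_nat_less_top)

lemma lip_approx_le: "x \<in> S \<Longrightarrow> lip_approx S f k x \<le> f x"
  unfolding lip_approx_def by (rule min.coboundedI2, rule INF_lower2[of x]) auto

lemma lip_approx_mono:
  assumes "k \<le> l"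
  shows "lip_approx S f k x \<le> lip_approx S f l x"
  unfolding lip_approx_def
  by (intro min.mono INF_mono') (use assms in \<open>auto intro!: add_mono ennreal_leI mult_right_mono\<close>)

lemma lip_approx_lipschitz: "lip_approx S f k x \<le> lip_approx S f k x' + ennreal (real k * dist x x')"
proof -
  let ?d = "ennreal (real k * dist x x')"
  have "(INF y\<in>S. f y + ennreal (real k * dist x y)) \<le> (INF y\<in>S. f y + ennreal (real k * dist x' y)) + ?d"
  proof (cases "S = {}")
    case False
    have "(INF y\<in>S. f y + ennreal (real k * dist x y)) \<le> (INF y\<in>S. ?d + (f y + ennreal (real k * dist x' y)))"
    proof (intro INF_mono')
      fix y
      have "ennreal (real k * dist x y) \<le> ennreal (real k * dist x x' + real k * dist x' y)"
        by (intro ennreal_leI) (simp add: dist_triangle mult_left_mono flip: distrib_left)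
      then show "f y + ennreal (real k * dist x y) \<le> ?d + (f y + ennreal (real k * dist x' y))"
        by (simp add: ac_simps add_left_mono flip: ennreal_plus)
    qed
    also have "\<dots> = ?d + (INF y\<in>S. f y + ennreal (real k * dist x' y))"
      using False by (simp add: INF_const_add_ennreal)
    finally show ?thesis by (simp add: ac_simps)
  qed simp
  then show ?thesis
    unfolding lip_approx_def
    by (auto simp: min_def intro: order_trans add_increasing2)
qed

lemma lip_approx_continuous:
  "continuous_on S (\<lambda>x. enn2real (lip_approx S f k x))"
proof -
  have *: "enn2real (lip_approx S f k x) \<le> enn2real (lip_approx S f k x') + real k * dist x x'" for x x'
  proof -
    have "enn2real (lip_approx S f k x) \<le> enn2real (lip_approx S f k x' + ennreal (real k * dist x x'))"
      by (intro enn2real_mono lip_approx_lipschitz) (simp add: lip_approx_finite)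
    then show ?thesis by (simp add: enn2real_plus lip_approx_finite)
  qed
  have "lipschitz_on (real k) S (\<lambda>x. enn2real (lip_approx S f k x))"
  proof (rule lipschitz_onI)
    fix x y
    show "dist (enn2real (lip_approx S f k x)) (enn2real (lip_approx S f k y)) \<le> real k * dist x y"
      using *[of x y] *[of y x] by (auto simp: dist_real_def dist_commute abs_le_iff)
  qed simp
  then show ?thesis by (rule lipschitz_on_continuous_on)
qed

text \<open>
  Below a level \<open>t < f x\<close> the function \<open>f\<close> can only fall outside some ball around \<open>x\<close>, and there
  the penalty \<open>k * dist x y\<close> exceeds \<open>t\<close> once \<open>k\<close> is large.
\<close>

lemma lip_approx_SUP:
  fixes S :: "'b::metric_space set"
  assumes f: "lsc_seq S f" and x: "x \<in> S"
  shows "(SUP k. lip_approx S f k x) = f x"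
proof (rule antisym)
  show "(SUP k. lip_approx S f k x) \<le> f x" by (intro SUP_least lip_approx_le x)
  show "f x \<le> (SUP k. lip_approx S f k x)"
  proof (rule dense_le)
    fix t assume t: "t < f x"
    have "\<exists>d>0. \<forall>y\<in>S. dist x y < d \<longrightarrow> t \<le> f y"
    proof (rule ccontr)
      assume "\<not> ?thesis"
      then have "\<exists>y\<in>S. dist x y < inverse (real (Suc n)) \<and> f y < t" for n
        by (metis inverse_positive_iff_positive not_le of_nat_0_less_iff zero_less_Suc)
      then obtain X where X: "\<And>n. X n \<in> S" "\<And>n. dist x (X n) < inverse (real (Suc n))" "\<And>n. f (X n) < t"
        by metis
      have "X \<longlonglongrightarrow> x"
        by (rule metric_tendsto_imp_tendsto[OF LIMSEQ_inverse_real_of_nat])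
          (use X(2) in \<open>auto simp: dist_commute intro!: always_eventually less_imp_le\<close>)
      from lsc_seq_eventually[OF f X(1) x this t] X(3) show False
        by (auto dest!: eventually_happens' [OF sequentially_bot] dest: less_asym)
    qed
    then obtain d where d: "d > 0" "\<And>y. y \<in> S \<Longrightarrow> dist x y < d \<Longrightarrow> t \<le> f y" by auto
    obtain r where r: "t = ennreal r" "0 \<le> r" using t by (cases t) (auto simp: top_unique)
    obtain k :: nat where k: "max r (r / d) \<le> real k" using real_arch_simple by blast
    have k': "t \<le> ennreal (real k * d)" "t \<le> of_nat k"
      using k d by (auto simp: r field_simps ennreal_of_nat_eq_real_of_nat intro!: ennreal_leI)
    have "t \<le> f y + ennreal (real k * dist x y)" if "y \<in> S" for y
    proof (cases "dist x y < d")
      case True then show ?thesis using d(2)[OF that] by (simp add: add_increasing2)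
    next
      case False
      then have "t \<le> ennreal (real k * dist x y)"
        by (intro order_trans[OF k'(1)] ennreal_leI mult_left_mono) auto
      then show ?thesis by (simp add: add_increasing)
    qed
    then have "t \<le> lip_approx S f k x" unfolding lip_approx_def using k' by (auto intro: INF_greatest)
    then show "t \<le> (SUP k. lip_approx S f k x)" by (rule order_trans) (rule SUP_upper, simp)
  qed
qed

text \<open>
  The half of the portmanteau theorem that concerns lower semicontinuous integrands: weak convergence applies to
  each Lipschitz approximation, and monotone convergence passes to their supremum. Test functions are
  continuous on \<open>S\<close> only, as the measures live on the subspace \<open>S\<close>.
\<close>

lemma weak_liminf_nn_integral:
  fixes S :: "'b::metric_space set" and N :: "nat \<Rightarrow> 'b measure"
  assumes weak: "\<And>h::'b \<Rightarrow> real. continuous_on S h \<Longrightarrow> bounded (h ` S) \<Longrightarrow>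
      (\<lambda>n. \<integral>y. h y \<partial>N n) \<longlonglongrightarrow> (\<integral>y. h y \<partial>L)"
    and N: "\<And>n. N n \<in> space (prob_algebra (restrict_space borel S))"
    and L: "L \<in> space (prob_algebra (restrict_space borel S))"
    and f: "lsc_seq S f"
  shows "(\<integral>\<^sup>+y. f y \<partial>L) \<le> liminf (\<lambda>n. \<integral>\<^sup>+y. f y \<partial>N n)"
proof -
  let ?h = "\<lambda>k x. enn2real (lip_approx S f k x)"
  have eq: "(\<integral>\<^sup>+y. lip_approx S f k y \<partial>P) = ennreal (\<integral>y. ?h k y \<partial>P)"
    and meas: "lip_approx S f k \<in> borel_measurable P"
    and sp: "space P = S"
    if P: "P \<in> space (prob_algebra (restrict_space borel S))" for P k
  proof -
    interpret prob_space P using P by (simp add: space_prob_algebra)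
    have sets: "sets P = sets (restrict_space borel S)" using P by (simp add: space_prob_algebra)
    show "space P = S" using sets_eq_imp_space_eq[OF sets] by (simp add: space_restrict_space)
    have m: "?h k \<in> borel_measurable P"
      unfolding measurable_cong_sets[OF sets refl]
      by (rule borel_measurable_continuous_on_restrict[OF lip_approx_continuous])
    have e: "lip_approx S f k y = ennreal (?h k y)" for y
      by (simp add: lip_approx_finite)
    show "lip_approx S f k \<in> borel_measurable P"
      using m by (subst e[abs_def]) (rule measurable_compose[OF _ measurable_ennreal])
    have "?h k y \<le> real k" for y
      by (rule enn2real_leI) (auto simp: lip_approx_def ennreal_of_nat_eq_real_of_nat)
    then have "integrable P (?h k)"
      by (intro integrable_const_bound[of _ "real k"] m) auto
    then show "(\<integral>\<^sup>+y. lip_approx S f k y \<partial>P) = ennreal (\<integral>y. ?h k y \<partial>P)"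
      by (subst e) (rule nn_integral_eq_integral, auto)
  qed
  have "(\<integral>\<^sup>+y. f y \<partial>L) = (\<integral>\<^sup>+y. (SUP k. lip_approx S f k y) \<partial>L)"
    by (intro nn_integral_cong) (simp add: sp[OF L] lip_approx_SUP[OF f])
  also have "\<dots> = (SUP k. \<integral>\<^sup>+y. lip_approx S f k y \<partial>L)"
    by (intro nn_integral_monotone_convergence_SUP meas L)
      (auto simp: incseq_def le_fun_def lip_approx_mono)
  also have "\<dots> \<le> liminf (\<lambda>n. \<integral>\<^sup>+y. f y \<partial>N n)"
  proof (rule SUP_least)
    fix k
    have bd: "bounded (?h k ` S)"
    proof (rule boundedI)
      fix y assume "y \<in> ?h k ` S"
      then show "norm y \<le> real k"
        by (auto intro!: enn2real_leI simp: lip_approx_def ennreal_of_nat_eq_real_of_nat)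
    qed
    have "(\<lambda>n. ennreal (\<integral>y. ?h k y \<partial>N n)) \<longlonglongrightarrow> ennreal (\<integral>y. ?h k y \<partial>L)"
      by (intro tendsto_ennrealI weak lip_approx_continuous bd)
    then have "(\<integral>\<^sup>+y. lip_approx S f k y \<partial>L) = liminf (\<lambda>n. ennreal (\<integral>y. ?h k y \<partial>N n))"
      unfolding eq[OF L] by (intro lim_imp_Liminf[symmetric]) auto
    also have "\<dots> \<le> liminf (\<lambda>n. \<integral>\<^sup>+y. f y \<partial>N n)"
      unfolding eq[OF N, symmetric]
      by (intro Liminf_mono always_eventually allI nn_integral_mono lip_approx_le) (simp add: sp[OF N])
    finally show "(\<integral>\<^sup>+y. lip_approx S f k y \<partial>L) \<le> liminf (\<lambda>n. \<integral>\<^sup>+y. f y \<partial>N n)" .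
  qed
  finally show ?thesis .
qed

section \<open>Measurable selection of minimizers\<close>

text \<open>
  The Kuratowski and Ryll-Nardzewski construction. The sets \<open>B x\<close> are shrunk by intersecting them,
  for \<open>n = 0, 1, \<dots>\<close>, with the first closed ball of radius \<open>2\<^sup>-\<^sup>n\<close> around a point of a dense
  sequence that they meet. The chosen centres depend measurably on \<open>x\<close> and converge to a point of \<open>B x\<close>.
\<close>

lemma closed_hit_measurable_selection:
  fixes B :: "'x \<Rightarrow> 'a::polish_space set"
  assumes closed: "\<And>x. x \<in> space M \<Longrightarrow> closed (B x)"
    and ne: "\<And>x. x \<in> space M \<Longrightarrow> B x \<noteq> {}"
    and hit: "\<And>F. closed F \<Longrightarrow> Measurable.pred M (\<lambda>x. B x \<inter> F \<noteq> {})"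
  obtains \<phi> where "\<phi> \<in> borel_measurable M" "\<And>x. x \<in> space M \<Longrightarrow> \<phi> x \<in> B x"
proof -
  obtain D :: "'a set" where D: "countable D" "\<And>U. open U \<Longrightarrow> U \<noteq> {} \<Longrightarrow> \<exists>d\<in>D. d \<in> U"
    using countable_dense_exists by blast
  from D(2)[of UNIV] have Dne: "D \<noteq> {}" by auto
  define d where "d = from_nat_into D"
  define C where "C i n = cball (d i) ((1/2)^n)" for i n :: nat
  have cover: "\<exists>i. a \<in> C i n" for a n
  proof -
    have "ball a ((1/2)^n) \<noteq> {}" by (metis centre_in_ball empty_iff half_gt_zero_iff zero_less_one zero_less_power)
    from D(2)[OF open_ball this] obtain e where "e \<in> D" "dist a e < (1/2)^n" by auto
    moreover then obtain i where "e = d i" using from_nat_into_surj[OF D(1)] by (metis d_def)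
    ultimately show ?thesis by (auto simp: C_def dist_commute intro!: exI[of _ i])
  qed
  define R where "R = rec_nat B (\<lambda>n P x. P x \<inter> C (LEAST i. P x \<inter> C i n \<noteq> {}) n)"
  define idx where "idx n x = (LEAST i. R n x \<inter> C i n \<noteq> {})" for n x
  have R0: "R 0 = B" and RS: "R (Suc n) x = R n x \<inter> C (idx n x) n" for n x
    by (simp_all add: R_def idx_def)
  have inv: "R n x \<noteq> {} \<and> closed (R n x)" if "x \<in> space M" for n x
  proof (induction n)
    case 0 then show ?case using closed ne that by (simp add: R0)
  next
    case (Suc n)
    then obtain a where "a \<in> R n x" by auto
    with cover[of a n] have "\<exists>i. R n x \<inter> C i n \<noteq> {}" by blast
    then have "R n x \<inter> C (idx n x) n \<noteq> {}" unfolding idx_def by (rule LeastI_ex)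
    then show ?case using Suc by (auto simp: RS C_def)
  qed
  \<comment> \<open>Measurability of the hitting sets of stage \<open>n\<close> and of the index chosen there must be shown together.\<close>
  have mR: "closed F \<Longrightarrow> Measurable.pred M (\<lambda>x. R n x \<inter> F \<noteq> {})"
    and mi: "idx n \<in> measurable M (count_space UNIV)" for n F
  proof (induction n arbitrary: F)
    case 0
    { case 1 then show ?case by (simp add: R0 hit) }
    { case 2 show ?case unfolding idx_def R0
        by (rule measurable_Least) (rule hit, simp add: C_def) }
  next
    case (Suc n)
    { case (1 F)
      have "Measurable.pred M (\<lambda>x. R n x \<inter> (C i n \<inter> F) \<noteq> {})" for i
        using 1 by (intro Suc(1)) (auto simp: C_def)
      then have "Measurable.pred M (\<lambda>x. \<exists>i. idx n x = i \<and> R n x \<inter> (C i n \<inter> F) \<noteq> {})"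
        using Suc(2) by (intro pred_intros_countable pred_intros_logic(3) pred_count_space_const1)
      also have "(\<lambda>x. \<exists>i. idx n x = i \<and> R n x \<inter> (C i n \<inter> F) \<noteq> {}) = (\<lambda>x. R (Suc n) x \<inter> F \<noteq> {})"
        by (auto simp: RS fun_eq_iff)
      finally show ?case . }
    note * = this
    { case 2 show ?case unfolding idx_def
        by (rule measurable_Least) (rule *, simp add: C_def) }
  qed
  have conv: "\<exists>p\<in>B x. (\<lambda>n. d (idx n x)) \<longlonglongrightarrow> p" if x: "x \<in> space M" for x
  proof -
    have "\<forall>n. \<exists>b. b \<in> R n x" using inv[OF x] by blast
    then obtain b where b: "\<And>n. b n \<in> R n x" by metis
    have dec: "R m x \<subseteq> R n x" if "n \<le> m" for n m
      using that by (rule lift_Suc_antimono_le[rotated]) (auto simp: RS)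
    have near: "dist (d (idx n x)) (b m) \<le> (1/2)^n" if "n < m" for n m
      using b[of m] dec[of "Suc n" m] that by (auto simp: RS C_def Suc_le_eq)
    have "Cauchy b"
    proof (rule metric_CauchyI)
      fix e :: real assume "e > 0"
      then obtain n where n: "(1/2)^n < e/2" using real_arch_pow_inv[of "e/2" "1/2"] by auto
      show "\<exists>N. \<forall>m\<ge>N. \<forall>k\<ge>N. dist (b m) (b k) < e"
      proof (intro exI[of _ "Suc n"] allI impI)
        fix m k assume "Suc n \<le> m" "Suc n \<le> k"
        with near[of n m] near[of n k] n dist_triangle3[of "b m" "b k" "d (idx n x)"]
        show "dist (b m) (b k) < e" by auto
      qed
    qed
    then obtain p where p: "b \<longlonglongrightarrow> p" by (auto simp: Cauchy_convergent_iff convergent_def)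
    have "p \<in> B x"
      by (rule closed_sequentially[OF closed[OF x] _ p]) (use b dec[of 0] R0 in auto)
    have pn: "dist (d (idx n x)) p \<le> (1/2)^n" for n
    proof (rule tendsto_upperbound[OF tendsto_dist[OF tendsto_const p]])
      show "\<forall>\<^sub>F m in sequentially. dist (d (idx n x)) (b m) \<le> (1/2)^n"
        using eventually_gt_at_top[of n] by eventually_elim (rule near)
    qed simp
    have "(\<lambda>n. d (idx n x)) \<longlonglongrightarrow> p"
      by (rule metric_tendsto_imp_tendsto[OF LIMSEQ_realpow_zero[of "1/2"]])
        (use pn in \<open>auto intro!: always_eventually\<close>)
    with \<open>p \<in> B x\<close> show ?thesis by blast
  qed
  define \<phi> where "\<phi> x = lim (\<lambda>n. d (idx n x))" for x
  have \<phi>: "\<phi> x \<in> B x \<and> (\<lambda>n. d (idx n x)) \<longlonglongrightarrow> \<phi> x" if "x \<in> space M" for x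
    using conv[OF that] by (auto simp: \<phi>_def limI)
  show thesis
  proof (rule that)
    show "\<phi> \<in> borel_measurable M"
      by (rule borel_measurable_LIMSEQ_metric[where f="\<lambda>n x. d (idx n x)"])
        (use \<phi> in \<open>auto intro!: measurable_compose[OF mi]\<close>)
  qed (use \<phi> in blast)
qed

text \<open>
  The sequential form of the property known as K-inf-compactness: along a convergent sequence of states,
  actions of bounded value accumulate at an action whose value is no larger than the limit of the bounds.
  It combines lower semicontinuity of \<open>Q\<close> with compactness of its sublevel sets, uniformly over
  convergent states.
\<close>

definition K_inf_compact :: "'x::topological_space set \<Rightarrow> ('x \<Rightarrow> 'a::topological_space set) \<Rightarrow> ('x \<Rightarrow> 'a \<Rightarrow> ennreal) \<Rightarrow> bool" where
  "K_inf_compact S A Q \<longleftrightarrow> (\<forall>X x a l L. (\<forall>n. X n \<in> S) \<and> x \<in> S \<and> X \<longlonglongrightarrow> x \<and> (\<forall>n. a n \<in> A (X n)) \<and>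
     (\<forall>n. Q (X n) (a n) \<le> l n) \<and> l \<longlonglongrightarrow> L \<and> L < top \<longrightarrow>
     (\<exists>b\<in>A x. Q x b \<le> L \<and> (\<exists>r::nat \<Rightarrow> nat. strict_mono r \<and> (a \<circ> r) \<longlonglongrightarrow> b)))"

lemma K_inf_compactD:
  assumes "K_inf_compact S A Q" "\<And>n. X n \<in> S" "x \<in> S" "X \<longlonglongrightarrow> x" "\<And>n. a n \<in> A (X n)"
    "\<And>n. Q (X n) (a n) \<le> l n" "l \<longlonglongrightarrow> L" "L < top"
  obtains b r where "b \<in> A x" "Q x b \<le> L" "strict_mono (r::nat \<Rightarrow> nat)" "(a \<circ> r) \<longlonglongrightarrow> b"
  using assms unfolding K_inf_compact_def by blast

text \<open>
  Almost minimizing actions at \<open>X n\<close> accumulate at an action at \<open>x\<close>. Both attainment of the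
  minimum (a constant sequence of states) and its lower semicontinuity follow. The closed set \<open>F\<close> is there
  for the hitting sets in the selection theorem.
\<close>

lemma K_inf_compact_limit_attained:
  assumes Q: "K_inf_compact S A Q" and X: "\<And>n. X n \<in> S" "x \<in> S" "X \<longlonglongrightarrow> x" and F: "closed F"
    and lim: "(\<lambda>n. INF a\<in>A (X n) \<inter> F. Q (X n) a) \<longlonglongrightarrow> L" and L: "L < top"
  shows "\<exists>b\<in>A x \<inter> F. Q x b \<le> L"
proof -
  let ?V = "\<lambda>n. INF a\<in>A (X n) \<inter> F. Q (X n) a"
  obtain N where N: "\<And>n. n \<ge> N \<Longrightarrow> ?V n < top"
    using order_tendstoD(2)[OF lim L] by (auto simp: eventually_sequentially)
  \<comment> \<open>The infimum need not be attained yet, so it is approached up to \<open>1 / (n + 1)\<close>.\<close>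
  let ?l = "\<lambda>n. ?V (n + N) + ennreal (inverse (real (Suc n)))"
  have "\<exists>a\<in>A (X (n + N)) \<inter> F. Q (X (n + N)) a < ?l n" for n
  proof -
    have "?V (n + N) < ?l n" using N[of "n + N"]
      by (cases "?V (n + N)") (auto simp: ennreal_less_iff simp flip: ennreal_plus)
    then show ?thesis by (simp add: INF_less_iff)
  qed
  then obtain a where a: "\<And>n. a n \<in> A (X (n + N)) \<inter> F" "\<And>n. Q (X (n + N)) (a n) < ?l n"
    by metis
  have "?l \<longlonglongrightarrow> L + ennreal 0"
    by (intro tendsto_add LIMSEQ_ignore_initial_segment[OF lim] tendsto_ennrealI LIMSEQ_inverse_real_of_nat)
  then have l: "?l \<longlonglongrightarrow> L" by simp
  obtain b r where b: "b \<in> A x" "Q x b \<le> L" "strict_mono (r::nat \<Rightarrow> nat)" "(a \<circ> r) \<longlonglongrightarrow> b"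
    by (rule K_inf_compactD[OF Q, where X="\<lambda>n. X (n + N)" and a=a and l="?l" and x=x and L=L])
      (use X a L l in \<open>auto intro: LIMSEQ_ignore_initial_segment less_imp_le\<close>)
  have "b \<in> F" by (rule closed_sequentially[OF F _ b(4)]) (use a in auto)
  with b show ?thesis by auto
qed

lemma K_inf_compact_attained:
  assumes "K_inf_compact S A Q" "x \<in> S" "closed F" "A x \<inter> F \<noteq> {}"
  obtains b where "b \<in> A x \<inter> F" "Q x b = (INF a\<in>A x \<inter> F. Q x a)"
proof (cases "(INF a\<in>A x \<inter> F. Q x a) = top")
  case True
  from assms(4) obtain b where "b \<in> A x \<inter> F" by auto
  moreover then have "Q x b = top" using True INF_lower[of b "A x \<inter> F" "Q x"] by (simp add: top_unique)
  ultimately show thesis using True that by simp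
next
  case False
  then obtain b where "b \<in> A x \<inter> F" "Q x b \<le> (INF a\<in>A x \<inter> F. Q x a)"
    using K_inf_compact_limit_attained[OF assms(1), of "\<lambda>n. x" x F "INF a\<in>A x \<inter> F. Q x a"] assms
    by (auto simp: less_top[symmetric])
  then show thesis using that by (metis INF_lower antisym)
qed

lemma K_inf_compact_INF_lsc:
  fixes S :: "'x::metric_space set"
  assumes Q: "K_inf_compact S A Q" and F: "closed F"
  shows "lsc_seq S (\<lambda>x. INF a\<in>A x \<inter> F. Q x a)"
  unfolding lsc_seq_def
proof (intro allI impI)
  fix X x assume X: "(\<forall>n. X n \<in> S) \<and> x \<in> S \<and> X \<longlonglongrightarrow> x"
  let ?V = "\<lambda>x. INF a\<in>A x \<inter> F. Q x a"
  let ?L = "liminf (\<lambda>n. ?V (X n))"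
  show "?V x \<le> ?L"
  proof (cases "?L < top")
    case True
    obtain r where r: "strict_mono (r::nat \<Rightarrow> nat)" "((\<lambda>n. ?V (X n)) \<circ> r) \<longlonglongrightarrow> ?L"
      using liminf_subseq_lim by blast
    have "\<exists>b\<in>A x \<inter> F. Q x b \<le> ?L"
      by (rule K_inf_compact_limit_attained[OF Q, where X="X \<circ> r"])
        (use X r True F LIMSEQ_subseq_LIMSEQ[of X x r] in \<open>auto simp: comp_def\<close>)
    then show ?thesis by (meson INF_lower2)
  qed (simp add: less_top[symmetric])
qed

lemma K_inf_compact_sublevel_compact:
  fixes S :: "'x::metric_space set" and A :: "'x \<Rightarrow> 'a::metric_space set"
  assumes Q: "K_inf_compact S A Q" and x: "x \<in> S" and L: "L < top"
  shows "compact {a \<in> A x. Q x a \<le> L}"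
  unfolding compact_eq_seq_compact_metric seq_compact_def
proof (intro allI impI)
  fix a :: "nat \<Rightarrow> 'a" assume a: "\<forall>n. a n \<in> {a \<in> A x. Q x a \<le> L}"
  obtain b r where "b \<in> A x" "Q x b \<le> L" "strict_mono (r::nat \<Rightarrow> nat)" "(a \<circ> r) \<longlonglongrightarrow> b"
    by (rule K_inf_compactD[OF Q, where X="\<lambda>n. x" and a=a and l="\<lambda>n. L" and x=x and L=L])
      (use x a L in auto)
  then show "\<exists>l\<in>{a \<in> A x. Q x a \<le> L}. \<exists>r. strict_mono r \<and> (a \<circ> r) \<longlonglongrightarrow> l" by auto
qed

text \<open>
  The minimizers meet a closed set \<open>F\<close> iff the minimum over \<open>F\<close> is no larger than the minimum over all
  actions, and both are lower semicontinuous. Where the minimum is infinite every action is a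
  minimizer, but these sets need not be closed, so the given selector \<open>\<psi>\<close> is used there.
\<close>

lemma K_inf_compact_selection:
  fixes S :: "'x::metric_space set" and A :: "'x \<Rightarrow> 'a::polish_space set"
  assumes Q: "K_inf_compact S A Q"
    and \<psi>: "\<psi> \<in> borel_measurable (restrict_space borel S)" "\<And>x. x \<in> S \<Longrightarrow> \<psi> x \<in> A x"
  obtains \<phi> where "\<phi> \<in> borel_measurable (restrict_space borel S)"
    "\<And>x. x \<in> S \<Longrightarrow> \<phi> x \<in> A x \<and> Q x (\<phi> x) = (INF a\<in>A x. Q x a)"
proof -
  let ?M = "restrict_space borel S"
  define V where "V F x = (INF a\<in>A x \<inter> F. Q x a)" for F x
  define B where "B x = (if V UNIV x < top then {a \<in> A x. Q x a \<le> V UNIV x} else {\<psi> x})" for x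
  have mV[measurable]: "V F \<in> borel_measurable ?M" if "closed F" for F
    unfolding V_def by (rule lsc_seq_measurable[OF K_inf_compact_INF_lsc[OF Q that]])
  have mT[measurable]: "Measurable.pred ?M (\<lambda>x. V UNIV x < top)"
    using mV[of UNIV] by measurable
  have m\<psi>: "Measurable.pred ?M (\<lambda>x. \<psi> x \<in> F)" if "closed F" for F
    using measurable_sets[OF \<psi>(1), of F] that by (simp add: pred_def vimage_def Int_def conj_commute)
  have "\<exists>\<phi>. \<phi> \<in> borel_measurable ?M \<and> (\<forall>x\<in>space ?M. \<phi> x \<in> B x)"
  proof (rule closed_hit_measurable_selection[of ?M B])
    fix x assume "x \<in> space ?M"
    then have x: "x \<in> S" by (simp add: space_restrict_space)
    show "closed (B x)"
      using K_inf_compact_sublevel_compact[OF Q x] by (auto simp: B_def intro: compact_imp_closed)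
    obtain b where "b \<in> A x \<inter> UNIV" "Q x b = (INF a\<in>A x \<inter> UNIV. Q x a)"
      by (rule K_inf_compact_attained[OF Q x closed_UNIV]) (use \<psi>(2)[OF x] in auto)
    then show "B x \<noteq> {}" by (auto simp: B_def V_def)
  next
    fix F :: "'a set" assume F: "closed F"
    have "Measurable.pred ?M (\<lambda>x. if V UNIV x < top then V F x \<le> V UNIV x else \<psi> x \<in> F)"
      using mV[OF F] mV[of UNIV] F m\<psi>[OF F] mT by measurable
    moreover have "(B x \<inter> F \<noteq> {}) = (if V UNIV x < top then V F x \<le> V UNIV x else \<psi> x \<in> F)"
      if "x \<in> space ?M" for x
    proof (cases "V UNIV x < top")
      case True
      have x: "x \<in> S" using that by (simp add: space_restrict_space)
      have "(B x \<inter> F \<noteq> {}) = (V F x \<le> V UNIV x)"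
      proof
        assume "B x \<inter> F \<noteq> {}"
        then show "V F x \<le> V UNIV x" using True by (auto simp: B_def V_def[of F] intro: INF_lower2)
      next
        assume le: "V F x \<le> V UNIV x"
        then have ne: "A x \<inter> F \<noteq> {}" using True by (auto simp: V_def[of F] top_unique)
        obtain b where "b \<in> A x \<inter> F" "Q x b = (INF a\<in>A x \<inter> F. Q x a)"
          by (rule K_inf_compact_attained[OF Q x F ne])
        then show "B x \<inter> F \<noteq> {}" using le True by (auto simp: B_def V_def[of F])
      qed
      then show ?thesis using True by simp
    qed (simp add: B_def)
    ultimately show "Measurable.pred ?M (\<lambda>x. B x \<inter> F \<noteq> {})"
      by (subst measurable_cong) assumption+
  qed blast
  then obtain \<phi> where \<phi>: "\<phi> \<in> borel_measurable ?M" "\<And>x. x \<in> S \<Longrightarrow> \<phi> x \<in> B x"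
    by (auto simp: space_restrict_space)
  show thesis
  proof (rule that[OF \<phi>(1)])
    fix x assume x: "x \<in> S"
    show "\<phi> x \<in> A x \<and> Q x (\<phi> x) = (INF a\<in>A x. Q x a)"
    proof (cases "V UNIV x < top")
      case True
      then show ?thesis using \<phi>(2)[OF x] by (auto simp: B_def V_def intro!: antisym INF_lower)
    next
      case False
      then have "(INF a\<in>A x. Q x a) = top" by (simp add: V_def less_top[symmetric])
      moreover have "\<phi> x \<in> A x" using \<phi>(2)[OF x] \<psi>(2)[OF x] False by (simp add: B_def)
      ultimately show ?thesis by (metis INF_lower top_unique)
    qed
  qed
qed

section \<open>One-step laws of the trajectory measure\<close>

context Ionescu_Tulcea
begin

text \<open>
  The limit measure determines a coordinate through the finite stages: the law of the first \<open>n\<close>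
  coordinates is \<open>C 0 n\<close>, and one more kernel gives the next coordinate.
\<close>

lemma distr_lim_C: "distr PF.lim (PiM {0..<n} M) (\<lambda>\<omega>. restrict \<omega> {0..<n}) = C 0 n (\<lambda>_. undefined)"
proof -
  have "up_to {0..<n} \<le> n" by (simp add: up_to_iff)
  moreover have "n \<le> up_to {0..<n}" using up_to_less[of "{0..<n}"] by (cases n) (auto simp: Suc_le_eq)
  ultimately have "up_to {0..<n} = n" by simp
  then have "CI {0..<n} = C 0 n (\<lambda>_. undefined)"
    using distr_C[of n n "\<lambda>_. undefined" 0] by (simp add: CI_def)
  then show ?thesis by (simp add: distr_lim)
qed

lemma measurable_restrict_lim:
  "(\<lambda>\<omega>. restrict \<omega> {0..<n}) \<in> PF.lim \<rightarrow>\<^sub>M PiM {0..<n} M"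
  unfolding measurable_cong_sets[OF PF.sets_lim refl] by (rule measurable_restrict_subset) simp

lemma nn_integral_lim_restrict:
  assumes "f \<in> borel_measurable (PiM {0..<n} M)"
  shows "(\<integral>\<^sup>+\<omega>. f (restrict \<omega> {0..<n}) \<partial>PF.lim) = (\<integral>\<^sup>+h. f h \<partial>C 0 n (\<lambda>_. undefined))"
  unfolding distr_lim_C[symmetric]
  using assms by (subst nn_integral_distr) (auto intro: measurable_restrict_lim)

lemma nn_integral_lim_component:
  assumes F: "F \<in> borel_measurable (M n)"
  shows "(\<integral>\<^sup>+\<omega>. F (\<omega> n) \<partial>PF.lim) = (\<integral>\<^sup>+\<omega>. (\<integral>\<^sup>+z. F z \<partial>P n (restrict \<omega> {0..<n})) \<partial>PF.lim)"
proof -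
  let ?u = "\<lambda>_. undefined"
  have u: "?u \<in> space (PiM {0..<0} M)" by (simp add: space_PiM)
  have m: "(\<lambda>h. F (h n)) \<in> borel_measurable (PiM {0..<Suc n} M)"
    by (rule measurable_compose[OF _ F], rule measurable_component_singleton) simp
  have "(\<integral>\<^sup>+\<omega>. F (\<omega> n) \<partial>PF.lim) = (\<integral>\<^sup>+h. F (h n) \<partial>C 0 (Suc n) ?u)"
    using nn_integral_lim_restrict[OF m] by simp
  also have "\<dots> = (\<integral>\<^sup>+h. (\<integral>\<^sup>+h'. F (h' n) \<partial>eP n h) \<partial>C 0 n ?u)"
  proof -
    have "eP n \<in> C 0 n ?u \<rightarrow>\<^sub>M subprob_algebra (PiM {0..<Suc n} M)"
      using measurable_eP[of n] sets_C[OF u, of n] by (simp cong: measurable_cong_sets)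
    then show ?thesis by (simp add: nn_integral_bind[OF m])
  qed
  also have "\<dots> = (\<integral>\<^sup>+h. (\<integral>\<^sup>+z. F z \<partial>P n h) \<partial>C 0 n ?u)"
  proof (rule nn_integral_cong)
    fix h assume "h \<in> space (C 0 n ?u)"
    then have "h \<in> space (PiM {0..<n} M)" using space_C[OF u, of n] by simp
    then show "(\<integral>\<^sup>+h'. F (h' n) \<partial>eP n h) = (\<integral>\<^sup>+z. F z \<partial>P n h)"
      by (simp add: nn_integral_eP[OF _ m])
  qed
  also have "\<dots> = (\<integral>\<^sup>+\<omega>. (\<integral>\<^sup>+z. F z \<partial>P n (restrict \<omega> {0..<n})) \<partial>PF.lim)"
    by (rule nn_integral_lim_restrict[symmetric])
      (rule measurable_compose[OF P nn_integral_measurable_subprob_algebra[OF F]])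
  finally show ?thesis .
qed

end

abbreviation pairM :: "('x::polish_space, 'a::polish_space) mdp \<Rightarrow> ('x \<times> 'a) measure" where
  "pairM M \<equiv> stateM M \<Otimes>\<^sub>M actM M"

locale mdp_traj =
  fixes M :: "('x::polish_space, 'a::polish_space) mdp" and \<pi> :: "('x, 'a) policy" and x :: 'x
  assumes mdp: "is_mdp M" and policy: "\<pi> \<in> policies M" and state: "x \<in> states M"
begin

sublocale IT: Ionescu_Tulcea "step M \<pi> x" "\<lambda>_. pairM M"
  by (rule Ionescu_Tulcea_step[OF mdp policy state])

abbreviation "T \<equiv> trajM M \<pi> x"

lemma T_eq: "T = IT.PF.lim" by (simp add: trajM_def)

lemma sets_T: "sets T = sets (PiM UNIV (\<lambda>_. pairM M))"
  by (simp add: T_eq IT.PF.sets_lim)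

lemma space_T: "space T = UNIV \<rightarrow>\<^sub>E states M \<times> actions M"
  using sets_eq_imp_space_eq[OF sets_T] by (simp add: space_PiM space_pair_measure space_restrict_space)

lemma component_T: "(\<lambda>\<omega>. \<omega> n) \<in> T \<rightarrow>\<^sub>M pairM M"
  unfolding measurable_cong_sets[OF sets_T refl] by (rule measurable_component_singleton) simp

lemma component_space: "\<omega> \<in> space T \<Longrightarrow> \<omega> n \<in> states M \<times> actions M"
  by (simp add: space_T PiE_iff)

lemma restrict_space_T: "\<omega> \<in> space T \<Longrightarrow> restrict \<omega> {0..<n} \<in> space (PiM {0..<n} (\<lambda>_. pairM M))"
  by (auto simp: space_T space_PiM space_pair_measure space_restrict_space PiE_iff)

lemma prob_T: "prob_space T"
proof -
  have "prob_space (IT.C 0 0 (\<lambda>_. undefined))"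
    by (rule IT.prob_space_C) (simp add: space_PiM)
  then show ?thesis
    unfolding T_eq IT.distr_lim_C[symmetric]
    by (rule prob_space_distrD[OF IT.measurable_restrict_lim])
qed

lemma state_step_prob:
  assumes "h \<in> space (PiM {0..<n} (\<lambda>_. pairM M))"
  shows "state_step M x n h \<in> space (prob_algebra (stateM M))"
proof (cases n)
  case 0
  then show ?thesis using state
    by (auto simp: state_step_def space_restrict_space space_prob_algebra intro!: prob_space_return)
next
  case (Suc m)
  then have "h m \<in> space (pairM M)" using assms by (auto simp: space_PiM PiE_iff)
  from measurable_space[OF ext_kernel_measurable[OF mdp] this] Suc show ?thesis
    by (simp add: state_step_def)
qed

lemma policy_measurable: "\<pi> n \<in> histM M n \<rightarrow>\<^sub>M prob_algebra (actM M)"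
  using policy by (simp add: policies_def)

lemma nn_integral_step:
  assumes h: "h \<in> space (PiM {0..<n} (\<lambda>_. pairM M))" and F: "F \<in> borel_measurable (pairM M)"
  shows "(\<integral>\<^sup>+z. F z \<partial>step M \<pi> x n h) = (\<integral>\<^sup>+y. (\<integral>\<^sup>+a. F (y, a) \<partial>\<pi> n (h, y)) \<partial>state_step M x n h)"
proof -
  have s: "sets (state_step M x n h) = sets (stateM M)" and sp: "space (state_step M x n h) = states M"
    using state_step_prob[OF h] sets_eq_imp_space_eq[of "state_step M x n h" "stateM M"]
    by (auto simp: space_prob_algebra space_restrict_space)
  have p: "(\<lambda>y. \<pi> n (h, y)) \<in> stateM M \<rightarrow>\<^sub>M prob_algebra (actM M)"
    by (rule measurable_compose[OF _ policy_measurable]) (use h in \<open>simp add: histM_def\<close>)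
  have i: "(\<lambda>y. bind (\<pi> n (h, y)) (\<lambda>a. return (pairM M) (y, a))) \<in> stateM M \<rightarrow>\<^sub>M prob_algebra (pairM M)"
    by (rule measurable_bind_prob_space2[OF p])
      (auto simp: case_prod_beta intro!: measurable_compose[OF _ measurable_return_prob_space])
  have "(\<integral>\<^sup>+z. F z \<partial>step M \<pi> x n h) =
      (\<integral>\<^sup>+y. (\<integral>\<^sup>+z. F z \<partial>bind (\<pi> n (h, y)) (\<lambda>a. return (pairM M) (y, a))) \<partial>state_step M x n h)"
    unfolding step_def
    by (rule nn_integral_bind[OF F])
      (use measurable_prob_algebraD[OF i] in \<open>simp add: measurable_cong_sets[OF s refl]\<close>)
  also have "\<dots> = (\<integral>\<^sup>+y. (\<integral>\<^sup>+a. F (y, a) \<partial>\<pi> n (h, y)) \<partial>state_step M x n h)"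
  proof (rule nn_integral_cong)
    fix y assume "y \<in> space (state_step M x n h)"
    then have y: "y \<in> space (stateM M)" by (simp add: sp space_restrict_space)
    have s2: "sets (\<pi> n (h, y)) = sets (actM M)"
      using measurable_space[OF p y] by (simp add: space_prob_algebra)
    have "(\<integral>\<^sup>+z. F z \<partial>bind (\<pi> n (h, y)) (\<lambda>a. return (pairM M) (y, a)))
        = (\<integral>\<^sup>+a. (\<integral>\<^sup>+z. F z \<partial>return (pairM M) (y, a)) \<partial>\<pi> n (h, y))"
      by (rule nn_integral_bind[OF F])
        (use y in \<open>auto simp: measurable_cong_sets[OF s2 refl] intro!: measurable_compose[OF _ return_measurable]\<close>)
    also have "\<dots> = (\<integral>\<^sup>+a. F (y, a) \<partial>\<pi> n (h, y))"
      using y sets_eq_imp_space_eq[OF s2]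
      by (intro nn_integral_cong nn_integral_return F) (simp add: space_pair_measure)
    finally show "(\<integral>\<^sup>+z. F z \<partial>bind (\<pi> n (h, y)) (\<lambda>a. return (pairM M) (y, a)))
        = (\<integral>\<^sup>+a. F (y, a) \<partial>\<pi> n (h, y))" .
  qed
  finally show ?thesis .
qed

text \<open>
  The conditional law of a state-action pair given the past, in integrated form: first the transition to
  the state \<open>y\<close>, then the action drawn by the policy. Everything below about a policy is deduced from this.
\<close>

lemma nn_integral_component:
  assumes F: "F \<in> borel_measurable (pairM M)"
  shows "(\<integral>\<^sup>+\<omega>. F (\<omega> n) \<partial>T) = (\<integral>\<^sup>+\<omega>.
    (\<integral>\<^sup>+y. (\<integral>\<^sup>+a. F (y, a) \<partial>\<pi> n (restrict \<omega> {0..<n}, y)) \<partial>state_step M x n (restrict \<omega> {0..<n})) \<partial>T)"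
  using IT.nn_integral_lim_component[OF F] unfolding T_eq[symmetric]
  by (simp add: nn_integral_step[OF restrict_space_T F] cong: nn_integral_cong)

lemma policy_prob:
  assumes "h \<in> space (PiM {0..<n} (\<lambda>_. pairM M))" "y \<in> states M"
  shows "prob_space (\<pi> n (h, y))" "sets (\<pi> n (h, y)) = sets (actM M)" "AE a in \<pi> n (h, y). a \<in> avail M y"
proof -
  have hy: "(h, y) \<in> space (histM M n)"
    using assms by (simp add: histM_def space_pair_measure space_restrict_space)
  from measurable_space[OF policy_measurable hy]
  show p: "prob_space (\<pi> n (h, y))" and s: "sets (\<pi> n (h, y)) = sets (actM M)"
    by (auto simp: space_prob_algebra)
  interpret prob_space "\<pi> n (h, y)" by fact
  have "avail M y \<in> sets (\<pi> n (h, y))"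
    using mdp assms(2) unfolding s by (auto simp: is_mdp_def sets_restrict_space)
  moreover have "emeasure (\<pi> n (h, y)) (avail M y) = 1"
    using policy hy by (auto simp: policies_def)
  ultimately show "AE a in \<pi> n (h, y). a \<in> avail M y"
    by (subst AE_in_set_eq_1) (auto simp: emeasure_eq_measure)
qed

lemma state_step_space:
  assumes "h \<in> space (PiM {0..<n} (\<lambda>_. pairM M))"
  shows "space (state_step M x n h) = states M"
    using state_step_prob[OF assms] sets_eq_imp_space_eq[of "state_step M x n h" "stateM M"]
    by (auto simp: space_prob_algebra space_restrict_space)

lemma nn_integral_component_state:
  assumes F: "F \<in> borel_measurable (pairM M)"
    and f: "\<And>h y. h \<in> space (PiM {0..<n} (\<lambda>_. pairM M)) \<Longrightarrow> y \<in> states M \<Longrightarrow>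
      (\<integral>\<^sup>+a. F (y, a) \<partial>\<pi> n (h, y)) = f y"
  shows "(\<integral>\<^sup>+\<omega>. F (\<omega> n) \<partial>T) = (\<integral>\<^sup>+\<omega>. (\<integral>\<^sup>+y. f y \<partial>state_step M x n (restrict \<omega> {0..<n})) \<partial>T)"
  unfolding nn_integral_component[OF F]
  by (intro nn_integral_cong f restrict_space_T) (simp_all add: state_step_space restrict_space_T)

lemma nn_integral_state:
  assumes f: "f \<in> borel_measurable (stateM M)"
  shows "(\<integral>\<^sup>+\<omega>. f (fst (\<omega> n)) \<partial>T) = (\<integral>\<^sup>+\<omega>. (\<integral>\<^sup>+y. f y \<partial>state_step M x n (restrict \<omega> {0..<n})) \<partial>T)"
proof -
  have "(\<lambda>z. f (fst z)) \<in> borel_measurable (pairM M)"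
    by (rule measurable_compose[OF measurable_fst f])
  from nn_integral_component_state[OF this, of n f] show ?thesis
    by (simp add: prob_space.emeasure_space_1[OF policy_prob(1)])
qed

lemma nn_integral_initial_state:
  assumes f: "f \<in> borel_measurable (stateM M)"
  shows "(\<integral>\<^sup>+\<omega>. f (fst (\<omega> 0)) \<partial>T) = f x"
  using state nn_integral_state[OF f, of 0]
  by (simp add: state_step_def nn_integral_return[OF _ f] space_restrict_space prob_space.emeasure_space_1[OF prob_T])

lemma Gr_sets: "Gr M (avail M) \<in> sets (pairM M)"
  using mdp by (auto simp: is_mdp_def sets_stateM_actM)

text \<open>
  A policy draws available actions almost surely, given any past. Hence the Dirac extension of the
  transition kernel to unavailable actions does not affect expectations.
\<close>

lemma AE_Gr: "AE \<omega> in T. \<omega> n \<in> Gr M (avail M)"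
proof -
  let ?F = "\<lambda>z. indicator (space (pairM M) - Gr M (avail M)) z :: ennreal"
  have F: "?F \<in> borel_measurable (pairM M)" using Gr_sets by (intro borel_measurable_indicator) auto
  have "(\<integral>\<^sup>+a. ?F (y, a) \<partial>\<pi> n (h, y)) = 0"
    if "h \<in> space (PiM {0..<n} (\<lambda>_. pairM M))" "y \<in> states M" for h y
  proof -
    have "AE a in \<pi> n (h, y). ?F (y, a) = 0"
      using policy_prob(3)[OF that] by eventually_elim (use that in \<open>auto simp: Gr_def\<close>)
    from nn_integral_cong_AE[OF this] show ?thesis by simp
  qed
  then have "(\<integral>\<^sup>+\<omega>. ?F (\<omega> n) \<partial>T) = 0"
    by (subst nn_integral_component_state[OF F, of n "\<lambda>_. 0"]) simp_all
  then have "AE \<omega> in T. ?F (\<omega> n) = 0"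
    using nn_integral_0_iff_AE[OF measurable_compose[OF component_T F]] by simp
  moreover have "AE \<omega> in T. \<omega> n \<in> space (pairM M)"
    by (rule AE_I2) (use component_space in \<open>simp add: space_pair_measure space_restrict_space\<close>)
  ultimately show ?thesis by eventually_elim (auto split: split_indicator_asm)
qed

lemma nn_integral_next_state:
  assumes f: "f \<in> borel_measurable (stateM M)"
  shows "(\<integral>\<^sup>+\<omega>. f (fst (\<omega> (Suc n))) \<partial>T) = (\<integral>\<^sup>+\<omega>. (\<integral>\<^sup>+y. f y \<partial>ext_kernel M (\<omega> n)) \<partial>T)"
  unfolding nn_integral_state[OF f] by (simp add: state_step_def)

lemma nn_integral_stationary:
  assumes F: "F \<in> borel_measurable (pairM M)" and \<phi>: "stationary M \<phi>" and pi: "\<pi> = stat_policy M \<phi>"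
  shows "(\<integral>\<^sup>+\<omega>. F (\<omega> n) \<partial>T) = (\<integral>\<^sup>+\<omega>. F (fst (\<omega> n), \<phi> (fst (\<omega> n))) \<partial>T)"
proof -
  have m\<phi>: "\<phi> \<in> stateM M \<rightarrow>\<^sub>M actM M" using \<phi> by (simp add: stationary_def)
  have f: "(\<lambda>y. F (y, \<phi> y)) \<in> borel_measurable (stateM M)"
    by (rule measurable_compose[OF _ F]) (use m\<phi> in simp)
  have inner: "(\<integral>\<^sup>+a. F (y, a) \<partial>\<pi> n (h, y)) = F (y, \<phi> y)" if y: "y \<in> states M" for h y
  proof -
    have "\<phi> y \<in> space (actM M)" using measurable_space[OF m\<phi>, of y] y by (simp add: space_restrict_space)
    moreover have "(\<lambda>a. F (y, a)) \<in> borel_measurable (actM M)"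
      by (rule measurable_compose[OF _ F]) (use y in \<open>simp add: space_restrict_space\<close>)
    ultimately show ?thesis unfolding pi stat_policy_def by (simp add: nn_integral_return)
  qed
  show ?thesis
    unfolding nn_integral_state[OF f] by (rule nn_integral_component_state[OF F inner])
qed

end

section \<open>Costs as nonnegative integrals\<close>

lemma enn2ereal_INF: "enn2ereal (INF i\<in>I. f i) = (INF i\<in>I. enn2ereal (f i))"
proof (rule antisym)
  show "enn2ereal (INF i\<in>I. f i) \<le> (INF i\<in>I. enn2ereal (f i))"
    by (intro INF_greatest) (simp add: less_eq_ennreal.rep_eq[symmetric] INF_lower)
  have "e2ennreal (INF i\<in>I. enn2ereal (f i)) \<le> (INF i\<in>I. f i)"
  proof (rule INF_greatest)
    fix i assume "i \<in> I"
    then have "e2ennreal (INF i\<in>I. enn2ereal (f i)) \<le> e2ennreal (enn2ereal (f i))"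
      by (intro e2ennreal_mono INF_lower)
    then show "e2ennreal (INF i\<in>I. enn2ereal (f i)) \<le> f i" by simp
  qed
  moreover have "0 \<le> (INF i\<in>I. enn2ereal (f i))" by (intro INF_greatest) simp
  ultimately show "(INF i\<in>I. enn2ereal (f i)) \<le> enn2ereal (INF i\<in>I. f i)"
    by (simp add: less_eq_ennreal.rep_eq enn2ereal_e2ennreal)
qed

lemma enn2ereal_SUP:
  assumes "I \<noteq> {}"
  shows "enn2ereal (SUP i\<in>I. f i) = (SUP i\<in>I. enn2ereal (f i))"
proof (rule antisym)
  show "(SUP i\<in>I. enn2ereal (f i)) \<le> enn2ereal (SUP i\<in>I. f i)"
    by (intro SUP_least) (simp add: less_eq_ennreal.rep_eq[symmetric] SUP_upper)
  have "(SUP i\<in>I. f i) \<le> e2ennreal (SUP i\<in>I. enn2ereal (f i))"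
  proof (rule SUP_least)
    fix i assume "i \<in> I"
    then have "e2ennreal (enn2ereal (f i)) \<le> e2ennreal (SUP i\<in>I. enn2ereal (f i))"
      by (intro e2ennreal_mono SUP_upper)
    then show "f i \<le> e2ennreal (SUP i\<in>I. enn2ereal (f i))" by simp
  qed
  moreover have "0 \<le> (SUP i\<in>I. enn2ereal (f i))"
  proof -
    from assms obtain i where "i \<in> I" by auto
    then show ?thesis by (rule SUP_upper2) simp
  qed
  ultimately show "enn2ereal (SUP i\<in>I. f i) \<le> (SUP i\<in>I. enn2ereal (f i))"
    by (simp add: less_eq_ennreal.rep_eq enn2ereal_e2ennreal)
qed

lemma INF_add_ereal:
  fixes f :: "'i \<Rightarrow> ereal"
  shows "(INF i\<in>I. f i + ereal c) = (INF i\<in>I. f i) + ereal c"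
proof (rule antisym)
  show "(INF i\<in>I. f i) + ereal c \<le> (INF i\<in>I. f i + ereal c)"
    by (intro INF_greatest add_right_mono INF_lower)
  have "(INF i\<in>I. f i + ereal c) - ereal c \<le> (INF i\<in>I. f i)"
    by (intro INF_greatest) (simp add: ereal_minus_le INF_lower[where f="\<lambda>i. f i + ereal c"])
  then show "(INF i\<in>I. f i + ereal c) \<le> (INF i\<in>I. f i) + ereal c"
    by (simp add: ereal_minus_le)
qed

text \<open>
  Links the difference of two integrals to a single nonnegative one. The point is the identity
  \<open>f\<^sup>+ + c\<^sup>- = f\<^sup>- + h + c\<^sup>+\<close> for \<open>f = h + c\<close>, in which no subtraction occurs and which can
  therefore be integrated in \<^typ>\<open>ennreal\<close>.
\<close>

lemma eintegral_bounded_below: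
  assumes N: "prob_space N" and h: "h \<in> borel_measurable N"
    and f: "AE y in N. f y = enn2ereal (h y) + ereal c"
  shows "eintegral N f = enn2ereal (\<integral>\<^sup>+y. h y \<partial>N) + ereal c"
proof -
  interpret prob_space N by fact
  let ?f = "\<lambda>y. enn2ereal (h y) + ereal c"
  have mf: "?f \<in> borel_measurable N" using h by measurable
  let ?P = "\<integral>\<^sup>+y. e2ennreal (?f y) \<partial>N" and ?N = "\<integral>\<^sup>+y. e2ennreal (- ?f y) \<partial>N"
  have "(\<integral>\<^sup>+y. e2ennreal (f y) \<partial>N) = ?P" "(\<integral>\<^sup>+y. e2ennreal (- f y) \<partial>N) = ?N"
    by (rule nn_integral_cong_AE, use f in eventually_elim, simp)+
  then have eq: "eintegral N f = enn2ereal ?P - enn2ereal ?N" by (simp add: eintegral_def)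
  have pt: "e2ennreal (?f y) + ennreal (max 0 (- c)) = e2ennreal (- ?f y) + (h y + ennreal (max 0 c))" for y
  proof (cases "h y")
    case (real r)
    then have "?f y = ereal (r + c)" by simp
    then have "e2ennreal (?f y) = ennreal (r + c)" "e2ennreal (- ?f y) = ennreal (- (r + c))"
      by (simp_all only: e2ennreal_ereal uminus_ereal.simps)
    moreover have "ennreal (r + c) + ennreal (max 0 (- c)) = ennreal (- (r + c)) + (ennreal r + ennreal (max 0 c))"
      using real by (cases "r + c \<ge> 0"; cases "c \<ge> 0")
        (simp_all add: ennreal_neg max_def flip: ennreal_plus)
    ultimately show ?thesis using real by simp
  next
    case top then show ?thesis by simp
  qed
  have "?P + ennreal (max 0 (- c)) = ?N + ((\<integral>\<^sup>+y. h y \<partial>N) + ennreal (max 0 c))"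
  proof -
    have "?P + ennreal (max 0 (- c)) = (\<integral>\<^sup>+y. e2ennreal (?f y) + ennreal (max 0 (- c)) \<partial>N)"
      using h by (subst nn_integral_add) (auto simp: emeasure_space_1)
    also have "\<dots> = ?N + ((\<integral>\<^sup>+y. h y \<partial>N) + ennreal (max 0 c))"
      unfolding pt using h by (subst nn_integral_add; (subst nn_integral_add)?) (auto simp: emeasure_space_1)
    finally show ?thesis .
  qed
  moreover have "?N < top"
  proof -
    have "?N \<le> (\<integral>\<^sup>+y. ennreal (max 0 (- c)) \<partial>N)"
    proof (rule nn_integral_mono)
      fix y
      have "- ?f y \<le> ereal (max 0 (- c))"
        by (cases "h y") (auto simp: max_def)
      from e2ennreal_mono[OF this] show "e2ennreal (- ?f y) \<le> ennreal (max 0 (- c))"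
        unfolding e2ennreal_ereal .
    qed
    also have "\<dots> < top" by (simp add: emeasure_space_1)
    finally show ?thesis .
  qed
  ultimately show ?thesis unfolding eq
    by (cases ?P; cases ?N; cases "\<integral>\<^sup>+y. h y \<partial>N"; cases "c \<ge> 0")
      (auto simp: max_def ennreal_neg simp flip: ennreal_plus)
qed

text \<open>
  The value 0 at unavailable actions makes this function measurable on all state-action pairs, while the
  cost itself is measurable on the graph only.
\<close>

definition shifted_cost :: "('x::polish_space, 'a::polish_space) mdp \<Rightarrow> real \<Rightarrow> 'x \<times> 'a \<Rightarrow> ennreal" where
  "shifted_cost M K z = (if z \<in> Gr M (avail M) then e2ennreal (cost M z - ereal K) else 0)"

lemma shifted_cost_measurable:
  assumes "is_mdp M"
  shows "shifted_cost M K \<in> borel_measurable (pairM M)"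
proof -
  let ?G = "Gr M (avail M)"
  have G: "?G \<in> sets (restrict_space borel (states M \<times> actions M))"
    and c: "cost M \<in> borel_measurable (restrict_space borel ?G)"
    using assms by (auto simp: is_mdp_def)
  have sub: "?G \<subseteq> states M \<times> actions M" using sets.sets_into_space[OF G] by (simp add: space_restrict_space)
  have "(\<lambda>z. e2ennreal (cost M z - ereal K)) \<in> borel_measurable (restrict_space borel ?G)"
    using c by measurable
  then have 1: "(\<lambda>z. e2ennreal (cost M z - ereal K)) \<in> borel_measurable (restrict_space (restrict_space borel (states M \<times> actions M)) ?G)"
    using sub by (subst measurable_cong_sets[OF sets_restrict_restrict_space refl]) (simp add: Int_absorb1)
  have B: "{z \<in> space (restrict_space borel (states M \<times> actions M)). z \<in> ?G} = ?G"
    using sub by (auto simp: space_restrict_space)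
  show ?thesis
    unfolding measurable_cong_sets[OF sets_stateM_actM refl] shifted_cost_def[abs_def]
    using 1 G by (subst measurable_If_restrict_space_iff) (auto simp: B)
qed

lemma cost_eq_shifted:
  assumes "z \<in> Gr M (avail M)" "ereal K \<le> cost M z"
  shows "cost M z = enn2ereal (shifted_cost M K z) + ereal K"
proof -
  have "0 \<le> cost M z - ereal K" using assms(2) by (cases "cost M z") auto
  then show ?thesis using assms by (cases "cost M z") (auto simp: shifted_cost_def enn2ereal_e2ennreal)
qed

locale mdp_traj_cost = mdp_traj +
  fixes K :: real
  assumes K: "\<And>z. z \<in> Gr M (avail M) \<Longrightarrow> ereal K \<le> cost M z"
begin

definition stage_cost :: "nat \<Rightarrow> ennreal" where
  "stage_cost n = (\<integral>\<^sup>+\<omega>. shifted_cost M K (\<omega> n) \<partial>T)"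

lemma shifted_cost_component: "(\<lambda>\<omega>. shifted_cost M K (\<omega> n)) \<in> borel_measurable T"
  by (rule measurable_compose[OF component_T shifted_cost_measurable[OF mdp]])

lemma discounted_term:
  assumes "z \<in> Gr M (avail M)" "0 \<le> (b::real)"
  shows "ereal b * cost M z = enn2ereal (ennreal b * shifted_cost M K z) + ereal (b * K)"
  unfolding cost_eq_shifted[OF assms(1) K[OF assms(1)]]
  using assms(2) by (cases "shifted_cost M K z"; cases "b = 0")
    (auto simp: ring_distribs ennreal_mult_top zero_ennreal.rep_eq simp flip: ennreal_mult zero_ereal_def)

lemma fin_cost_eq:
  "fin_cost M N 1 \<pi> x = enn2ereal (\<Sum>n<N. stage_cost n) + ereal (real N * K)"
proof -
  have "AE \<omega> in T. \<forall>n. \<omega> n \<in> Gr M (avail M)" by (simp add: AE_all_countable AE_Gr)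
  then have "AE \<omega> in T. (\<Sum>n<N. ereal (1 ^ n) * cost M (\<omega> n)) =
      enn2ereal (\<Sum>n<N. shifted_cost M K (\<omega> n)) + ereal (real N * K)"
  proof eventually_elim
    case (elim \<omega>)
    have "(\<Sum>n<N. ereal (1 ^ n) * cost M (\<omega> n)) = (\<Sum>n<N. enn2ereal (shifted_cost M K (\<omega> n)) + ereal K)"
      by (intro sum.cong refl) (use elim cost_eq_shifted[OF _ K] in simp)
    then show ?case by (simp add: sum.distrib)
  qed
  from eintegral_bounded_below[OF prob_T _ this] shifted_cost_component
  show ?thesis unfolding fin_cost_def stage_cost_def by (simp add: nn_integral_sum)
qed

lemma disc_cost_eq:
  assumes \<alpha>: "0 \<le> \<alpha>" "\<alpha> < 1"
  shows "disc_cost M \<alpha> \<pi> x = enn2ereal (\<Sum>n. ennreal (\<alpha> ^ n) * stage_cost n) + ereal (K / (1 - \<alpha>))"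
proof -
  have geo: "(\<lambda>n. \<alpha> ^ n * K) sums (K / (1 - \<alpha>))"
    using sums_mult2[OF geometric_sums[of \<alpha>], of K] \<alpha> by simp
  have "AE \<omega> in T. \<forall>n. \<omega> n \<in> Gr M (avail M)" by (simp add: AE_all_countable AE_Gr)
  then have "AE \<omega> in T. (\<Sum>n. ereal (\<alpha> ^ n) * cost M (\<omega> n)) =
      enn2ereal (\<Sum>n. ennreal (\<alpha> ^ n) * shifted_cost M K (\<omega> n)) + ereal (K / (1 - \<alpha>))"
  proof eventually_elim
    case (elim \<omega>)
    let ?a = "\<lambda>n. ennreal (\<alpha> ^ n) * shifted_cost M K (\<omega> n)"
    have a: "(\<lambda>N. \<Sum>n<N. enn2ereal (?a n)) \<longlonglongrightarrow> enn2ereal (suminf ?a)"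
      using summable_sums[of ?a] by (simp only: sums_enn2ereal[symmetric] sums_def[symmetric]) simp
    have b: "(\<lambda>N. \<Sum>n<N. ereal (\<alpha> ^ n * K)) \<longlonglongrightarrow> ereal (K / (1 - \<alpha>))"
      using geo by (simp add: sums_def)
    have "(\<lambda>N. (\<Sum>n<N. enn2ereal (?a n)) + (\<Sum>n<N. ereal (\<alpha> ^ n * K))) \<longlonglongrightarrow> enn2ereal (suminf ?a) + ereal (K / (1 - \<alpha>))"
      by (rule tendsto_add_ereal_general1[OF _ a b]) simp
    then have "(\<lambda>n. enn2ereal (?a n) + ereal (\<alpha> ^ n * K)) sums (enn2ereal (suminf ?a) + ereal (K / (1 - \<alpha>)))"
      unfolding sums_def sum.distrib .
    then show ?case using elim \<alpha> by (simp add: discounted_term sums_iff)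
  qed
  from eintegral_bounded_below[OF prob_T _ this] shifted_cost_component
  show ?thesis unfolding disc_cost_def stage_cost_def
    by (simp add: nn_integral_suminf nn_integral_cmult)
qed

end

section \<open>Abel and Cesaro means of nonnegative sequences\<close>

text \<open>
  Abel summation, written with the distance of the partial sums to an arbitrary constant \<open>C\<close>; with \<open>C\<close> an
  upper bound of the partial sums every subtracted term is nonnegative.
\<close>

lemma summation_by_parts:
  fixes d :: "nat \<Rightarrow> real"
  shows "(\<Sum>n<N. \<alpha> ^ n * d n) = C - \<alpha> ^ N * (C - (\<Sum>k<N. d k)) - (1 - \<alpha>) * (\<Sum>n<N. \<alpha> ^ n * (C - (\<Sum>k<Suc n. d k)))"
  by (induction N) (simp_all add: algebra_simps)

text \<open>
  The set \<open>I\<close> collects indices at which the partial sums stay below their bound \<open>C\<close> by the margin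
  \<open>B\<close>; each of them lowers the Abel sum. With empty \<open>I\<close> this is the elementary Abelian
  estimate, with a long block of indices it is the quantitative step of the Tauberian one.
\<close>

lemma abel_sum_bound:
  fixes d :: "nat \<Rightarrow> real"
  assumes \<alpha>: "0 \<le> \<alpha>" "\<alpha> \<le> 1" and D: "\<And>n. (\<Sum>k<n. d k) \<le> C"
    and I: "I \<subseteq> {..<N}" "\<And>n. n \<in> I \<Longrightarrow> (\<Sum>k<Suc n. d k) \<le> C - B" "\<And>n. n \<in> I \<Longrightarrow> c \<le> \<alpha> ^ n" and "0 \<le> B"
  shows "(\<Sum>n<N. \<alpha> ^ n * d n) \<le> C - (1 - \<alpha>) * (real (card I) * (c * B))"
proof -
  have "real (card I) * (c * B) = (\<Sum>n\<in>I. c * B)" by simp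
  also have "\<dots> \<le> (\<Sum>n\<in>I. \<alpha> ^ n * (C - (\<Sum>k<Suc n. d k)))"
  proof (rule sum_mono)
    fix n assume n: "n \<in> I"
    have "c * B \<le> \<alpha> ^ n * B" using I(3)[OF n] \<open>0 \<le> B\<close> by (rule mult_right_mono)
    also have "\<dots> \<le> \<alpha> ^ n * (C - (\<Sum>k<Suc n. d k))"
      using I(2)[OF n] \<alpha> by (intro mult_left_mono) auto
    finally show "c * B \<le> \<alpha> ^ n * (C - (\<Sum>k<Suc n. d k))" .
  qed
  also have "\<dots> \<le> (\<Sum>n<N. \<alpha> ^ n * (C - (\<Sum>k<Suc n. d k)))"
    using I(1) D \<alpha> by (intro sum_mono2) (auto intro!: mult_nonneg_nonneg simp del: sum.lessThan_Suc)
  finally have "(1 - \<alpha>) * (real (card I) * (c * B)) \<le> (1 - \<alpha>) * (\<Sum>n<N. \<alpha> ^ n * (C - (\<Sum>k<Suc n. d k)))"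
    using \<alpha> by (intro mult_left_mono) auto
  moreover have "0 \<le> \<alpha> ^ N * (C - (\<Sum>k<N. d k))" using D[of N] \<alpha> by simp
  ultimately show ?thesis unfolding summation_by_parts[of \<alpha> d N C] by linarith
qed

lemma abel_sum_le_of_cesaro_le:
  fixes e :: "nat \<Rightarrow> real"
  assumes \<alpha>: "0 \<le> \<alpha>" "\<alpha> < 1" and S: "\<And>N. (\<Sum>n<N. e n) \<le> L * real N + C" and "0 \<le> L"
  shows "(\<Sum>n<N. \<alpha> ^ n * e n) \<le> L / (1 - \<alpha>) + C"
proof -
  have "(\<Sum>n<N. \<alpha> ^ n * (e n - L)) \<le> C"
    using abel_sum_bound[of \<alpha> "\<lambda>n. e n - L" C "{}" N 0 0] \<alpha> S
    by (simp add: sum_subtractf algebra_simps)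
  moreover have "(\<Sum>n<N. \<alpha> ^ n * e n) = (\<Sum>n<N. \<alpha> ^ n * (e n - L)) + L * (\<Sum>n<N. \<alpha> ^ n)"
    by (simp add: sum_distrib_left sum.distrib[symmetric] algebra_simps)
  moreover have "L * (\<Sum>n<N. \<alpha> ^ n) \<le> L * (1 / (1 - \<alpha>))"
    using \<alpha> \<open>0 \<le> L\<close> by (intro mult_left_mono) (auto simp: sum_gp_strict divide_right_mono)
  ultimately show ?thesis by simp
qed

lemma abel_suminf_le_of_cesaro_le:
  fixes e :: "nat \<Rightarrow> ennreal"
  assumes \<alpha>: "0 \<le> \<alpha>" "\<alpha> < 1" and S: "\<And>N. (\<Sum>n<N. e n) \<le> ennreal (L * real N + C)" and L: "0 \<le> L" "0 \<le> C"
  shows "(\<Sum>n. ennreal (\<alpha> ^ n) * e n) \<le> ennreal (L / (1 - \<alpha>) + C)"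
proof -
  have "e n < top" for n
  proof -
    have "e n \<le> (\<Sum>k<Suc n. e k)" by simp
    also have "\<dots> < top" by (rule le_less_trans[OF S]) simp
    finally show ?thesis .
  qed
  then have e: "e n = ennreal (enn2real (e n))" for n by simp
  have "(\<Sum>n<N. enn2real (e n)) \<le> L * real N + C" for N
    using S[of N] L by (subst (asm) e) (simp add: sum_ennreal ennreal_le_iff flip: ennreal_plus)
  from abel_sum_le_of_cesaro_le[OF \<alpha> this L(1)]
  have "(\<Sum>n<N. ennreal (\<alpha> ^ n) * e n) \<le> ennreal (L / (1 - \<alpha>) + C)" for N
    using \<alpha> by (subst e) (simp add: sum_ennreal ennreal_leI flip: ennreal_mult)
  then show ?thesis by (simp add: suminf_eq_SUP SUP_least)
qed

text \<open>
  A Tauberian theorem. Suppose that the Cesaro mean at a large \<open>N\<close> is below \<open>L - \<delta>\<close>. The partial sums increase, so the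
  mean stays below \<open>L\<close> by a margin on the whole block from \<open>(1 - \<eta>) N\<close> to \<open>N\<close>. For \<open>\<alpha> = 1 - 1/(2N)\<close>
  this block carries a fixed fraction of the Abel mean, while elsewhere the Cesaro means exceed \<open>L\<close> by an
  arbitrarily small amount. So the Abel mean at \<open>\<alpha>\<close> is less than \<open>L\<close> by a fixed amount.

  The Abel hypothesis speaks about upper bounds \<open>U\<close> of the partial sums, which avoids any
  assumption of convergence.
\<close>

lemma cesaro_ge_of_abel_ge:
  fixes e :: "nat \<Rightarrow> real"
  assumes e: "\<And>n. 0 \<le> e n"
    and upper: "\<And>\<epsilon>. \<epsilon> > 0 \<Longrightarrow> \<exists>C. \<forall>N. (\<Sum>n<N. e n) \<le> (L + \<epsilon>) * real N + C"
    and abel: "\<And>\<epsilon>. \<epsilon> > 0 \<Longrightarrow> \<exists>\<beta><1. \<forall>\<alpha> U. \<beta> \<le> \<alpha> \<and> \<alpha> < 1 \<and> (\<forall>N. (\<Sum>n<N. \<alpha> ^ n * e n) \<le> U) \<longrightarrow> L - \<epsilon> \<le> (1 - \<alpha>) * U"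
    and \<delta>: "\<delta> > 0"
  shows "\<forall>\<^sub>F N in sequentially. (L - \<delta>) * real N \<le> (\<Sum>n<N. e n)"
proof (rule ccontr)
  assume "\<not> ?thesis"
  then have freq: "\<exists>N\<ge>N0. (\<Sum>n<N. e n) < (L - \<delta>) * real N" for N0
    by (auto simp: eventually_sequentially not_le)
  have L: "\<delta> < L"
  proof -
    obtain N where "(\<Sum>n<N. e n) < (L - \<delta>) * real N" using freq by blast
    moreover have "0 \<le> (\<Sum>n<N. e n)" by (simp add: sum_nonneg e)
    ultimately have "0 < (L - \<delta>) * real N" by linarith
    then show ?thesis by (simp add: zero_less_mult_iff)
  qed
  \<comment> \<open>Chosen so that on the block the loss \<open>\<delta>\<close> is at least halved: \<open>L * \<eta> = \<delta> / 2\<close>.\<close>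
  define \<eta> where "\<eta> = \<delta> / (2 * L)"
  have \<eta>: "0 < \<eta>" "\<eta> < 1" "L * \<eta> = \<delta> / 2" using L \<delta> by (auto simp: \<eta>_def)
  \<comment> \<open>The gain on the block is about \<open>\<delta> * \<eta> / 16\<close>, which leaves room for \<open>2 * \<epsilon>\<close> and the error in \<open>1 / N\<close>.\<close>
  define \<epsilon> where "\<epsilon> = \<delta> * \<eta> / 64"
  have \<epsilon>: "\<epsilon> > 0" using \<delta> \<eta> by (simp add: \<epsilon>_def)
  obtain C where C: "\<And>N. (\<Sum>n<N. e n) \<le> (L + \<epsilon>) * real N + C" using upper[OF \<epsilon>] by blast
  have C0: "0 \<le> C" using C[of 0] by simp
  obtain \<beta> where \<beta>: "\<beta> < 1" "\<And>\<alpha> U. \<beta> \<le> \<alpha> \<Longrightarrow> \<alpha> < 1 \<Longrightarrow> (\<And>N. (\<Sum>n<N. \<alpha> ^ n * e n) \<le> U) \<Longrightarrow> L - \<epsilon> \<le> (1 - \<alpha>) * U"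
    using abel[OF \<epsilon>] by blast
  obtain N0 :: nat where N0: "max (max 1 (1 / (1 - \<beta>))) ((C / 2 + \<delta> / 16) * 32 / (\<delta> * \<eta>) + 1) \<le> real N0"
    using real_arch_simple by blast
  obtain N where N: "N0 \<le> N" "(\<Sum>n<N. e n) < (L - \<delta>) * real N" using freq by blast
  have rN: "1 \<le> real N" "1 / (1 - \<beta>) \<le> real N" "(C / 2 + \<delta> / 16) * 32 / (\<delta> * \<eta>) < real N"
    using N0 N(1) by linarith+
  define \<alpha> where "\<alpha> = 1 - 1 / (2 * real N)"
  have \<alpha>: "0 \<le> \<alpha>" "\<alpha> < 1" using rN(1) by (auto simp: \<alpha>_def field_simps)
  have \<beta>\<alpha>: "\<beta> \<le> \<alpha>"
  proof -
    have "1 / real N \<le> 1 - \<beta>" using rN \<beta>(1) by (simp add: field_simps)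
    moreover have "1 / (2 * real N) \<le> 1 / real N" using rN(1) by (simp add: field_simps)
    ultimately show ?thesis by (simp add: \<alpha>_def)
  qed
  \<comment> \<open>The factor 2 in \<open>\<alpha> = 1 - 1/(2N)\<close> makes the Bernoulli inequality sufficient here.\<close>
  have half: "1 / 2 \<le> \<alpha> ^ n" if "n \<le> N" for n
  proof -
    have "1 + real N * (- (1 / (2 * real N))) \<le> (1 + (- (1 / (2 * real N)))) ^ N"
      by (rule Bernoulli_inequality) (use rN(1) in \<open>simp add: field_simps\<close>)
    then have "1 / 2 \<le> \<alpha> ^ N" using rN(1) by (simp add: \<alpha>_def)
    also have "\<dots> \<le> \<alpha> ^ n" using that \<alpha> by (intro power_decreasing) auto
    finally show ?thesis .
  qed
  define m where "m = nat \<lceil>(1 - \<eta>) * real N\<rceil>"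
  have m: "(1 - \<eta>) * real N \<le> real m" "real m \<le> (1 - \<eta>) * real N + 1"
    using \<eta> unfolding m_def by (auto simp: of_nat_nat intro: less_imp_le)
  define d where "d n = e n - (L + \<epsilon>)" for n
  have sd: "(\<Sum>k<n. d k) = (\<Sum>k<n. e k) - (L + \<epsilon>) * real n" for n
    by (simp add: d_def sum_subtractf algebra_simps)
  have low: "(\<Sum>k<Suc n. d k) \<le> C - \<delta> / 2 * real N" if "n \<in> {m..<N}" for n
  proof -
    have "(\<Sum>k<Suc n. e k) \<le> (\<Sum>k<N. e k)" using that e by (intro sum_mono2) auto
    moreover have "L * ((1 - \<eta>) * real N) \<le> L * real (Suc n)"
      using that m(1) L \<delta> by (intro mult_left_mono) auto
    moreover have "0 \<le> \<epsilon> * real (Suc n)" using \<epsilon> by simp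
    ultimately have "(\<Sum>k<Suc n. d k) \<le> (L - \<delta>) * real N - L * ((1 - \<eta>) * real N)"
      using N(2) unfolding sd ring_distribs by linarith
    also have "\<dots> = (L * \<eta> - \<delta>) * real N" by (simp add: algebra_simps)
    also have "\<dots> = - (\<delta> / 2 * real N)" unfolding \<eta>(3) by (simp add: algebra_simps)
    finally show ?thesis using C0 by simp
  qed
  let ?G = "(1 - \<alpha>) * (real (card {m..<N}) * (1 / 2 * (\<delta> / 2 * real N)))"
  define U where "U = (L + \<epsilon>) / (1 - \<alpha>) + (C - ?G)"
  have bound: "(\<Sum>n<N'. \<alpha> ^ n * e n) \<le> U" for N'
  proof -
    have "(\<Sum>n<N'. \<alpha> ^ n * e n) \<le> (\<Sum>n<max N N'. \<alpha> ^ n * e n)"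
      using \<alpha> e by (intro sum_mono2) auto
    also have "\<dots> = (\<Sum>n<max N N'. \<alpha> ^ n * d n) + (L + \<epsilon>) * (\<Sum>n<max N N'. \<alpha> ^ n)"
      by (simp add: d_def sum_distrib_left sum.distrib[symmetric] algebra_simps)
    also have "(\<Sum>n<max N N'. \<alpha> ^ n * d n) \<le> C - ?G"
    proof (rule abel_sum_bound)
      show "(\<Sum>k<n. d k) \<le> C" for n using C[of n] by (simp add: sd)
    qed (use \<alpha> low half \<delta> in auto)
    also have "(L + \<epsilon>) * (\<Sum>n<max N N'. \<alpha> ^ n) \<le> (L + \<epsilon>) * (1 / (1 - \<alpha>))"
      using \<alpha> \<epsilon> L \<delta> by (intro mult_left_mono) (auto simp: sum_gp_strict divide_right_mono)
    finally show ?thesis by (simp add: U_def)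
  qed
  have card: "\<eta> * real N - 1 \<le> real (card {m..<N})"
    using m(2) by (simp add: algebra_simps of_nat_diff_if)
  have "(1 - \<alpha>) * U = (L + \<epsilon>) + (1 - \<alpha>) * (C - ?G)"
    unfolding U_def using \<alpha> by (subst distrib_left) simp
  also have "\<dots> \<le> (L + \<epsilon>) + (1 - \<alpha>) * (C - (1 - \<alpha>) * ((\<eta> * real N - 1) * (1 / 2 * (\<delta> / 2 * real N))))"
    using \<alpha> card \<delta> by (intro add_left_mono mult_left_mono diff_left_mono mult_right_mono) auto
  also have "\<dots> = L + \<epsilon> + C / (2 * real N) - \<delta> * \<eta> / 16 + \<delta> / (16 * real N)"
    using rN(1) by (simp add: \<alpha>_def field_simps)
  also have "\<dots> = L + \<epsilon> - \<delta> * \<eta> / 16 + (C / 2 + \<delta> / 16) / real N"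
    using rN(1) by (simp add: field_simps)
  also have "(C / 2 + \<delta> / 16) / real N < \<delta> * \<eta> / 32"
    using rN \<delta> \<eta> by (simp add: field_simps)
  also have "L + \<epsilon> - \<delta> * \<eta> / 16 + \<delta> * \<eta> / 32 = L - \<epsilon>"
    by (simp add: \<epsilon>_def)
  finally have "(1 - \<alpha>) * U < L - \<epsilon>" by simp
  with \<beta>(2)[OF \<beta>\<alpha> \<alpha>(2) bound] show False by simp
qed

section \<open>Dynamic programming for discounted costs\<close>

locale mdp_W_star =
  fixes M :: "('x::polish_space, 'a::polish_space) mdp" and K :: real
  assumes mdp: "is_mdp M" and W_star: "assumption_W_star M"
    and K: "\<And>z. z \<in> Gr M (avail M) \<Longrightarrow> ereal K \<le> cost M z"
begin

abbreviation "S \<equiv> states M"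
abbreviation "A \<equiv> avail M"
abbreviation "G \<equiv> Gr M (avail M)"

lemma Gr_iff [simp]: "(x, a) \<in> G \<longleftrightarrow> x \<in> S \<and> a \<in> A x"
  by (simp add: Gr_def)

lemma kernel_prob: "z \<in> G \<Longrightarrow> kernel M z \<in> space (prob_algebra (stateM M))"
proof -
  assume "z \<in> G"
  then have "z \<in> space (restrict_space borel G)" by (simp add: space_restrict_space)
  then show ?thesis using mdp unfolding is_mdp_def by (meson measurable_space)
qed

lemma kernel_space: "z \<in> G \<Longrightarrow> space (kernel M z) = S"
  using kernel_prob[of z] sets_eq_imp_space_eq[of "kernel M z" "stateM M"]
  by (auto simp: space_prob_algebra space_restrict_space)

lemma kernel_measurable_iff: "z \<in> G \<Longrightarrow> measurable (kernel M z) N = measurable (stateM M) N"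
  using kernel_prob[of z] by (intro measurable_cong_sets) (auto simp: space_prob_algebra)

lemma kernel_prob_space: "z \<in> G \<Longrightarrow> prob_space (kernel M z)"
  using kernel_prob[of z] by (simp add: space_prob_algebra)

lemma kernel_integral_lsc:
  assumes f: "lsc_seq S f"
  shows "lsc_seq G (\<lambda>z. \<integral>\<^sup>+y. f y \<partial>kernel M z)"
  unfolding lsc_seq_def
proof (intro allI impI)
  fix Z z assume Z: "(\<forall>n. Z n \<in> G) \<and> z \<in> G \<and> Z \<longlonglongrightarrow> z"
  have "weakly_continuous_kernel M" using W_star by (simp add: assumption_W_star_def)
  then have "(\<lambda>n. \<integral>y. h y \<partial>kernel M (Z n)) \<longlonglongrightarrow> (\<integral>y. h y \<partial>kernel M z)"
    if "continuous_on S h" "bounded (h ` S)" for h :: "'x \<Rightarrow> real"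
    using that Z unfolding weakly_continuous_kernel_def by blast
  then show "(\<integral>\<^sup>+y. f y \<partial>kernel M z) \<le> liminf (\<lambda>n. \<integral>\<^sup>+y. f y \<partial>kernel M (Z n))"
    by (rule weak_liminf_nn_integral) (use Z kernel_prob f in auto)
qed

abbreviation "g \<equiv> shifted_cost M K"

lemma shifted_cost_lsc: "lsc_seq G g"
proof (rule lsc_seqI)
  fix X x t assume X: "\<And>n. X n \<in> G" "x \<in> G" "X \<longlonglongrightarrow> x" and t: "t < g x"
  obtain r where r: "t = ennreal r" "0 \<le> r" using t by (cases t) (auto simp: top_unique)
  have lsc: "lsc_on G (cost M)" using W_star by (simp add: assumption_W_star_def)
  then obtain C where C: "closed C" "{y \<in> G. cost M y \<le> ereal (r + K)} = G \<inter> C"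
    unfolding lsc_on_def closedin_closed by meson
  have gt: "t < g z \<longleftrightarrow> \<not> cost M z \<le> ereal (r + K)" if "z \<in> G" for z
    using cost_eq_shifted[OF that K[OF that]] r by (cases "g z") (auto simp: ennreal_less_iff)
  have "x \<in> - C" using t X(2) gt[OF X(2)] C(2) by blast
  then have "\<forall>\<^sub>F n in sequentially. X n \<in> - C"
    using X(3) C(1) by (intro topological_tendstoD) auto
  then show "\<forall>\<^sub>F n in sequentially. t < g (X n)"
    by eventually_elim (use X(1) gt C(2) in blast)
qed

text \<open>
  The compactness clause of the assumption, for bounds that converge instead of a uniform one: a tail of
  the sequence is bounded by \<open>L + 1\<close>.
\<close>

lemma bounded_cost_convergent_subsequence:
  assumes X: "\<And>n. X n \<in> S" "x \<in> S" "X \<longlonglongrightarrow> x" and a: "\<And>n. a n \<in> A (X n)"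
    and l: "\<And>n. g (X n, a n) \<le> l n" "l \<longlonglongrightarrow> L" "L < top"
  obtains b r where "b \<in> A x" "strict_mono (r::nat \<Rightarrow> nat)" "(a \<circ> r) \<longlonglongrightarrow> b"
proof -
  have "L < L + 1" using l(3) by (cases L) (auto simp: ennreal_less_iff simp flip: ennreal_1 ennreal_plus)
  with order_tendstoD(2)[OF l(2)] have "\<forall>\<^sub>F n in sequentially. l n < L + 1" by blast
  then obtain N where N: "\<And>n. n \<ge> N \<Longrightarrow> l n < L + 1"
    unfolding eventually_sequentially by blast
  have "L + 1 < top" using l(3) by simp
  then obtain c where c: "L + 1 = ennreal c" "0 \<le> c" by (cases "L + 1") auto
  have "cost M (X (n + N), a (n + N)) \<le> ereal (c + K)" for n
  proof -
    have z: "(X (n + N), a (n + N)) \<in> G" using X a by simp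
    have "g (X (n + N), a (n + N)) \<le> ennreal c"
      using order_trans[OF l(1)[of "n + N"] less_imp_le[OF N[of "n + N"]]] c(1) by simp
    then show ?thesis using cost_eq_shifted[OF z K[OF z]] c(2)
      by (cases "g (X (n + N), a (n + N))") (auto simp: top_unique)
  qed
  then have "\<exists>b\<in>A x. \<exists>r::nat \<Rightarrow> nat. strict_mono r \<and> ((\<lambda>n. a (n + N)) \<circ> r) \<longlonglongrightarrow> b"
    using W_star X a LIMSEQ_ignore_initial_segment[OF X(3), of N] unfolding assumption_W_star_def
    by (elim conjE allE[of _ "\<lambda>n. X (n + N)"] allE[of _ x] allE[of _ "\<lambda>n. a (n + N)"]) blast
  then obtain b r where "b \<in> A x" "strict_mono (r::nat \<Rightarrow> nat)" "((\<lambda>n. a (n + N)) \<circ> r) \<longlonglongrightarrow> b"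
    by blast
  then show thesis using that[of b "\<lambda>n. r n + N"] by (auto simp: strict_mono_def comp_def)
qed

definition Qval :: "real \<Rightarrow> ('x \<Rightarrow> ennreal) \<Rightarrow> 'x \<Rightarrow> 'a \<Rightarrow> ennreal" where
  "Qval \<alpha> f x a = g (x, a) + ennreal \<alpha> * (\<integral>\<^sup>+y. f y \<partial>kernel M (x, a))"

lemma shifted_cost_le_Qval: "g (x, a) \<le> Qval \<alpha> f x a"
  by (simp add: Qval_def)

lemma Qval_lsc: "lsc_seq S f \<Longrightarrow> lsc_seq G (\<lambda>z. Qval \<alpha> f (fst z) (snd z))"
  unfolding Qval_def prod.collapse
  by (intro lsc_seq_add lsc_seq_cmult shifted_cost_lsc kernel_integral_lsc)

lemma Qval_limit:
  assumes f: "lsc_seq S f" and X: "\<And>n. X n \<in> S" "x \<in> S" "X \<longlonglongrightarrow> x" "\<And>n. a n \<in> A (X n)" "b \<in> A x" "a \<longlonglongrightarrow> b"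
    and l: "\<forall>\<^sub>F n in sequentially. Qval \<alpha> f (X n) (a n) \<le> l n" "l \<longlonglongrightarrow> L"
  shows "Qval \<alpha> f x b \<le> L"
proof -
  have "Qval \<alpha> f x b \<le> liminf (\<lambda>n. Qval \<alpha> f (X n) (a n))"
    using lsc_seqD[OF Qval_lsc[OF f], of "\<lambda>n. (X n, a n)" "(x, b)" \<alpha>] X by (auto intro: tendsto_Pair)
  also have "\<dots> \<le> liminf l" by (rule Liminf_mono[OF l(1)])
  also have "\<dots> = L" using l(2) by (intro lim_imp_Liminf) auto
  finally show ?thesis .
qed

lemma Qval_K_inf_compact:
  assumes f: "lsc_seq S f"
  shows "K_inf_compact S A (Qval \<alpha> f)"
  unfolding K_inf_compact_def
proof (intro allI impI, elim conjE)
  fix X x a l L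
  assume X: "\<forall>n. X n \<in> S" "x \<in> S" "X \<longlonglongrightarrow> x" "\<forall>n. a n \<in> A (X n)"
    and l: "\<forall>n. Qval \<alpha> f (X n) (a n) \<le> l n" "l \<longlonglongrightarrow> L" "L < top"
  have "g (X n, a n) \<le> l n" for n
    using order_trans[OF shifted_cost_le_Qval] l(1) by blast
  then obtain b r where b: "b \<in> A x" "strict_mono (r::nat \<Rightarrow> nat)" "(a \<circ> r) \<longlonglongrightarrow> b"
    using bounded_cost_convergent_subsequence[of X x a l L] X l by blast
  have "Qval \<alpha> f x b \<le> L"
    by (rule Qval_limit[OF f, where X="X \<circ> r" and a="a \<circ> r" and l="l \<circ> r"])
      (use X l b in \<open>auto intro: LIMSEQ_subseq_LIMSEQ\<close>)
  with b show "\<exists>b\<in>A x. Qval \<alpha> f x b \<le> L \<and> (\<exists>r. strict_mono r \<and> (a \<circ> r) \<longlonglongrightarrow> b)" by blast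
qed

lemma Qval_mono:
  assumes "\<And>y. y \<in> S \<Longrightarrow> f y \<le> h y" "(x, a) \<in> G" "\<alpha> \<le> \<beta>"
  shows "Qval \<alpha> f x a \<le> Qval \<beta> h x a"
  unfolding Qval_def using assms
  by (intro add_mono mult_mono nn_integral_mono ennreal_leI) (auto simp: kernel_space)

lemma Qval_SUP:
  assumes "\<And>n. lsc_seq S (F n)" "\<And>n y. F n y \<le> F (Suc n) y" "(x, a) \<in> G"
  shows "Qval \<alpha> (\<lambda>y. SUP n. F n y) x a = (SUP n. Qval \<alpha> (F n) x a)"
proof -
  have inc: "incseq F" using assms(2) by (intro incseq_SucI) (auto simp: le_fun_def)
  have m: "F n \<in> borel_measurable (kernel M (x, a))" for n
    unfolding kernel_measurable_iff[OF assms(3)] by (rule lsc_seq_measurable[OF assms(1)])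
  show ?thesis
    unfolding Qval_def
    by (subst nn_integral_monotone_convergence_SUP[OF inc m])
      (simp add: SUP_mult_left_ennreal ennreal_SUP_add_right)
qed

text \<open>
  The Bellman operator.
\<close>

definition opt :: "real \<Rightarrow> ('x \<Rightarrow> ennreal) \<Rightarrow> 'x \<Rightarrow> ennreal" where
  "opt \<alpha> f x = (INF a\<in>A x. Qval \<alpha> f x a)"

lemma avail_ne: "x \<in> S \<Longrightarrow> A x \<noteq> {}"
  using mdp by (auto simp: is_mdp_def)

lemma opt_lsc: "lsc_seq S f \<Longrightarrow> lsc_seq S (opt \<alpha> f)"
  using K_inf_compact_INF_lsc[OF Qval_K_inf_compact, of f UNIV \<alpha>] by (simp add: opt_def[abs_def])

lemma opt_mono: "(\<And>y. y \<in> S \<Longrightarrow> f y \<le> h y) \<Longrightarrow> x \<in> S \<Longrightarrow> opt \<alpha> f x \<le> opt \<alpha> h x"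
  unfolding opt_def by (rule INF_mono, rule bexI, rule Qval_mono) auto

lemma opt_attained:
  assumes "lsc_seq S f" "x \<in> S"
  obtains a where "a \<in> A x" "Qval \<alpha> f x a = opt \<alpha> f x"
  using K_inf_compact_attained[OF Qval_K_inf_compact[OF assms(1), of \<alpha>] assms(2), of UNIV] avail_ne[OF assms(2)]
  unfolding opt_def by auto

lemma stationary_selector:
  assumes "lsc_seq S f"
  obtains \<phi> where "stationary M \<phi>" "\<And>x. x \<in> S \<Longrightarrow> Qval \<alpha> f x (\<phi> x) = opt \<alpha> f x"
proof -
  obtain \<psi> where "stationary M \<psi>" using mdp by (auto simp: is_mdp_def)
  then have "\<psi> \<in> borel_measurable (stateM M)" "\<And>x. x \<in> S \<Longrightarrow> \<psi> x \<in> A x"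
    by (auto simp: stationary_def measurable_restrict_space2_iff)
  from K_inf_compact_selection[OF Qval_K_inf_compact[OF assms] this]
  obtain \<phi> where \<phi>: "\<phi> \<in> borel_measurable (stateM M)"
    "\<And>x. x \<in> S \<Longrightarrow> \<phi> x \<in> A x \<and> Qval \<alpha> f x (\<phi> x) = (INF a\<in>A x. Qval \<alpha> f x a)" by blast
  have "A x \<subseteq> actions M" if "x \<in> S" for x using mdp that by (auto simp: is_mdp_def)
  then have "stationary M \<phi>"
    using \<phi> unfolding stationary_def
    by (intro conjI ballI measurable_restrict_space2 Pi_I) (auto simp: space_restrict_space)
  with \<phi> show thesis using that by (auto simp: opt_def)
qed

text \<open>
  The value 0 outside the state space lets the iterates increase on the whole type, as monotone
  convergence requires.
\<close>

primrec value_iter :: "real \<Rightarrow> nat \<Rightarrow> 'x \<Rightarrow> ennreal" where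
  "value_iter \<alpha> 0 = (\<lambda>x. 0)"
| "value_iter \<alpha> (Suc n) = (\<lambda>x. if x \<in> S then opt \<alpha> (value_iter \<alpha> n) x else 0)"

lemma value_iter_lsc: "lsc_seq S (value_iter \<alpha> n)"
proof (induction n)
  case (Suc n)
  have "lsc_seq S (value_iter \<alpha> (Suc n)) \<longleftrightarrow> lsc_seq S (opt \<alpha> (value_iter \<alpha> n))" by (rule lsc_seq_cong) simp
  then show ?case using opt_lsc[OF Suc] by blast
qed (simp add: lsc_seq_const)

lemma value_iter_mono: "value_iter \<alpha> n x \<le> value_iter \<alpha> (Suc n) x"
  by (induction n arbitrary: x) (auto intro!: opt_mono)

lemma value_iter_mono': "m \<le> n \<Longrightarrow> value_iter \<alpha> m x \<le> value_iter \<alpha> n x"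
  by (rule lift_Suc_mono_le[of "\<lambda>n. value_iter \<alpha> n x"]) (rule value_iter_mono)

definition value_lim :: "real \<Rightarrow> 'x \<Rightarrow> ennreal" where
  "value_lim \<alpha> x = (SUP n. value_iter \<alpha> n x)"

lemma value_lim_lsc: "lsc_seq S (value_lim \<alpha>)"
  unfolding value_lim_def[abs_def] by (intro lsc_seq_SUP value_iter_lsc)

text \<open>
  Minimizers for the successive iterates have bounded cost, hence a limit point \<open>b\<close>. For fixed \<open>m\<close> the \<open>m\<close>-th iterate is
  dominated by the later ones, so lower semicontinuity bounds its one-step cost at \<open>b\<close>; then \<open>m\<close> tends to infinity by
  monotone convergence.
\<close>

lemma value_lim_superharmonic:
  assumes x: "x \<in> S"
  obtains a where "a \<in> A x" "Qval \<alpha> (value_lim \<alpha>) x a \<le> value_lim \<alpha> x"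
proof (cases "value_lim \<alpha> x < top")
  case False
  then show thesis using avail_ne[OF x] that by (auto simp: less_top[symmetric])
next
  case True
  have "\<exists>a. a \<in> A x \<and> Qval \<alpha> (value_iter \<alpha> n) x a \<le> value_lim \<alpha> x" for n
  proof -
    obtain a where "a \<in> A x" "Qval \<alpha> (value_iter \<alpha> n) x a = opt \<alpha> (value_iter \<alpha> n) x"
      using opt_attained[OF value_iter_lsc x] .
    moreover have "value_iter \<alpha> (Suc n) x \<le> value_lim \<alpha> x" unfolding value_lim_def by (rule SUP_upper) simp
    ultimately show ?thesis using x by auto
  qed
  then obtain a where a: "\<And>n. a n \<in> A x" "\<And>n. Qval \<alpha> (value_iter \<alpha> n) x (a n) \<le> value_lim \<alpha> x" by metis
  have "g (x, a n) \<le> value_lim \<alpha> x" for n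
    by (rule order_trans[OF shifted_cost_le_Qval a(2)])
  then obtain b r where b: "b \<in> A x" "strict_mono (r::nat \<Rightarrow> nat)" "(a \<circ> r) \<longlonglongrightarrow> b"
    using bounded_cost_convergent_subsequence[of "\<lambda>n. x" x a "\<lambda>n. value_lim \<alpha> x" "value_lim \<alpha> x"] x a True by auto
  have "Qval \<alpha> (value_iter \<alpha> m) x b \<le> value_lim \<alpha> x" for m
  proof (rule Qval_limit[OF value_iter_lsc, where X="\<lambda>n. x" and a="a \<circ> r" and l="\<lambda>n. value_lim \<alpha> x"])
    show "\<forall>\<^sub>F n in sequentially. Qval \<alpha> (value_iter \<alpha> m) x ((a \<circ> r) n) \<le> value_lim \<alpha> x"
      using eventually_ge_at_top[of m]
    proof eventually_elim
      case (elim n)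
      then have "m \<le> r n" using seq_suble[OF b(2), of n] by linarith
      then have "Qval \<alpha> (value_iter \<alpha> m) x (a (r n)) \<le> Qval \<alpha> (value_iter \<alpha> (r n)) x (a (r n))"
        using x a by (intro Qval_mono value_iter_mono') auto
      then show ?case using a(2)[of "r n"] by simp
    qed
  qed (use x a b in auto)
  then have "Qval \<alpha> (value_lim \<alpha>) x b \<le> value_lim \<alpha> x"
    unfolding value_lim_def[abs_def] using x b
    by (subst Qval_SUP) (auto simp: value_lim_def[symmetric] simp del: value_iter.simps intro!: SUP_least value_iter_lsc value_iter_mono)
  with b show thesis using that by blast
qed

lemma traj_cost: "\<pi> \<in> policies M \<Longrightarrow> x \<in> S \<Longrightarrow> mdp_traj_cost M \<pi> x K"
  by unfold_locales (use mdp K in auto)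

lemma stat_traj_cost: "stationary M \<phi> \<Longrightarrow> x \<in> S \<Longrightarrow> mdp_traj_cost M (stat_policy M \<phi>) x K"
  by (intro traj_cost stat_policy_in_policies mdp)

abbreviation "stage \<pi> x n \<equiv> mdp_traj_cost.stage_cost M \<pi> x K n"

lemma nn_integral_Qval:
  assumes \<pi>: "\<pi> \<in> policies M" and x: "x \<in> S" and f: "f \<in> borel_measurable (stateM M)"
  shows "stage \<pi> x n + ennreal \<alpha> * (\<integral>\<^sup>+\<omega>. f (fst (\<omega> (Suc n))) \<partial>trajM M \<pi> x) =
    (\<integral>\<^sup>+\<omega>. g (\<omega> n) + ennreal \<alpha> * (\<integral>\<^sup>+y. f y \<partial>ext_kernel M (\<omega> n)) \<partial>trajM M \<pi> x)"
    and "(\<lambda>z. g z + ennreal \<alpha> * (\<integral>\<^sup>+y. f y \<partial>ext_kernel M z)) \<in> borel_measurable (pairM M)"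
proof -
  interpret mdp_traj_cost M \<pi> x K by (rule traj_cost[OF \<pi> x])
  have m: "(\<lambda>z. \<integral>\<^sup>+y. f y \<partial>ext_kernel M z) \<in> borel_measurable (pairM M)"
    by (rule measurable_compose[OF measurable_prob_algebraD[OF ext_kernel_measurable[OF mdp]] nn_integral_measurable_subprob_algebra[OF f]])
  then show "(\<lambda>z. g z + ennreal \<alpha> * (\<integral>\<^sup>+y. f y \<partial>ext_kernel M z)) \<in> borel_measurable (pairM M)"
    using shifted_cost_measurable[OF mdp, of K] by measurable
  show "stage \<pi> x n + ennreal \<alpha> * (\<integral>\<^sup>+\<omega>. f (fst (\<omega> (Suc n))) \<partial>trajM M \<pi> x) =
    (\<integral>\<^sup>+\<omega>. g (\<omega> n) + ennreal \<alpha> * (\<integral>\<^sup>+y. f y \<partial>ext_kernel M (\<omega> n)) \<partial>trajM M \<pi> x)"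
    using measurable_compose[OF component_T m] shifted_cost_component
    by (simp add: nn_integral_add nn_integral_cmult nn_integral_next_state[OF f] stage_cost_def)
qed

lemma Qval_ext_kernel:
  "(y, a) \<in> G \<Longrightarrow> Qval \<alpha> f y a = g (y, a) + ennreal \<alpha> * (\<integral>\<^sup>+y. f y \<partial>ext_kernel M (y, a))"
  by (simp add: Qval_def ext_kernel_def)

text \<open>
  No policy beats the Bellman operator on average in a single step, whatever its dependence on the past.
\<close>

lemma nn_integral_opt_le:
  assumes \<pi>: "\<pi> \<in> policies M" and x: "x \<in> S" and f: "lsc_seq S f"
  shows "(\<integral>\<^sup>+\<omega>. opt \<alpha> f (fst (\<omega> n)) \<partial>trajM M \<pi> x)
    \<le> stage \<pi> x n + ennreal \<alpha> * (\<integral>\<^sup>+\<omega>. f (fst (\<omega> (Suc n))) \<partial>trajM M \<pi> x)"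
proof -
  interpret mdp_traj_cost M \<pi> x K by (rule traj_cost[OF \<pi> x])
  show ?thesis
    unfolding nn_integral_Qval(1)[OF \<pi> x lsc_seq_measurable[OF f]]
  proof (rule nn_integral_mono_AE, use AE_Gr[of n] in eventually_elim)
    case (elim \<omega>)
    then have "opt \<alpha> f (fst (\<omega> n)) \<le> Qval \<alpha> f (fst (\<omega> n)) (snd (\<omega> n))"
      unfolding opt_def by (intro INF_lower) (auto simp: Gr_def)
    then show ?case using elim Qval_ext_kernel[of "fst (\<omega> n)" "snd (\<omega> n)" \<alpha> f] by simp
  qed
qed

lemma nn_integral_value_iter_le:
  assumes \<pi>: "\<pi> \<in> policies M" and x: "x \<in> S" and "0 \<le> \<alpha>"
  shows "(\<integral>\<^sup>+\<omega>. value_iter \<alpha> m (fst (\<omega> n)) \<partial>trajM M \<pi> x) \<le> (\<Sum>k<m. ennreal (\<alpha> ^ k) * stage \<pi> x (n + k))"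
proof (induction m arbitrary: n)
  case (Suc m)
  interpret mdp_traj_cost M \<pi> x K by (rule traj_cost[OF \<pi> x])
  have "(\<integral>\<^sup>+\<omega>. value_iter \<alpha> (Suc m) (fst (\<omega> n)) \<partial>T) \<le> (\<integral>\<^sup>+\<omega>. opt \<alpha> (value_iter \<alpha> m) (fst (\<omega> n)) \<partial>T)"
    by (intro nn_integral_mono) simp
  also have "\<dots> \<le> stage \<pi> x n + ennreal \<alpha> * (\<integral>\<^sup>+\<omega>. value_iter \<alpha> m (fst (\<omega> (Suc n))) \<partial>T)"
    by (rule nn_integral_opt_le[OF \<pi> x value_iter_lsc])
  also have "\<dots> \<le> stage \<pi> x n + ennreal \<alpha> * (\<Sum>k<m. ennreal (\<alpha> ^ k) * stage \<pi> x (Suc n + k))"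
    by (intro add_left_mono mult_left_mono Suc) simp
  also have "\<dots> = (\<Sum>k<Suc m. ennreal (\<alpha> ^ k) * stage \<pi> x (n + k))"
    using \<open>0 \<le> \<alpha>\<close> by (subst sum.lessThan_Suc_shift) (simp add: sum_distrib_left ennreal_mult mult.assoc)
  finally show ?case .
qed simp

lemma value_lim_le_cost:
  assumes \<pi>: "\<pi> \<in> policies M" and x: "x \<in> S" and "0 \<le> \<alpha>"
  shows "value_lim \<alpha> x \<le> (\<Sum>n. ennreal (\<alpha> ^ n) * stage \<pi> x n)"
  unfolding value_lim_def
proof (rule SUP_least)
  fix m
  interpret mdp_traj_cost M \<pi> x K by (rule traj_cost[OF \<pi> x])
  have "value_iter \<alpha> m x = (\<integral>\<^sup>+\<omega>. value_iter \<alpha> m (fst (\<omega> 0)) \<partial>T)"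
    by (rule nn_integral_initial_state[symmetric, OF lsc_seq_measurable[OF value_iter_lsc]])
  also have "\<dots> \<le> (\<Sum>n<m. ennreal (\<alpha> ^ n) * stage \<pi> x n)"
    using nn_integral_value_iter_le[OF \<pi> x \<open>0 \<le> \<alpha>\<close>, of m 0] by simp
  also have "\<dots> \<le> (\<Sum>n. ennreal (\<alpha> ^ n) * stage \<pi> x n)"
    by (rule sum_le_suminf) auto
  finally show "value_iter \<alpha> m x \<le> (\<Sum>n. ennreal (\<alpha> ^ n) * stage \<pi> x n)" .
qed

text \<open>
  A function that dominates its one-step cost along \<open>\<phi>\<close> up to a constant \<open>W\<close> per step bounds the total cost
  of \<open>\<phi>\<close>. It serves twice: with \<open>W = 0\<close> for discounted costs, and with \<open>\<alpha> = 1\<close> for the average cost.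
\<close>

lemma stationary_cost_bound:
  assumes \<phi>: "stationary M \<phi>" and x: "x \<in> S" and f: "lsc_seq S f" and "0 \<le> \<alpha>"
    and le: "\<And>y. y \<in> S \<Longrightarrow> Qval \<alpha> f y (\<phi> y) \<le> W + f y"
  shows "(\<Sum>k<n. ennreal (\<alpha> ^ k) * stage (stat_policy M \<phi>) x k) \<le> W * (\<Sum>k<n. ennreal (\<alpha> ^ k)) + f x"
proof -
  interpret mdp_traj_cost M "stat_policy M \<phi>" x K by (rule stat_traj_cost[OF \<phi> x])
  have mf: "f \<in> borel_measurable (stateM M)" by (rule lsc_seq_measurable[OF f])
  let ?F = "\<lambda>z. g z + ennreal \<alpha> * (\<integral>\<^sup>+y. f y \<partial>ext_kernel M z)"
  have one: "stage_cost n + ennreal \<alpha> * (\<integral>\<^sup>+\<omega>. f (fst (\<omega> (Suc n))) \<partial>T) \<le> W + (\<integral>\<^sup>+\<omega>. f (fst (\<omega> n)) \<partial>T)" for n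
  proof -
    have "stage_cost n + ennreal \<alpha> * (\<integral>\<^sup>+\<omega>. f (fst (\<omega> (Suc n))) \<partial>T) = (\<integral>\<^sup>+\<omega>. ?F (\<omega> n) \<partial>T)"
      by (rule nn_integral_Qval(1)[OF policy x mf])
    also have "\<dots> = (\<integral>\<^sup>+\<omega>. ?F (fst (\<omega> n), \<phi> (fst (\<omega> n))) \<partial>T)"
      by (rule nn_integral_stationary[OF nn_integral_Qval(2)[OF policy x mf] \<phi> refl])
    also have "\<dots> \<le> (\<integral>\<^sup>+\<omega>. W + f (fst (\<omega> n)) \<partial>T)"
    proof (rule nn_integral_mono)
      fix \<omega> assume "\<omega> \<in> space T"
      then have s: "fst (\<omega> n) \<in> S" using component_space by (metis mem_Times_iff)
      then have "(fst (\<omega> n), \<phi> (fst (\<omega> n))) \<in> G" using \<phi> by (simp add: stationary_def)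
      then show "?F (fst (\<omega> n), \<phi> (fst (\<omega> n))) \<le> W + f (fst (\<omega> n))"
        using le[OF s] Qval_ext_kernel[of "fst (\<omega> n)" "\<phi> (fst (\<omega> n))" \<alpha> f] by simp
    qed
    also have "\<dots> = W + (\<integral>\<^sup>+\<omega>. f (fst (\<omega> n)) \<partial>T)"
      using measurable_compose[OF measurable_compose[OF component_T measurable_fst] mf]
      by (simp add: nn_integral_add prob_space.emeasure_space_1[OF prob_T])
    finally show ?thesis .
  qed
  have "(\<Sum>k<n. ennreal (\<alpha> ^ k) * stage_cost k) + ennreal (\<alpha> ^ n) * (\<integral>\<^sup>+\<omega>. f (fst (\<omega> n)) \<partial>T)
      \<le> W * (\<Sum>k<n. ennreal (\<alpha> ^ k)) + f x"
  proof (induction n)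
    case 0 then show ?case by (simp add: nn_integral_initial_state[OF mf])
  next
    case (Suc n)
    have "(\<Sum>k<Suc n. ennreal (\<alpha> ^ k) * stage_cost k) + ennreal (\<alpha> ^ Suc n) * (\<integral>\<^sup>+\<omega>. f (fst (\<omega> (Suc n))) \<partial>T)
      = (\<Sum>k<n. ennreal (\<alpha> ^ k) * stage_cost k) +
        ennreal (\<alpha> ^ n) * (stage_cost n + ennreal \<alpha> * (\<integral>\<^sup>+\<omega>. f (fst (\<omega> (Suc n))) \<partial>T))"
      using \<open>0 \<le> \<alpha>\<close> by (simp add: distrib_left ennreal_mult ac_simps)
    also have "\<dots> \<le> (\<Sum>k<n. ennreal (\<alpha> ^ k) * stage_cost k) +
        ennreal (\<alpha> ^ n) * (W + (\<integral>\<^sup>+\<omega>. f (fst (\<omega> n)) \<partial>T))"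
      by (intro add_left_mono mult_left_mono one) simp
    also have "\<dots> = ((\<Sum>k<n. ennreal (\<alpha> ^ k) * stage_cost k) + ennreal (\<alpha> ^ n) * (\<integral>\<^sup>+\<omega>. f (fst (\<omega> n)) \<partial>T))
        + W * ennreal (\<alpha> ^ n)"
      by (simp add: distrib_left ac_simps)
    also have "\<dots> \<le> W * (\<Sum>k<n. ennreal (\<alpha> ^ k)) + f x + W * ennreal (\<alpha> ^ n)"
      by (rule add_right_mono[OF Suc])
    finally show ?case by (simp add: distrib_left ac_simps)
  qed
  then show ?thesis by (rule order_trans[rotated]) simp
qed

text \<open>
  The lower bound holds for every policy by induction over the iterates. The minimizer for the limit of the
  iterates attains it, since the limit dominates its one-step cost.
\<close>

lemma disc_value_eq:
  assumes x: "x \<in> S" and \<alpha>: "0 \<le> \<alpha>" "\<alpha> < 1"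
  shows "disc_value M \<alpha> x = enn2ereal (value_lim \<alpha> x) + ereal (K / (1 - \<alpha>))"
proof (rule antisym)
  show "enn2ereal (value_lim \<alpha> x) + ereal (K / (1 - \<alpha>)) \<le> disc_value M \<alpha> x"
    unfolding disc_value_def
  proof (rule INF_greatest)
    fix \<pi> assume \<pi>: "\<pi> \<in> policies M"
    interpret mdp_traj_cost M \<pi> x K by (rule traj_cost[OF \<pi> x])
    show "enn2ereal (value_lim \<alpha> x) + ereal (K / (1 - \<alpha>)) \<le> disc_cost M \<alpha> \<pi> x"
      unfolding disc_cost_eq[OF \<alpha>] using value_lim_le_cost[OF \<pi> x \<alpha>(1)]
      by (intro add_right_mono) (simp add: less_eq_ennreal.rep_eq)
  qed
  obtain \<phi> where \<phi>: "stationary M \<phi>" "\<And>x. x \<in> S \<Longrightarrow> Qval \<alpha> (value_lim \<alpha>) x (\<phi> x) = opt \<alpha> (value_lim \<alpha>) x"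
    using stationary_selector[OF value_lim_lsc[of \<alpha>], of \<alpha>] by blast
  have "Qval \<alpha> (value_lim \<alpha>) y (\<phi> y) \<le> 0 + value_lim \<alpha> y" if "y \<in> S" for y
    using value_lim_superharmonic[OF that, of \<alpha>] \<phi>(2)[OF that]
    by (metis INF_lower2 add_0 opt_def)
  from stationary_cost_bound[OF \<phi>(1) x value_lim_lsc \<alpha>(1) this]
  have "(\<Sum>k<n. ennreal (\<alpha> ^ k) * stage (stat_policy M \<phi>) x k) \<le> value_lim \<alpha> x" for n by simp
  then have "(\<Sum>n. ennreal (\<alpha> ^ n) * stage (stat_policy M \<phi>) x n) \<le> value_lim \<alpha> x"
    by (simp add: suminf_eq_SUP SUP_least)
  then have "disc_cost M \<alpha> (stat_policy M \<phi>) x \<le> enn2ereal (value_lim \<alpha> x) + ereal (K / (1 - \<alpha>))"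
    unfolding mdp_traj_cost.disc_cost_eq[OF stat_traj_cost[OF \<phi>(1) x] \<alpha>]
    by (intro add_right_mono) (simp add: less_eq_ennreal.rep_eq)
  then show "disc_value M \<alpha> x \<le> enn2ereal (value_lim \<alpha> x) + ereal (K / (1 - \<alpha>))"
    unfolding disc_value_def by (rule INF_lower2[OF stat_policy_in_policies[OF mdp \<phi>(1)]])
qed

end

section \<open>The vanishing discount limit\<close>

context mdp_W_star
begin

definition min_value :: "real \<Rightarrow> ennreal" where
  "min_value \<alpha> = (INF x\<in>S. value_lim \<alpha> x)"

definition rel_value :: "real \<Rightarrow> 'x \<Rightarrow> ennreal" where
  "rel_value \<alpha> x = value_lim \<alpha> x - min_value \<alpha>"

lemma value_lim_eq: "x \<in> S \<Longrightarrow> value_lim \<alpha> x = min_value \<alpha> + rel_value \<alpha> x"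
  unfolding rel_value_def by (subst add_diff_inverse_ennreal) (auto simp: min_value_def INF_lower)

lemma rel_value_superharmonic:
  assumes x: "x \<in> S" and fin: "min_value \<alpha> < top" and \<alpha>: "0 \<le> \<alpha>" "\<alpha> \<le> 1"
  obtains a where "a \<in> A x" "Qval \<alpha> (rel_value \<alpha>) x a \<le> ennreal (1 - \<alpha>) * min_value \<alpha> + rel_value \<alpha> x"
proof -
  obtain a where a: "a \<in> A x" "Qval \<alpha> (value_lim \<alpha>) x a \<le> value_lim \<alpha> x"
    using value_lim_superharmonic[OF x] .
  then have z: "(x, a) \<in> G" using x by simp
  have m: "rel_value \<alpha> \<in> borel_measurable (kernel M (x, a))"
    unfolding kernel_measurable_iff[OF z] rel_value_def using lsc_seq_measurable[OF value_lim_lsc] by measurable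
  have "(\<integral>\<^sup>+y. value_lim \<alpha> y \<partial>kernel M (x, a)) = (\<integral>\<^sup>+y. min_value \<alpha> + rel_value \<alpha> y \<partial>kernel M (x, a))"
    by (intro nn_integral_cong value_lim_eq) (simp add: kernel_space[OF z])
  also have "\<dots> = min_value \<alpha> + (\<integral>\<^sup>+y. rel_value \<alpha> y \<partial>kernel M (x, a))"
    using m by (simp add: nn_integral_add prob_space.emeasure_space_1[OF kernel_prob_space[OF z]])
  finally have "Qval \<alpha> (value_lim \<alpha>) x a = ennreal \<alpha> * min_value \<alpha> + Qval \<alpha> (rel_value \<alpha>) x a"
    by (simp add: Qval_def distrib_left ac_simps)
  moreover have "value_lim \<alpha> x = ennreal \<alpha> * min_value \<alpha> + (ennreal (1 - \<alpha>) * min_value \<alpha> + rel_value \<alpha> x)"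
  proof -
    have "ennreal \<alpha> * min_value \<alpha> + ennreal (1 - \<alpha>) * min_value \<alpha> = ennreal (\<alpha> + (1 - \<alpha>)) * min_value \<alpha>"
      using \<alpha> by (subst ennreal_plus) (auto simp: distrib_right)
    then show ?thesis by (simp add: value_lim_eq[OF x] add.assoc[symmetric])
  qed
  moreover have "ennreal \<alpha> * min_value \<alpha> \<noteq> \<infinity>" using fin by (auto simp: ennreal_mult_eq_top_iff)
  ultimately have "Qval \<alpha> (rel_value \<alpha>) x a \<le> ennreal (1 - \<alpha>) * min_value \<alpha> + rel_value \<alpha> x"
    using a(2) by (simp add: ennreal_add_left_cancel_le)
  with a(1) show thesis by (rule that)
qed

text \<open>
  The set \<open>D\<close> restricts the discount factors that enter the limit. The choice \<open>D = {0..<1}\<close> gives the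
  relative value function of the theorem; a smaller \<open>D\<close> is used to compare the lower and the upper limit
  of the scaled minimal values.
\<close>

definition rel_env :: "real set \<Rightarrow> real \<Rightarrow> 'x \<Rightarrow> ennreal" where
  "rel_env D \<beta> = lsc_env S (\<lambda>y. INF \<alpha>\<in>D \<inter> {\<beta>..<1}. rel_value \<alpha> y)"

definition rel_lim :: "real set \<Rightarrow> 'x \<Rightarrow> ennreal" where
  "rel_lim D x = (SUP \<beta>\<in>{0..<1}. rel_env D \<beta> x)"

lemma rel_env_lsc: "lsc_seq S (rel_env D \<beta>)"
  unfolding rel_env_def by (rule lsc_env_lsc)

lemma rel_lim_lsc: "lsc_seq S (rel_lim D)"
  unfolding rel_lim_def[abs_def] by (intro lsc_seq_SUP rel_env_lsc)

lemma rel_env_mono: "\<beta> \<le> \<beta>' \<Longrightarrow> rel_env D \<beta> x \<le> rel_env D \<beta>' x"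
  unfolding rel_env_def by (intro lsc_env_mono INF_superset_mono) auto

lemma rel_env_le_rel_value: "x \<in> S \<Longrightarrow> \<alpha> \<in> D \<Longrightarrow> \<beta> \<le> \<alpha> \<Longrightarrow> \<alpha> < 1 \<Longrightarrow> rel_env D \<beta> x \<le> rel_value \<alpha> x"
  unfolding rel_env_def by (rule order_trans[OF lsc_env_le INF_lower]) auto

abbreviation "grid n \<equiv> 1 - inverse (real (Suc n))"

lemma grid_mono: "m \<le> n \<Longrightarrow> grid m \<le> grid n"
  by (simp add: le_imp_inverse_le)

lemma grid_nonneg: "0 \<le> grid n"
  by (simp add: field_simps)

lemma grid_lim: "grid \<longlonglongrightarrow> 1"
  using tendsto_diff[OF tendsto_const LIMSEQ_inverse_real_of_nat, of 1] by simp

text \<open>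
  The supremum over discount factors is replaced by a countable increasing one, to which monotone convergence applies.
\<close>

lemma rel_lim_grid: "rel_lim D x = (SUP n. rel_env D (grid n) x)"
proof (rule antisym)
  show "rel_lim D x \<le> (SUP n. rel_env D (grid n) x)"
    unfolding rel_lim_def
  proof (rule SUP_least)
    fix \<beta> :: real assume "\<beta> \<in> {0..<1}"
    then have "\<forall>\<^sub>F n in sequentially. \<beta> < grid n" by (intro order_tendstoD(1)[OF grid_lim]) auto
    then obtain n where "\<beta> < grid n" by (auto simp: eventually_sequentially)
    then show "rel_env D \<beta> x \<le> (SUP n. rel_env D (grid n) x)"
      by (intro SUP_upper2[of n] rel_env_mono) auto
  qed
  show "(SUP n. rel_env D (grid n) x) \<le> rel_lim D x"
    unfolding rel_lim_def using grid_nonneg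
    by (intro SUP_least SUP_upper) (auto simp del: of_nat_Suc)
qed

text \<open>
  The vanishing discount limit. Discount factors \<open>\<alpha> n\<close> in \<open>D\<close> and states \<open>y n\<close> are chosen such that
  \<open>rel_value (\<alpha> n) (y n)\<close> is at most \<open>rel_lim D x\<close> up to \<open>1 / (n + 1)\<close>. The actions of \<open>rel_value_superharmonic\<close> at \<open>y n\<close> have a
  limit point \<open>b\<close>. For a fixed \<open>m\<close> the relative values of all later discount factors dominate the envelope
  \<open>rel_env D (grid m)\<close>, which is lower semicontinuous, so the inequality passes to the limit with this envelope in the
  integral; then \<open>m\<close> tends to infinity. Finiteness of the limit guarantees that \<open>D\<close> accumulates at 1.
\<close>

lemma acoi_rel_lim:
  assumes x: "x \<in> S" and fin: "rel_lim D x < top"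
    and D: "D \<subseteq> {0..<1}" "\<And>\<alpha>. \<alpha> \<in> D \<Longrightarrow> min_value \<alpha> < top"
    and W: "\<And>\<epsilon>. \<epsilon> > 0 \<Longrightarrow> \<exists>\<beta><1. \<forall>\<alpha>\<in>D. \<beta> \<le> \<alpha> \<longrightarrow> ennreal (1 - \<alpha>) * min_value \<alpha> \<le> ennreal (W + \<epsilon>)" "0 \<le> W"
  shows "\<exists>a\<in>A x. Qval 1 (rel_lim D) x a \<le> ennreal W + rel_lim D x"
proof -
  let ?u = "rel_lim D x" and ?e = "\<lambda>n. inverse (real (Suc n))"
  have "\<exists>\<alpha> y. \<alpha> \<in> D \<and> grid n \<le> \<alpha> \<and> y \<in> S \<and> dist y x < ?e n \<and>
      ennreal (1 - \<alpha>) * min_value \<alpha> \<le> ennreal (W + ?e n) \<and> rel_value \<alpha> y \<le> ?u + ennreal (?e n)" for n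
  proof -
    have e: "?e n > 0" by simp
    obtain \<beta> where \<beta>: "\<beta> < 1" "\<And>\<alpha>. \<alpha> \<in> D \<Longrightarrow> \<beta> \<le> \<alpha> \<Longrightarrow> ennreal (1 - \<alpha>) * min_value \<alpha> \<le> ennreal (W + ?e n)"
      using W(1)[OF e] by blast
    let ?b = "max \<beta> (grid n)"
    have b: "0 \<le> ?b" "?b < 1" using \<beta>(1) grid_nonneg[of n] by (auto simp del: of_nat_Suc)
    have "(INF y\<in>{y\<in>S. dist y x < ?e n}. INF \<alpha>\<in>D \<inter> {?b..<1}. rel_value \<alpha> y) \<le> rel_env D ?b x"
      unfolding rel_env_def lsc_env_def by (rule SUP_upper) (use e in simp)
    also have "\<dots> \<le> ?u" unfolding rel_lim_def using b by (intro SUP_upper) auto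
    also have "\<dots> < ?u + ennreal (?e n)"
      using fin e by (cases ?u) (auto simp: ennreal_less_iff simp del: of_nat_Suc simp flip: ennreal_plus)
    finally obtain y \<alpha> where "y \<in> S" "dist y x < ?e n" "\<alpha> \<in> D" "?b \<le> \<alpha>" "rel_value \<alpha> y < ?u + ennreal (?e n)"
      by (auto simp: INF_less_iff)
    then show ?thesis using \<beta>(2)[of \<alpha>] by (intro exI[of _ \<alpha>] exI[of _ y]) auto
  qed
  then obtain \<alpha> y where \<alpha>: "\<And>n. \<alpha> n \<in> D" "\<And>n. grid n \<le> \<alpha> n" and y: "\<And>n. y n \<in> S" "\<And>n. dist (y n) x < ?e n"
    and le: "\<And>n. ennreal (1 - \<alpha> n) * min_value (\<alpha> n) \<le> ennreal (W + ?e n)" "\<And>n. rel_value (\<alpha> n) (y n) \<le> ?u + ennreal (?e n)"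
    by metis
  let ?l = "\<lambda>n. ennreal (W + ?e n) + (?u + ennreal (?e n))"
  have "\<exists>a. a \<in> A (y n) \<and> Qval (\<alpha> n) (rel_value (\<alpha> n)) (y n) a \<le> ?l n" for n
  proof -
    have "0 \<le> \<alpha> n" "\<alpha> n < 1" using \<alpha>(1)[of n] D(1) by auto
    then obtain a where "a \<in> A (y n)"
      "Qval (\<alpha> n) (rel_value (\<alpha> n)) (y n) a \<le> ennreal (1 - \<alpha> n) * min_value (\<alpha> n) + rel_value (\<alpha> n) (y n)"
      using rel_value_superharmonic[OF y(1) D(2)[OF \<alpha>(1)]] by (metis less_imp_le)
    then show ?thesis using add_mono[OF le(1)[of n] le(2)[of n]] by (meson order_trans)
  qed
  then obtain a where a: "\<And>n. a n \<in> A (y n)" "\<And>n. Qval (\<alpha> n) (rel_value (\<alpha> n)) (y n) (a n) \<le> ?l n" by metis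
  have yx: "y \<longlonglongrightarrow> x"
    by (rule metric_tendsto_imp_tendsto[OF LIMSEQ_inverse_real_of_nat])
      (use y(2) in \<open>auto intro!: always_eventually less_imp_le simp del: of_nat_Suc\<close>)
  have "?l \<longlonglongrightarrow> ennreal (W + 0) + (?u + ennreal 0)"
    by (intro tendsto_intros LIMSEQ_inverse_real_of_nat)
  then have l: "?l \<longlonglongrightarrow> ennreal W + ?u" by simp
  have g: "g (y n, a n) \<le> ?l n" for n by (rule order_trans[OF shifted_cost_le_Qval a(2)])
  obtain b r where b: "b \<in> A x" "strict_mono (r::nat \<Rightarrow> nat)" "(a \<circ> r) \<longlonglongrightarrow> b"
    by (rule bounded_cost_convergent_subsequence[OF y(1) x yx a(1) g l]) (use fin in auto)
  \<comment> \<open>The discount factor is lowered to \<open>grid m\<close> together with the integrand, so that one lower semicontinuous function lies below the whole tail.\<close>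
  have Qm: "Qval (grid m) (rel_env D (grid m)) x b \<le> ennreal W + ?u" for m
  proof (rule Qval_limit[OF rel_env_lsc, where X="y \<circ> r" and a="a \<circ> r" and l="?l \<circ> r"])
    show "\<forall>\<^sub>F n in sequentially. Qval (grid m) (rel_env D (grid m)) ((y \<circ> r) n) ((a \<circ> r) n) \<le> (?l \<circ> r) n"
      using eventually_ge_at_top[of m]
    proof eventually_elim
      case (elim n)
      let ?k = "r n"
      have "m \<le> ?k" using elim seq_suble[OF b(2), of n] by linarith
      then have "grid m \<le> \<alpha> ?k" using grid_mono \<alpha>(2) order_trans by blast
      then have "Qval (grid m) (rel_env D (grid m)) (y ?k) (a ?k) \<le> Qval (\<alpha> ?k) (rel_value (\<alpha> ?k)) (y ?k) (a ?k)"
        using y(1) a(1) \<alpha>(1)[of ?k] D(1) by (intro Qval_mono rel_env_le_rel_value) auto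
      also have "\<dots> \<le> ?l ?k" by (rule a(2))
      finally show ?case by (simp add: comp_def)
    qed
    show "(y \<circ> r) \<longlonglongrightarrow> x" by (rule LIMSEQ_subseq_LIMSEQ[OF yx b(2)])
    show "(?l \<circ> r) \<longlonglongrightarrow> ennreal W + ?u" by (rule LIMSEQ_subseq_LIMSEQ[OF l b(2)])
  qed (use x y a b in auto)
  have z: "(x, b) \<in> G" using x b by simp
  have inc: "incseq (\<lambda>n. \<integral>\<^sup>+y. rel_env D (grid n) y \<partial>kernel M (x, b))"
    by (intro incseq_SucI nn_integral_mono rel_env_mono grid_mono) simp
  have "(\<integral>\<^sup>+y. rel_lim D y \<partial>kernel M (x, b)) = (SUP n. \<integral>\<^sup>+y. rel_env D (grid n) y \<partial>kernel M (x, b))"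
    unfolding rel_lim_grid
  proof (rule nn_integral_monotone_convergence_SUP)
    show "incseq (\<lambda>n. rel_env D (grid n))" by (intro incseq_SucI le_funI rel_env_mono grid_mono) simp
    show "rel_env D (grid n) \<in> borel_measurable (kernel M (x, b))" for n
      unfolding kernel_measurable_iff[OF z] by (rule lsc_seq_measurable[OF rel_env_lsc])
  qed
  then have "(\<lambda>n. \<integral>\<^sup>+y. rel_env D (grid n) y \<partial>kernel M (x, b)) \<longlonglongrightarrow> (\<integral>\<^sup>+y. rel_lim D y \<partial>kernel M (x, b))"
    using LIMSEQ_SUP[OF inc] by simp
  then have "(\<lambda>n. Qval (grid n) (rel_env D (grid n)) x b) \<longlonglongrightarrow> Qval 1 (rel_lim D) x b"
    unfolding Qval_def by (intro tendsto_add tendsto_const tendsto_mult_ennreal tendsto_ennrealI grid_lim) auto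
  then have "Qval 1 (rel_lim D) x b \<le> ennreal W + ?u"
    by (rule LIMSEQ_le_const2) (use Qm in auto)
  with b(1) show ?thesis by blast
qed

lemma stationary_acoi_rel_lim:
  assumes fin: "\<And>x. x \<in> S \<Longrightarrow> rel_lim D x < top"
    and D: "D \<subseteq> {0..<1}" "\<And>\<alpha>. \<alpha> \<in> D \<Longrightarrow> min_value \<alpha> < top"
    and W: "\<And>\<epsilon>. \<epsilon> > 0 \<Longrightarrow> \<exists>\<beta><1. \<forall>\<alpha>\<in>D. \<beta> \<le> \<alpha> \<longrightarrow> ennreal (1 - \<alpha>) * min_value \<alpha> \<le> ennreal (W + \<epsilon>)" "0 \<le> W"
  obtains \<phi> where "stationary M \<phi>"
    "\<And>x. x \<in> S \<Longrightarrow> Qval 1 (rel_lim D) x (\<phi> x) = opt 1 (rel_lim D) x"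
    "\<And>x. x \<in> S \<Longrightarrow> opt 1 (rel_lim D) x \<le> ennreal W + rel_lim D x"
proof -
  have "opt 1 (rel_lim D) x \<le> ennreal W + rel_lim D x" if x: "x \<in> S" for x
    using acoi_rel_lim[OF x fin[OF x] D W] unfolding opt_def by (meson INF_lower2)
  then show thesis using stationary_selector[OF rel_lim_lsc] that by metis
qed

lemma acoi_fin_cost:
  assumes \<phi>: "stationary M \<phi>" and x: "x \<in> S" and f: "lsc_seq S f" "f x < top"
    and le: "\<And>y. y \<in> S \<Longrightarrow> Qval 1 f y (\<phi> y) \<le> ennreal W + f y" and W: "0 \<le> W"
  shows "(\<Sum>k<n. stage (stat_policy M \<phi>) x k) \<le> ennreal (W * real n + enn2real (f x))"
  using stationary_cost_bound[OF \<phi> x f(1) _ le, of n] f(2) W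
  by (simp add: ennreal_of_nat_eq_real_of_nat ennreal_mult)

end

context mdp_traj_cost
begin

lemma avg_cost_le:
  assumes S: "\<And>N. (\<Sum>k<N. stage_cost k) \<le> ennreal (W * real N + C)" and W: "0 \<le> W" "0 \<le> C"
  shows "avg_cost M \<pi> x \<le> ereal (W + K)"
proof -
  have "avg_cost M \<pi> x \<le> limsup (\<lambda>N. ereal (W + K + C / real N))"
    unfolding avg_cost_def
  proof (intro Limsup_mono, use eventually_gt_at_top[of 0] in eventually_elim)
    case (elim N)
    have "enn2ereal (\<Sum>k<N. stage_cost k) \<le> ereal (W * real N + C)"
      using S[of N] W by (simp add: less_eq_ennreal.rep_eq del: ennreal_plus)
    then have "fin_cost M N 1 \<pi> x \<le> ereal (W * real N + C + real N * K)"
      unfolding fin_cost_eq using add_right_mono[of _ _ "ereal (real N * K)"] by fastforce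
    then have "fin_cost M N 1 \<pi> x / ereal (real N) \<le> ereal (W * real N + C + real N * K) / ereal (real N)"
      using elim by (intro ereal_divide_right_mono) auto
    also have "\<dots> = ereal (W + K + C / real N)" using elim by (simp add: field_simps)
    finally show ?case .
  qed
  also have "\<dots> = ereal (W + K + 0)"
    by (intro lim_imp_Limsup tendsto_intros lim_const_over_n) auto
  finally show ?thesis by simp
qed

text \<open>
  The bound on the average holds from some time on only; since the stage costs are nonnegative, the partial sum at that time
  covers the earlier ones.
\<close>

lemma stage_cost_bound_of_avg:
  assumes "avg_cost M \<pi> x < ereal w"
  obtains C where "0 \<le> C" "K \<le> w" "\<And>N. (\<Sum>k<N. stage_cost k) \<le> ennreal ((w - K) * real N + C)"
proof -
  let ?S = "\<lambda>N. \<Sum>k<N. stage_cost k"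
  have "\<forall>\<^sub>F N in sequentially. fin_cost M N 1 \<pi> x / ereal (real N) < ereal w"
    using assms unfolding avg_cost_def by (rule Limsup_lessD)
  then obtain N0 where N0: "\<And>N. N \<ge> N0 \<Longrightarrow> fin_cost M N 1 \<pi> x / ereal (real N) < ereal w"
    by (auto simp: eventually_sequentially)
  have le: "\<exists>s. ?S N = ennreal s \<and> 0 \<le> s \<and> s \<le> (w - K) * real N" if "N \<ge> max N0 1" for N
  proof -
    have N: "real N > 0" "N \<ge> N0" using that by auto
    have "fin_cost M N 1 \<pi> x < ereal w * ereal (real N)"
      using N0[OF N(2)] N(1) by (subst (asm) ereal_divide_less_iff) (auto simp: mult.commute)
    then show ?thesis unfolding fin_cost_eq
      by (cases "?S N") (auto simp: algebra_simps)
  qed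
  define N1 where "N1 = max N0 1"
  obtain s where s: "?S N1 = ennreal s" "0 \<le> s" "s \<le> (w - K) * real N1" using le[of N1] by (auto simp: N1_def)
  have "0 \<le> (w - K) * real N1" using s by linarith
  moreover have "0 < real N1" by (simp add: N1_def)
  ultimately have wK: "K \<le> w" by (simp add: zero_le_mult_iff)
  show thesis
  proof (rule that[OF s(2) wK])
    fix N
    show "?S N \<le> ennreal ((w - K) * real N + s)"
    proof (cases "N \<ge> N1")
      case True
      then obtain t where "?S N = ennreal t" "t \<le> (w - K) * real N" using le[of N] by (auto simp: N1_def)
      then show ?thesis using s(2) by (simp add: ennreal_leI del: ennreal_plus)
    next
      case False
      then have "?S N \<le> ?S N1" by (intro sum_mono2) auto
      also have "\<dots> \<le> ennreal ((w - K) * real N + s)"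
        unfolding s(1) using wK by (intro ennreal_leI) simp
      finally show ?thesis .
    qed
  qed
qed

lemma disc_cost_le_of_avg:
  assumes "avg_cost M \<pi> x < ereal w"
  obtains C where "0 \<le> C" "\<And>\<alpha>. 0 \<le> \<alpha> \<Longrightarrow> \<alpha> < 1 \<Longrightarrow> disc_cost M \<alpha> \<pi> x \<le> ereal (w / (1 - \<alpha>) + C)"
proof -
  obtain C where C: "0 \<le> C" "K \<le> w" "\<And>N. (\<Sum>k<N. stage_cost k) \<le> ennreal ((w - K) * real N + C)"
    using stage_cost_bound_of_avg[OF assms] by blast
  show thesis
  proof (rule that[OF C(1)])
    fix \<alpha> :: real assume \<alpha>: "0 \<le> \<alpha>" "\<alpha> < 1"
    have "(\<Sum>n. ennreal (\<alpha> ^ n) * stage_cost n) \<le> ennreal ((w - K) / (1 - \<alpha>) + C)"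
      using C by (intro abel_suminf_le_of_cesaro_le[OF \<alpha>]) auto
    then have "enn2ereal (\<Sum>n. ennreal (\<alpha> ^ n) * stage_cost n) \<le> ereal ((w - K) / (1 - \<alpha>) + C)"
      using C \<alpha> by (simp add: less_eq_ennreal.rep_eq del: ennreal_plus)
    then have "disc_cost M \<alpha> \<pi> x \<le> ereal ((w - K) / (1 - \<alpha>) + C) + ereal (K / (1 - \<alpha>))"
      unfolding disc_cost_eq[OF \<alpha>] by (rule add_right_mono)
    also have "\<dots> = ereal (w / (1 - \<alpha>) + C)" by (simp add: diff_divide_distrib)
    finally show "disc_cost M \<alpha> \<pi> x \<le> ereal (w / (1 - \<alpha>) + C)" .
  qed
qed

end

lemma at_left_1_unit: "\<forall>\<^sub>F \<alpha> in at_left (1::real). 0 \<le> \<alpha> \<and> \<alpha> < 1"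
  unfolding eventually_at_left_field by (rule exI[of _ 0]) auto

context mdp_W_star
begin

text \<open>
  Abel means are bounded by upper Cesaro means. If \<open>w\<close> exceeds the average cost, then the stage costs
  sum to at most \<open>w N + C\<close>, and the constant \<open>C\<close> disappears after multiplication by \<open>1 - \<alpha>\<close>.
\<close>

lemma Limsup_disc_value_le_avg_cost:
  assumes \<pi>: "\<pi> \<in> policies M" and x: "x \<in> S"
  shows "Limsup (at_left 1) (\<lambda>\<alpha>. ereal (1 - \<alpha>) * disc_value M \<alpha> x) \<le> avg_cost M \<pi> x"
proof (rule dense_ge)
  fix t assume t: "avg_cost M \<pi> x < t"
  show "Limsup (at_left 1) (\<lambda>\<alpha>. ereal (1 - \<alpha>) * disc_value M \<alpha> x) \<le> t"
  proof (cases t)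
    case (real w)
    interpret mdp_traj_cost M \<pi> x K by (rule traj_cost[OF \<pi> x])
    obtain C where C: "\<And>\<alpha>. 0 \<le> \<alpha> \<Longrightarrow> \<alpha> < 1 \<Longrightarrow> disc_cost M \<alpha> \<pi> x \<le> ereal (w / (1 - \<alpha>) + C)"
      using disc_cost_le_of_avg[of w] t real by metis
    have "Limsup (at_left 1) (\<lambda>\<alpha>. ereal (1 - \<alpha>) * disc_value M \<alpha> x)
        \<le> Limsup (at_left 1) (\<lambda>\<alpha>. ereal (w + (1 - \<alpha>) * C))"
    proof (intro Limsup_mono, use at_left_1_unit in eventually_elim)
      case (elim \<alpha>)
      have "disc_value M \<alpha> x \<le> disc_cost M \<alpha> \<pi> x" unfolding disc_value_def by (rule INF_lower[OF \<pi>])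
      also have "\<dots> \<le> ereal (w / (1 - \<alpha>) + C)" using C elim by auto
      finally have "ereal (1 - \<alpha>) * disc_value M \<alpha> x \<le> ereal (1 - \<alpha>) * ereal (w / (1 - \<alpha>) + C)"
        using elim by (intro ereal_mult_left_mono) auto
      then show ?case using elim by (simp add: distrib_left)
    qed
    also have "\<dots> = ereal (w + (1 - 1) * C)"
      by (intro lim_imp_Limsup tendsto_intros) auto
    finally show ?thesis using real by simp
  qed (use t in auto)
qed

end

section \<open>Consequences of bounded relative values\<close>

locale mdp_W_star_B = mdp_W_star M K for M :: "('x::polish_space, 'a::polish_space) mdp" and K +
  assumes B: "assumption_B M"
begin

text \<open>
  The only use of the finiteness of the optimal average cost: some policy has finite discounted cost for
  every discount factor, so the minimal values are finite and the relative values are well defined.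
\<close>

lemma finite_avg_cost:
  obtains \<pi> x w where "\<pi> \<in> policies M" "x \<in> S" "avg_cost M \<pi> x < ereal w"
proof -
  have "w_star M < \<infinity>" using B by (simp add: assumption_B_def)
  then obtain x \<pi> where "x \<in> S" "\<pi> \<in> policies M" "avg_cost M \<pi> x < \<infinity>"
    unfolding w_star_def avg_value_def INF_less_iff by blast
  moreover from this(3) obtain w where "avg_cost M \<pi> x < ereal w"
    by (metis ereal_dense2 )
  ultimately show thesis using that by blast
qed

lemma min_value_finite:
  assumes \<alpha>: "0 \<le> \<alpha>" "\<alpha> < 1"
  shows "min_value \<alpha> < top"
proof -
  obtain \<pi> x w where H: "\<pi> \<in> policies M" "x \<in> S" "avg_cost M \<pi> x < ereal w" by (rule finite_avg_cost)
  interpret mdp_traj_cost M \<pi> x K by (rule traj_cost[OF H(1,2)])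
  obtain C where "disc_cost M \<alpha> \<pi> x \<le> ereal (w / (1 - \<alpha>) + C)"
    using disc_cost_le_of_avg[OF H(3)] \<alpha> by metis
  moreover have "disc_value M \<alpha> x \<le> disc_cost M \<alpha> \<pi> x" unfolding disc_value_def by (rule INF_lower[OF H(1)])
  ultimately have "enn2ereal (value_lim \<alpha> x) + ereal (K / (1 - \<alpha>)) \<le> ereal (w / (1 - \<alpha>) + C)"
    unfolding disc_value_eq[OF H(2) \<alpha>] by simp
  then have "value_lim \<alpha> x < top" by (cases "value_lim \<alpha> x") auto
  moreover have "min_value \<alpha> \<le> value_lim \<alpha> x" unfolding min_value_def by (rule INF_lower[OF H(2)])
  ultimately show ?thesis by (rule le_less_trans[rotated])
qed

lemma m_disc_eq:
  assumes \<alpha>: "0 \<le> \<alpha>" "\<alpha> < 1"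
  shows "m_disc M \<alpha> = enn2ereal (min_value \<alpha>) + ereal (K / (1 - \<alpha>))"
  unfolding m_disc_def min_value_def enn2ereal_INF INF_add_ereal[symmetric]
  by (intro INF_cong refl disc_value_eq[OF _ \<alpha>])

lemma u_disc_eq:
  assumes x: "x \<in> S" and \<alpha>: "0 \<le> \<alpha>" "\<alpha> < 1"
  shows "u_disc M \<alpha> x = enn2ereal (rel_value \<alpha> x)"
  unfolding u_disc_def disc_value_eq[OF x \<alpha>] m_disc_eq[OF \<alpha>] value_lim_eq[OF x]
  using min_value_finite[OF \<alpha>] by (cases "min_value \<alpha>"; cases "rel_value \<alpha> x") (auto simp flip: ennreal_plus)

lemma rel_value_bounded:
  assumes x: "x \<in> S"
  obtains C where "C < top" "\<And>\<alpha>. 0 \<le> \<alpha> \<Longrightarrow> \<alpha> < 1 \<Longrightarrow> rel_value \<alpha> x \<le> C"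
proof
  let ?s = "SUP \<alpha>\<in>{0..<1}. u_disc M \<alpha> x"
  have "?s < \<infinity>" using B x by (auto simp: assumption_B_def)
  then show "e2ennreal ?s < top" by (cases ?s) (auto simp: e2ennreal_neg)
  fix \<alpha> :: real assume \<alpha>: "0 \<le> \<alpha>" "\<alpha> < 1"
  have "u_disc M \<alpha> x \<le> ?s" by (rule SUP_upper) (use \<alpha> in simp)
  then have "e2ennreal (u_disc M \<alpha> x) \<le> e2ennreal ?s" by (rule e2ennreal_mono)
  then show "rel_value \<alpha> x \<le> e2ennreal ?s" by (simp add: u_disc_eq[OF x \<alpha>])
qed

lemma rel_lim_finite:
  assumes x: "x \<in> S" and D: "D \<subseteq> {0..<1}" "\<And>\<beta>. \<beta> < 1 \<Longrightarrow> \<exists>\<alpha>\<in>D. \<beta> \<le> \<alpha>"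
  shows "rel_lim D x < top"
proof -
  obtain C where C: "C < top" "\<And>\<alpha>. 0 \<le> \<alpha> \<Longrightarrow> \<alpha> < 1 \<Longrightarrow> rel_value \<alpha> x \<le> C" using rel_value_bounded[OF x] by blast
  have "rel_lim D x \<le> C"
    unfolding rel_lim_def
  proof (rule SUP_least)
    fix \<beta> :: real assume "\<beta> \<in> {0..<1}"
    then obtain \<alpha> where \<alpha>: "\<alpha> \<in> D" "\<beta> \<le> \<alpha>" using D(2)[of \<beta>] by auto
    then have "0 \<le> \<alpha>" "\<alpha> < 1" using D(1) by auto
    then show "rel_env D \<beta> x \<le> C" using rel_env_le_rel_value[OF x \<alpha>] C(2) by (meson order_trans)
  qed
  then show ?thesis using C(1) by (rule le_less_trans)
qed

abbreviation "u \<equiv> rel_lim {0..<1}"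

lemma u_fun_eq: "u_fun M x = enn2ereal (u x)"
proof -
  have rel_env_eq: "enn2ereal (rel_env {0..<1} \<beta> x) =
      (SUP R\<in>{0<..}. INF (\<alpha>, y)\<in>{\<beta>..<1} \<times> {y \<in> S. dist y x < R}. u_disc M \<alpha> y)"
    if \<beta>: "\<beta> \<in> {0..<1}" for \<beta> :: real
  proof -
    have D: "{0..<1} \<inter> {\<beta>..<1} = {\<beta>..<1}" using \<beta> by auto
    have "(INF y\<in>{y \<in> S. dist y x < R}. INF \<alpha>\<in>{\<beta>..<1}. enn2ereal (rel_value \<alpha> y))
        = (INF (\<alpha>, y)\<in>{\<beta>..<1} \<times> {y \<in> S. dist y x < R}. u_disc M \<alpha> y)" for R
    proof -
      have "(INF (\<alpha>, y)\<in>{\<beta>..<1} \<times> {y \<in> S. dist y x < R}. u_disc M \<alpha> y)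
          = (INF \<alpha>\<in>{\<beta>..<1}. INF y\<in>{y \<in> S. dist y x < R}. u_disc M \<alpha> y)"
        by (simp add: INF_pair case_prod_beta)
      also have "\<dots> = (INF \<alpha>\<in>{\<beta>..<1}. INF y\<in>{y \<in> S. dist y x < R}. enn2ereal (rel_value \<alpha> y))"
        using \<beta> by (intro INF_cong refl u_disc_eq) auto
      finally show ?thesis by (subst INF_commute) simp
    qed
    moreover have "{0<..} \<noteq> ({} :: real set)" by auto
    ultimately show ?thesis
      unfolding rel_env_def lsc_env_def D by (simp add: enn2ereal_SUP enn2ereal_INF)
  qed
  have ne: "{0..<1} \<noteq> ({} :: real set)" by auto
  have "u_fun M x = (SUP \<beta>\<in>{0..<1}. SUP R\<in>{0<..}. INF (\<alpha>, y)\<in>{\<beta>..<1} \<times> {y \<in> S. dist y x < R}. u_disc M \<alpha> y)"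
    unfolding u_fun_def by (simp add: SUP_pair case_prod_beta)
  also have "\<dots> = (SUP \<beta>\<in>{0..<1}. enn2ereal (rel_env {0..<1} \<beta> x))"
    by (intro SUP_cong refl rel_env_eq[symmetric])
  finally show ?thesis unfolding rel_lim_def by (simp add: enn2ereal_SUP[OF ne])
qed

lemma u_finite: "x \<in> S \<Longrightarrow> u x < top"
proof (erule rel_lim_finite)
  fix \<beta> :: real assume "\<beta> < 1"
  then show "\<exists>\<alpha>\<in>{0..<1}. \<beta> \<le> \<alpha>" by (intro bexI[of _ "max 0 \<beta>"]) auto
qed simp

text \<open>
  The quantity \<open>(1 - \<alpha>) m\<^sub>\<alpha>\<close> of the original problem as a real number.
\<close>

definition scaled_min :: "real \<Rightarrow> real" where
  "scaled_min \<alpha> = (1 - \<alpha>) * enn2real (min_value \<alpha>) + K"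

lemma scaled_m_disc:
  assumes \<alpha>: "0 \<le> \<alpha>" "\<alpha> < 1"
  shows "ereal (1 - \<alpha>) * m_disc M \<alpha> = ereal (scaled_min \<alpha>)"
  unfolding m_disc_eq[OF \<alpha>] scaled_min_def using min_value_finite[OF \<alpha>] \<alpha>
  by (cases "min_value \<alpha>") (auto simp: distrib_left)

lemma ennreal_scaled_min_value:
  assumes \<alpha>: "0 \<le> \<alpha>" "\<alpha> < 1"
  shows "ennreal (1 - \<alpha>) * min_value \<alpha> = ennreal (scaled_min \<alpha> - K)"
  unfolding scaled_min_def using min_value_finite[OF \<alpha>] \<alpha>
  by (cases "min_value \<alpha>") (auto simp flip: ennreal_mult)

lemma scaled_min_ge: "0 \<le> \<alpha> \<Longrightarrow> \<alpha> < 1 \<Longrightarrow> K \<le> scaled_min \<alpha>"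
  by (simp add: scaled_min_def)

lemma w_upper_scaled_min: "w_upper M = Limsup (at_left 1) (\<lambda>\<alpha>. ereal (scaled_min \<alpha>))"
  unfolding w_upper_def
  by (rule Limsup_eq, use at_left_1_unit in eventually_elim) (simp add: scaled_m_disc)

lemma w_lower_scaled_min: "w_lower M = Liminf (at_left 1) (\<lambda>\<alpha>. ereal (scaled_min \<alpha>))"
  unfolding w_lower_def
  by (rule Liminf_eq, use at_left_1_unit in eventually_elim) (simp add: scaled_m_disc)

lemma m_disc_le_disc_value:
  assumes x: "x \<in> S" and "0 \<le> \<alpha>" "\<alpha> < 1"
  shows "ereal (scaled_min \<alpha>) \<le> ereal (1 - \<alpha>) * disc_value M \<alpha> x"
  unfolding scaled_m_disc[OF assms(2,3), symmetric]
  using assms by (intro ereal_mult_left_mono) (auto simp: m_disc_def INF_lower)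

lemma w_upper_le_disc:
  assumes x: "x \<in> S"
  shows "w_upper M \<le> Limsup (at_left 1) (\<lambda>\<alpha>. ereal (1 - \<alpha>) * disc_value M \<alpha> x)"
  unfolding w_upper_scaled_min
  by (intro Limsup_mono, use at_left_1_unit in eventually_elim) (simp add: m_disc_le_disc_value[OF x])

lemma w_lower_le_disc:
  assumes x: "x \<in> S"
  shows "w_lower M \<le> Liminf (at_left 1) (\<lambda>\<alpha>. ereal (1 - \<alpha>) * disc_value M \<alpha> x)"
  unfolding w_lower_scaled_min
  by (intro Liminf_mono, use at_left_1_unit in eventually_elim) (simp add: m_disc_le_disc_value[OF x])

lemma w_upper_le_avg_cost: "\<pi> \<in> policies M \<Longrightarrow> x \<in> S \<Longrightarrow> w_upper M \<le> avg_cost M \<pi> x"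
  using w_upper_le_disc Limsup_disc_value_le_avg_cost order_trans by blast

lemma K_le_w_lower: "ereal K \<le> w_lower M"
  unfolding w_lower_scaled_min by (rule Liminf_bounded, use at_left_1_unit in eventually_elim) (simp add: scaled_min_ge)

lemma w_lower_le_w_upper: "w_lower M \<le> w_upper M"
  unfolding w_lower_scaled_min w_upper_scaled_min by (rule Liminf_le_Limsup) simp

lemma w_upper_finite: "w_upper M < \<infinity>"
proof -
  obtain \<pi> x w where H: "\<pi> \<in> policies M" "x \<in> S" "avg_cost M \<pi> x < ereal w" by (rule finite_avg_cost)
  then have "w_upper M < ereal w" using w_upper_le_avg_cost[OF H(1,2)] by simp
  then show ?thesis by (rule less_trans) simp
qed

lemma w_upper_real: obtains w where "w_upper M = ereal w" "K \<le> w"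
proof -
  have "ereal K \<le> w_upper M" using K_le_w_lower w_lower_le_w_upper by (rule order_trans)
  then show thesis using w_upper_finite that by (cases "w_upper M") auto
qed

lemma w_lower_real: obtains w where "w_lower M = ereal w" "K \<le> w"
proof -
  have "w_lower M < \<infinity>" using w_lower_le_w_upper w_upper_finite by (rule le_less_trans)
  then show thesis using K_le_w_lower that by (cases "w_lower M") auto
qed

lemma avg_cost_le_of_acoi:
  assumes \<phi>: "stationary M \<phi>" and x: "x \<in> S" and f: "lsc_seq S f" "f x < top"
    and le: "\<And>y. y \<in> S \<Longrightarrow> Qval 1 f y (\<phi> y) \<le> ennreal (w - K) + f y" and W: "K \<le> w"
  shows "avg_cost M (stat_policy M \<phi>) x \<le> ereal w"
proof -
  have "avg_cost M (stat_policy M \<phi>) x \<le> ereal (w - K + K)"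
    by (rule mdp_traj_cost.avg_cost_le[OF stat_traj_cost[OF \<phi> x] acoi_fin_cost[OF \<phi> x f le]])
      (use W in auto)
  then show ?thesis by simp
qed

text \<open>
  The vanishing discount limit along those discount factors whose scaled minimal value is within \<open>\<epsilon>\<close> of the
  lower limit gives a stationary policy of average cost at most \<open>w_lower M + \<epsilon>\<close>, and
  \<open>w_upper M\<close> is a lower bound for all average costs.
\<close>

lemma w_lower_eq_w_upper: "w_lower M = w_upper M"
proof (rule antisym[OF w_lower_le_w_upper])
  obtain w where w: "w_lower M = ereal w" "K \<le> w" by (rule w_lower_real)
  obtain x where x: "x \<in> S" using finite_avg_cost by metis
  have "w_upper M \<le> ereal w + ereal \<epsilon>" if \<epsilon>: "\<epsilon> > 0" for \<epsilon>
  proof -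
    define D where "D = {\<alpha>\<in>{0..<1}. scaled_min \<alpha> < w + \<epsilon>}"
    have acc: "\<exists>\<alpha>\<in>D. \<beta> \<le> \<alpha>" if "\<beta> < 1" for \<beta>
    proof (rule ccontr)
      assume neg: "\<not> ?thesis"
      have "\<forall>\<^sub>F \<alpha> in at_left 1. \<beta> < \<alpha> \<and> \<alpha> < 1"
        unfolding eventually_at_left_field using that by auto
      with at_left_1_unit have "\<forall>\<^sub>F \<alpha> in at_left 1. ereal (w + \<epsilon>) \<le> ereal (scaled_min \<alpha>)"
        by eventually_elim (use neg in \<open>force simp: D_def not_less\<close>)
      then have "ereal (w + \<epsilon>) \<le> w_lower M" unfolding w_lower_scaled_min by (rule Liminf_bounded)
      then show False using w \<epsilon> by simp
    qed
    have D: "D \<subseteq> {0..<1}" "\<And>\<alpha>. \<alpha> \<in> D \<Longrightarrow> min_value \<alpha> < top" by (auto simp: D_def min_value_finite)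
    have fin: "rel_lim D y < top" if "y \<in> S" for y by (rule rel_lim_finite[OF that D(1) acc])
    have W: "\<exists>\<beta><1. \<forall>\<alpha>\<in>D. \<beta> \<le> \<alpha> \<longrightarrow> ennreal (1 - \<alpha>) * min_value \<alpha> \<le> ennreal (w + \<epsilon> - K + e)" if "e > 0" for e
      using that by (intro exI[of _ 0]) (auto simp: D_def ennreal_scaled_min_value intro!: ennreal_leI)
    obtain \<phi> where \<phi>: "stationary M \<phi>" "\<And>x. x \<in> S \<Longrightarrow> Qval 1 (rel_lim D) x (\<phi> x) = opt 1 (rel_lim D) x"
      "\<And>x. x \<in> S \<Longrightarrow> opt 1 (rel_lim D) x \<le> ennreal (w + \<epsilon> - K) + rel_lim D x"
      by (rule stationary_acoi_rel_lim[OF fin D W]) (use w \<epsilon> in auto)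
    have "avg_cost M (stat_policy M \<phi>) x \<le> ereal (w + \<epsilon>)"
      by (rule avg_cost_le_of_acoi[OF \<phi>(1) x rel_lim_lsc fin[OF x]]) (use \<phi> w \<epsilon> in auto)
    with w_upper_le_avg_cost[OF stat_policy_in_policies[OF mdp \<phi>(1)] x]
    have "w_upper M \<le> ereal (w + \<epsilon>)" by (rule order_trans)
    then show ?thesis by simp
  qed
  then show "w_upper M \<le> w_lower M" unfolding w(1) by (rule ereal_le_epsilon2)
qed

lemma one_step_eq:
  assumes z: "(x, a) \<in> G"
  shows "one_step M x a = enn2ereal (Qval 1 u x a) + ereal K"
proof -
  have m: "u \<in> borel_measurable (kernel M (x, a))"
    unfolding kernel_measurable_iff[OF z] by (rule lsc_seq_measurable[OF rel_lim_lsc])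
  have "eintegral (kernel M (x, a)) (u_fun M) = enn2ereal (\<integral>\<^sup>+y. u y \<partial>kernel M (x, a))"
    using eintegral_bounded_below[OF kernel_prob_space[OF z] m, of "u_fun M" 0] by (simp add: u_fun_eq)
  then show ?thesis
    unfolding one_step_def cost_eq_shifted[OF z K[OF z]] Qval_def
    by (simp add: plus_ennreal.rep_eq ac_simps)
qed

lemma one_step_le_iff:
  assumes z: "(x, a) \<in> G" and w: "w_upper M = ereal w" "K \<le> w"
  shows "one_step M x a \<le> w_upper M + u_fun M x \<longleftrightarrow> Qval 1 u x a \<le> ennreal (w - K) + u x"
proof -
  have "w_upper M + u_fun M x = enn2ereal (ennreal (w - K) + u x) + ereal K"
    unfolding plus_ennreal.rep_eq u_fun_eq w(1) using w(2)
    by (cases "enn2ereal (u x)") auto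
  moreover have "p + ereal K \<le> q + ereal K \<longleftrightarrow> p \<le> q" for p q :: ereal
    by (cases p; cases q) auto
  ultimately show ?thesis
    unfolding one_step_eq[OF z] by (simp add: less_eq_ennreal.rep_eq)
qed

lemma acoi_iff:
  assumes \<phi>: "stationary M \<phi>" and w: "w_upper M = ereal w" "K \<le> w"
  shows "acoi M \<phi> \<longleftrightarrow> (\<forall>x\<in>S. Qval 1 u x (\<phi> x) \<le> ennreal (w - K) + u x)"
  unfolding acoi_def using one_step_le_iff[OF _ w] \<phi> by (auto simp: stationary_def)

lemma opt_u_le:
  assumes x: "x \<in> S" and w: "w_upper M = ereal w" "K \<le> w"
  shows "opt 1 u x \<le> ennreal (w - K) + u x"
proof -
  have W: "\<exists>\<beta><1. \<forall>\<alpha>\<in>{0..<1}. \<beta> \<le> \<alpha> \<longrightarrow> ennreal (1 - \<alpha>) * min_value \<alpha> \<le> ennreal (w - K + \<epsilon>)"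
    if \<epsilon>: "\<epsilon> > 0" for \<epsilon>
  proof -
    have "w_upper M < ereal (w + \<epsilon>)" using w \<epsilon> by simp
    then have "\<forall>\<^sub>F \<alpha> in at_left 1. ereal (scaled_min \<alpha>) < ereal (w + \<epsilon>)" unfolding w_upper_scaled_min by (rule Limsup_lessD)
    then obtain \<beta> where \<beta>: "\<beta> < 1" "\<And>\<alpha>. \<beta> < \<alpha> \<Longrightarrow> \<alpha> < 1 \<Longrightarrow> scaled_min \<alpha> < w + \<epsilon>"
      unfolding eventually_at_left_field by auto
    show ?thesis
    proof (intro exI[of _ "(\<beta> + 1) / 2"] conjI ballI impI)
      fix \<alpha> :: real assume "\<alpha> \<in> {0..<1}" "(\<beta> + 1) / 2 \<le> \<alpha>"
      then show "ennreal (1 - \<alpha>) * min_value \<alpha> \<le> ennreal (w - K + \<epsilon>)"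
        using \<beta>(1) \<beta>(2)[of \<alpha>] by (auto simp: ennreal_scaled_min_value intro!: ennreal_leI)
    qed (use \<beta> in simp)
  qed
  have "\<exists>a\<in>A x. Qval 1 u x a \<le> ennreal (w - K) + u x"
    by (rule acoi_rel_lim[OF x u_finite[OF x] _ _ W]) (use w in \<open>auto simp: min_value_finite\<close>)
  then show ?thesis unfolding opt_def by (meson INF_lower2)
qed

lemma A_sup_star_eq:
  assumes x: "x \<in> S" and w: "w_upper M = ereal w" "K \<le> w"
  shows "A_sup_star M x = {a \<in> A x. Qval 1 u x a \<le> ennreal (w - K) + u x}"
  unfolding A_sup_star_def using one_step_le_iff[OF _ w] x by auto

lemma A_sub_star_eq:
  assumes x: "x \<in> S"
  shows "A_sub_star M x = {a \<in> A x. Qval 1 u x a = opt 1 u x}"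
proof -
  have "(INF b\<in>A x. one_step M x b) = (INF b\<in>A x. enn2ereal (Qval 1 u x b) + ereal K)"
    using x by (intro INF_cong refl one_step_eq) simp
  also have "\<dots> = enn2ereal (opt 1 u x) + ereal K"
    by (simp add: opt_def enn2ereal_INF INF_add_ereal)
  finally have "(INF b\<in>A x. one_step M x b) = one_step M x a \<longleftrightarrow> Qval 1 u x a = opt 1 u x" if "a \<in> A x" for a
    using x that one_step_eq[of x a]
    by (cases "Qval 1 u x a"; cases "opt 1 u x") auto
  then show ?thesis by (auto simp: A_sub_star_def)
qed

lemma A_sup_star_compact_nonempty:
  assumes x: "x \<in> S"
  shows "compact (A_sup_star M x)" "A_sup_star M x \<noteq> {}" "A_sub_star M x \<subseteq> A_sup_star M x"
proof -
  obtain w where w: "w_upper M = ereal w" "K \<le> w" by (rule w_upper_real)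
  have "ennreal (w - K) + u x < top" using u_finite[OF x] by simp
  from K_inf_compact_sublevel_compact[OF Qval_K_inf_compact[OF rel_lim_lsc] x this]
  show "compact (A_sup_star M x)" unfolding A_sup_star_eq[OF x w] .
  obtain a where "a \<in> A x" "Qval 1 u x a = opt 1 u x" using opt_attained[OF rel_lim_lsc x] .
  then show "A_sup_star M x \<noteq> {}" using opt_u_le[OF x w] unfolding A_sup_star_eq[OF x w] by auto
  show "A_sub_star M x \<subseteq> A_sup_star M x"
    using opt_u_le[OF x w] unfolding A_sup_star_eq[OF x w] A_sub_star_eq[OF x] by auto
qed

lemma Gr_A_sup_star_sets: "Gr M (A_sup_star M) \<in> sets (restrict_space borel (S \<times> actions M))"
proof -
  obtain w where w: "w_upper M = ereal w" "K \<le> w" by (rule w_upper_real)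
  let ?R = "restrict_space borel (S \<times> actions M) :: ('x \<times> 'a) measure"
  have G: "G \<in> sets ?R" using mdp by (simp add: is_mdp_def)
  have sub: "G \<subseteq> S \<times> actions M" using sets.sets_into_space[OF G] by (simp add: space_restrict_space)
  have SA: "S \<times> actions M \<in> sets borel"
    using mdp by (auto simp: is_mdp_def intro!: borel_Times)
  have GB: "G \<in> sets borel" using G SA by (simp add: sets_restrict_space_iff)
  have u_G: "lsc_seq G (\<lambda>z. u (fst z))"
    unfolding lsc_seq_def
  proof (intro allI impI)
    fix Z z assume Z: "(\<forall>n. Z n \<in> G) \<and> z \<in> G \<and> Z \<longlonglongrightarrow> z"
    then have "fst (Z n) \<in> S" "fst z \<in> S" for n by (metis Gr_iff prod.collapse)+
    with Z show "u (fst z) \<le> liminf (\<lambda>n. u (fst (Z n)))"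
      by (intro lsc_seqD[OF rel_lim_lsc] tendsto_fst) auto
  qed
  have [measurable]: "(\<lambda>z. u (fst z)) \<in> borel_measurable (restrict_space borel G)"
    "(\<lambda>z. Qval 1 u (fst z) (snd z)) \<in> borel_measurable (restrict_space borel G)"
    by (intro lsc_seq_measurable u_G Qval_lsc rel_lim_lsc)+
  have "{z \<in> space (restrict_space borel G). Qval 1 u (fst z) (snd z) \<le> ennreal (w - K) + u (fst z)}
      \<in> sets (restrict_space borel G)" by measurable
  moreover have "{z \<in> space (restrict_space borel G). Qval 1 u (fst z) (snd z) \<le> ennreal (w - K) + u (fst z)}
      = Gr M (A_sup_star M)"
    using A_sup_star_eq[OF _ w] by (auto simp: Gr_def space_restrict_space)
  ultimately have "Gr M (A_sup_star M) \<in> sets borel" "Gr M (A_sup_star M) \<subseteq> G"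
    using GB by (auto simp: sets_restrict_space_iff)
  then show ?thesis using sub SA by (simp add: sets_restrict_space_iff)
qed

lemma avg_cost_acoi:
  assumes \<phi>: "stationary M \<phi>" "acoi M \<phi>" and x: "x \<in> S"
  shows "avg_cost M (stat_policy M \<phi>) x = w_upper M"
proof (rule antisym)
  obtain w where w: "w_upper M = ereal w" "K \<le> w" by (rule w_upper_real)
  show "avg_cost M (stat_policy M \<phi>) x \<le> w_upper M"
    unfolding w(1)
    by (rule avg_cost_le_of_acoi[OF \<phi>(1) x rel_lim_lsc u_finite[OF x]]) (use acoi_iff[OF \<phi>(1) w] \<phi>(2) w in auto)
  show "w_upper M \<le> avg_cost M (stat_policy M \<phi>) x"
    by (rule w_upper_le_avg_cost[OF stat_policy_in_policies[OF mdp \<phi>(1)] x])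
qed

lemma stationary_minimizer:
  obtains \<phi> where "stationary M \<phi>" "acoi M \<phi>" "\<And>x. x \<in> S \<Longrightarrow> \<phi> x \<in> A_sub_star M x"
proof -
  obtain w where w: "w_upper M = ereal w" "K \<le> w" by (rule w_upper_real)
  obtain \<phi> where \<phi>: "stationary M \<phi>" "\<And>x. x \<in> S \<Longrightarrow> Qval 1 u x (\<phi> x) = opt 1 u x"
    using stationary_selector[OF rel_lim_lsc[of "{0..<1}"], of 1] by blast
  have "acoi M \<phi>" unfolding acoi_iff[OF \<phi>(1) w] using \<phi>(2) opt_u_le[OF _ w] by simp
  moreover have "\<phi> x \<in> A_sub_star M x" if "x \<in> S" for x
    unfolding A_sub_star_eq[OF that] using \<phi> that by (auto simp: stationary_def)
  ultimately show thesis using that \<phi>(1) by blast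
qed

lemma avg_value_eq:
  assumes x: "x \<in> S"
  shows "avg_value M x = w_upper M"
proof (rule antisym)
  obtain \<phi> where \<phi>: "stationary M \<phi>" "acoi M \<phi>" using stationary_minimizer by blast
  show "avg_value M x \<le> w_upper M"
    unfolding avg_value_def
    by (rule INF_lower2[OF stat_policy_in_policies[OF mdp \<phi>(1)]]) (simp add: avg_cost_acoi[OF \<phi> x])
  show "w_upper M \<le> avg_value M x"
    unfolding avg_value_def by (intro INF_greatest w_upper_le_avg_cost x)
qed

lemma w_star_eq: "w_star M = w_upper M"
proof -
  obtain x where "x \<in> S" using finite_avg_cost by metis
  then have "S \<noteq> {}" by auto
  then show ?thesis unfolding w_star_def by (simp add: avg_value_eq cong: INF_cong)
qed

lemma Limsup_disc_value_eq:
  assumes x: "x \<in> S"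
  shows "Limsup (at_left 1) (\<lambda>\<alpha>. ereal (1 - \<alpha>) * disc_value M \<alpha> x) = w_upper M"
proof (rule antisym)
  obtain \<phi> where \<phi>: "stationary M \<phi>" "acoi M \<phi>" using stationary_minimizer by blast
  show "Limsup (at_left 1) (\<lambda>\<alpha>. ereal (1 - \<alpha>) * disc_value M \<alpha> x) \<le> w_upper M"
    using Limsup_disc_value_le_avg_cost[OF stat_policy_in_policies[OF mdp \<phi>(1)] x] avg_cost_acoi[OF \<phi> x] by simp
qed (rule w_upper_le_disc[OF x])

lemma disc_value_tendsto:
  assumes x: "x \<in> S"
  shows "((\<lambda>\<alpha>. ereal (1 - \<alpha>) * disc_value M \<alpha> x) \<longlongrightarrow> w_lower M) (at_left 1)"
proof (rule Liminf_eq_Limsup)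
  show "Limsup (at_left 1) (\<lambda>\<alpha>. ereal (1 - \<alpha>) * disc_value M \<alpha> x) = w_lower M"
    by (simp add: Limsup_disc_value_eq[OF x] w_lower_eq_w_upper)
  then show "Liminf (at_left 1) (\<lambda>\<alpha>. ereal (1 - \<alpha>) * disc_value M \<alpha> x) = w_lower M"
    using w_lower_le_disc[OF x] Liminf_le_Limsup[of "at_left (1::real)" "\<lambda>\<alpha>. ereal (1 - \<alpha>) * disc_value M \<alpha> x"]
    by (intro antisym) auto
qed simp

text \<open>
  The optimality inequality bounds the expected total costs by \<open>N w + u(x)\<close>. Their Abel means are at least
  \<open>(1 - \<alpha>) m\<^sub>\<alpha>\<close>, whose limit is the same \<open>w\<close>, so the Tauberian theorem applies.
\<close>

lemma fin_cost_tendsto: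
  assumes \<phi>: "stationary M \<phi>" "acoi M \<phi>" and x: "x \<in> S"
  shows "(\<lambda>N. fin_cost M N 1 (stat_policy M \<phi>) x / ereal (real N)) \<longlonglongrightarrow> w_lower M"
proof -
  obtain w where w: "w_upper M = ereal w" "K \<le> w" by (rule w_upper_real)
  let ?\<pi> = "stat_policy M \<phi>"
  interpret mdp_traj_cost M ?\<pi> x K by (rule stat_traj_cost[OF \<phi>(1) x])
  let ?C = "enn2real (u x)"
  have S: "(\<Sum>k<N. stage_cost k) \<le> ennreal ((w - K) * real N + ?C)" for N
    by (rule acoi_fin_cost[OF \<phi>(1) x rel_lim_lsc u_finite[OF x]]) (use acoi_iff[OF \<phi>(1) w] \<phi>(2) w in auto)
  have fin: "stage_cost k < top" for k
  proof -
    have "stage_cost k \<le> (\<Sum>i<Suc k. stage_cost i)" by simp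
    also have "\<dots> < top" by (rule le_less_trans[OF S]) simp
    finally show ?thesis .
  qed
  define e where "e k = enn2real (stage_cost k)" for k
  have e: "stage_cost k = ennreal (e k)" "0 \<le> e k" for k using fin by (auto simp: e_def)
  have Se: "(\<Sum>k<N. e k) \<le> (w - K) * real N + ?C" for N
    using S[of N] w(2) by (simp add: e sum_ennreal ennreal_le_iff del: ennreal_plus)
  have lower: "\<forall>\<^sub>F N in sequentially. (w - K - \<delta>) * real N \<le> (\<Sum>k<N. e k)" if \<delta>: "\<delta> > 0" for \<delta>
  proof (rule cesaro_ge_of_abel_ge[OF e(2) _ _ \<delta>])
    fix \<epsilon> :: real assume \<epsilon>: "\<epsilon> > 0"
    have "(\<Sum>k<N. e k) \<le> (w - K + \<epsilon>) * real N + ?C" for N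
      by (rule order_trans[OF Se]) (use \<epsilon> in \<open>simp add: mult_right_mono\<close>)
    then show "\<exists>C. \<forall>N. (\<Sum>k<N. e k) \<le> (w - K + \<epsilon>) * real N + C" by blast
    have "ereal (w - \<epsilon>) < w_lower M" using \<epsilon> by (simp add: w_lower_eq_w_upper w(1))
    then have "\<forall>\<^sub>F \<alpha> in at_left 1. ereal (w - \<epsilon>) < ereal (scaled_min \<alpha>)" unfolding w_lower_scaled_min by (rule less_LiminfD)
    then obtain \<beta> where \<beta>: "\<beta> < 1" "\<And>\<alpha>. \<beta> < \<alpha> \<Longrightarrow> \<alpha> < 1 \<Longrightarrow> w - \<epsilon> < scaled_min \<alpha>"
      unfolding eventually_at_left_field by auto
    show "\<exists>\<beta><1. \<forall>\<alpha> U. \<beta> \<le> \<alpha> \<and> \<alpha> < 1 \<and> (\<forall>N. (\<Sum>n<N. \<alpha> ^ n * e n) \<le> U) \<longrightarrow> w - K - \<epsilon> \<le> (1 - \<alpha>) * U"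
    proof (intro exI[of _ "max 0 ((\<beta> + 1) / 2)"] conjI allI impI, use \<beta>(1) in simp, elim conjE)
      fix \<alpha> U assume \<alpha>: "max 0 ((\<beta> + 1) / 2) \<le> \<alpha>" "\<alpha> < 1" and U: "\<forall>N. (\<Sum>n<N. \<alpha> ^ n * e n) \<le> U"
      have U0: "0 \<le> U" using U[rule_format, of 0] by simp
      have \<alpha>0: "0 \<le> \<alpha>" using \<alpha> by simp
      have "(\<Sum>n<N. ennreal (\<alpha> ^ n) * stage_cost n) \<le> ennreal U" for N
        using U \<alpha>0 e(2) by (simp add: e(1) sum_ennreal ennreal_leI flip: ennreal_mult)
      then have "(\<Sum>n. ennreal (\<alpha> ^ n) * stage_cost n) \<le> ennreal U"
        by (simp add: suminf_eq_SUP SUP_least)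
      then have "value_lim \<alpha> x \<le> ennreal U" using value_lim_le_cost[OF policy x \<alpha>0] by simp
      moreover have "min_value \<alpha> \<le> value_lim \<alpha> x" unfolding min_value_def by (rule INF_lower[OF x])
      ultimately have "enn2real (min_value \<alpha>) \<le> U" using U0 by (intro enn2real_leI) auto
      then have "scaled_min \<alpha> - K \<le> (1 - \<alpha>) * U" using \<alpha> by (simp add: scaled_min_def mult_left_mono)
      moreover have "w - \<epsilon> < scaled_min \<alpha>" using \<alpha> \<beta>(1) by (intro \<beta>(2)) auto
      ultimately show "w - K - \<epsilon> \<le> (1 - \<alpha>) * U" by simp
    qed
  qed
  have lim: "(\<lambda>N. (\<Sum>k<N. e k) / real N) \<longlonglongrightarrow> w - K"
  proof (rule order_tendstoI)
    fix a assume a: "a < w - K"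
    have "\<forall>\<^sub>F N in sequentially. (w - K - (w - K - a) / 2) * real N \<le> (\<Sum>k<N. e k)"
      by (rule lower) (use a in simp)
    then show "\<forall>\<^sub>F N in sequentially. a < (\<Sum>k<N. e k) / real N"
      using eventually_gt_at_top[of 0]
    proof eventually_elim
      case (elim N)
      have "a * real N < (w - K - (w - K - a) / 2) * real N" using a elim by (intro mult_strict_right_mono) (auto simp: field_simps)
      then show ?case using elim by (simp add: field_simps)
    qed
  next
    fix a assume a: "w - K < a"
    have "(\<lambda>N. w - K + ?C / real N) \<longlonglongrightarrow> w - K + 0"
      by (intro tendsto_intros lim_const_over_n)
    then have "\<forall>\<^sub>F N in sequentially. w - K + ?C / real N < a" using a by (intro order_tendstoD(2)) auto
    then show "\<forall>\<^sub>F N in sequentially. (\<Sum>k<N. e k) / real N < a"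
      using eventually_gt_at_top[of 0]
    proof eventually_elim
      case (elim N)
      have "(\<Sum>k<N. e k) / real N \<le> ((w - K) * real N + ?C) / real N" using Se elim by (intro divide_right_mono) auto
      also have "\<dots> = w - K + ?C / real N" using elim by (simp add: field_simps)
      finally show ?case using elim by simp
    qed
  qed
  have "(\<lambda>N. ereal ((\<Sum>k<N. e k) / real N + K)) \<longlonglongrightarrow> ereal (w - K + K)"
    by (intro tendsto_intros lim)
  then have "(\<lambda>N. ereal ((\<Sum>k<N. e k) / real N + K)) \<longlonglongrightarrow> w_lower M"
    by (simp add: w_lower_eq_w_upper w(1))
  then show ?thesis
  proof (rule Lim_transform_eventually, use eventually_gt_at_top[of 0] in eventually_elim)
    case (elim N)
    have "fin_cost M N 1 ?\<pi> x = ereal ((\<Sum>k<N. e k) + real N * K)"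
      unfolding fin_cost_eq by (simp add: e sum_ennreal sum_nonneg)
    then show ?case using elim by (simp add: add_divide_distrib)
  qed
qed

lemma u_fun_lsc_on: "lsc_on S (u_fun M)"
  unfolding lsc_on_def
proof
  fix l :: real
  have "{y \<in> S. u_fun M y \<le> ereal l} = {y \<in> S. u y \<le> e2ennreal (ereal l)}" if "0 \<le> l"
  proof -
    have "u_fun M y \<le> ereal l \<longleftrightarrow> u y \<le> ennreal l" for y
      unfolding u_fun_eq using that by (simp add: less_eq_ennreal.rep_eq)
    then show ?thesis by simp
  qed
  moreover have "{y \<in> S. u_fun M y \<le> ereal l} = {}" if "\<not> 0 \<le> l"
    using that order_trans[OF enn2ereal_nonneg] by (fastforce simp: u_fun_eq)
  ultimately show "closedin (top_of_set S) {y \<in> S. u_fun M y \<le> ereal l}"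
    using lsc_seq_closedin[OF rel_lim_lsc, of "{0..<1}"] by (metis closedin_empty)
qed

text \<open>
  Along a stationary policy that satisfies the optimality inequality the cost at \<open>y\<close> is at most
  \<open>w_upper M + u(y)\<close>. Hence a sublevel set of \<open>u\<close> lies in the projection of a sublevel set of the cost,
  which is compact.
\<close>

lemma u_fun_inf_compact:
  assumes "assumption_Wu M"
  shows "inf_compact_on S (u_fun M)"
  unfolding inf_compact_on_def
proof
  fix l :: real
  obtain w where w: "w_upper M = ereal w" "K \<le> w" by (rule w_upper_real)
  obtain \<phi> where \<phi>: "stationary M \<phi>" "acoi M \<phi>" using stationary_minimizer by blast
  let ?C = "{z \<in> G. cost M z \<le> ereal (w + l)}"
  have C: "compact (fst ` ?C)"
    using assms by (intro compact_continuous_image continuous_intros) (auto simp: assumption_Wu_def inf_compact_on_def)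
  obtain T where T: "closed T" "{y \<in> S. u_fun M y \<le> ereal l} = S \<inter> T"
    using u_fun_lsc_on unfolding lsc_on_def closedin_closed by meson
  have "{y \<in> S. u_fun M y \<le> ereal l} \<subseteq> fst ` ?C"
  proof
    fix y assume y: "y \<in> {y \<in> S. u_fun M y \<le> ereal l}"
    then have z: "(y, \<phi> y) \<in> G" using \<phi>(1) by (simp add: stationary_def)
    have "cost M (y, \<phi> y) \<le> one_step M y (\<phi> y)"
      unfolding one_step_eq[OF z] cost_eq_shifted[OF z K[OF z]]
      by (intro add_right_mono) (simp add: shifted_cost_le_Qval less_eq_ennreal.rep_eq[symmetric])
    also have "\<dots> \<le> w_upper M + u_fun M y" using \<phi>(2) y by (simp add: acoi_def)
    also have "\<dots> \<le> ereal w + ereal l" unfolding w(1) using y by (intro add_left_mono) simp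
    finally have "(y, \<phi> y) \<in> ?C" using z by simp
    then show "y \<in> fst ` ?C" by force
  qed
  moreover have "fst ` ?C \<subseteq> S" by (auto simp: Gr_def)
  ultimately have "{y \<in> S. u_fun M y \<le> ereal l} = fst ` ?C \<inter> T" using T(2) by blast
  then show "compact {y \<in> S. u_fun M y \<le> ereal l}" using compact_Int_closed[OF C T(1)] by simp
qed

end

theorem theorem5p6:
  fixes M :: "('x::polish_space, 'a::polish_space) mdp"
  assumes "is_mdp M"
    and "assumption_W_star M"
    and "assumption_B M"
  shows
    "(\<exists>\<phi>. stationary M \<phi> \<and> acoi M \<phi> \<and> avg_optimal M (stat_policy M \<phi>) \<and>
        (\<forall>x\<in>states M.
           avg_value M x = avg_cost M (stat_policy M \<phi>) x \<and>
           avg_cost M (stat_policy M \<phi>) x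
             = Limsup (at_left 1) (\<lambda>\<alpha>. ereal (1 - \<alpha>) * disc_value M \<alpha> x) \<and>
           Limsup (at_left 1) (\<lambda>\<alpha>. ereal (1 - \<alpha>) * disc_value M \<alpha> x) = w_upper M \<and>
           w_upper M = w_star M))
     \<and> ((\<forall>x\<in>states M. 0 \<le> u_fun M x \<and> u_fun M x < \<infinity>) \<and> lsc_on (states M) (u_fun M))
     \<and> ((\<forall>x\<in>states M. A_sup_star M x \<noteq> {} \<and> compact (A_sup_star M x)) \<and>
        Gr M (A_sup_star M) \<in> sets (restrict_space borel (states M \<times> actions M)))
     \<and> (\<forall>\<phi>. stationary M \<phi> \<and> (\<forall>x\<in>states M. \<phi> x \<in> A_sup_star M x)
          \<longrightarrow> avg_optimal M (stat_policy M \<phi>) \<and> acoi M \<phi>)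
     \<and> (\<exists>\<phi>. stationary M \<phi> \<and>
          (\<forall>x\<in>states M. \<phi> x \<in> A_sub_star M x \<and> A_sub_star M x \<subseteq> A_sup_star M x))
     \<and> (assumption_Wu M \<longrightarrow> inf_compact_on (states M) (u_fun M))
     \<and> (\<forall>\<phi>. stationary M \<phi> \<and> acoi M \<phi> \<longrightarrow>
          (\<forall>x\<in>states M.
             avg_cost M (stat_policy M \<phi>) x = w_lower M \<and>
             ((\<lambda>\<alpha>. ereal (1 - \<alpha>) * disc_value M \<alpha> x) \<longlongrightarrow> w_lower M) (at_left 1) \<and>
             (\<lambda>N. fin_cost M N 1 (stat_policy M \<phi>) x / ereal (real N)) \<longlonglongrightarrow> w_lower M))"
proof -
  obtain K where "\<And>z. z \<in> Gr M (avail M) \<Longrightarrow> ereal K \<le> cost M z"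
    using assms(2) unfolding assumption_W_star_def bounded_below_on_def by blast
  then interpret mdp_W_star_B M K
    using assms by unfold_locales
  have optimal: "avg_optimal M (stat_policy M \<phi>)" if "stationary M \<phi>" "acoi M \<phi>" for \<phi>
    unfolding avg_optimal_def
    using stat_policy_in_policies[OF mdp that(1)] avg_cost_acoi[OF that] avg_value_eq by simp
  obtain \<phi> where \<phi>: "stationary M \<phi>" "acoi M \<phi>" "\<And>x. x \<in> S \<Longrightarrow> \<phi> x \<in> A_sub_star M x"
    using stationary_minimizer by blast
  show ?thesis
  proof (intro conjI)
    show "\<exists>\<phi>. stationary M \<phi> \<and> acoi M \<phi> \<and> avg_optimal M (stat_policy M \<phi>) \<and>
        (\<forall>x\<in>states M.
           avg_value M x = avg_cost M (stat_policy M \<phi>) x \<and>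
           avg_cost M (stat_policy M \<phi>) x
             = Limsup (at_left 1) (\<lambda>\<alpha>. ereal (1 - \<alpha>) * disc_value M \<alpha> x) \<and>
           Limsup (at_left 1) (\<lambda>\<alpha>. ereal (1 - \<alpha>) * disc_value M \<alpha> x) = w_upper M \<and>
           w_upper M = w_star M)"
      using \<phi>(1,2) optimal[OF \<phi>(1,2)] avg_cost_acoi[OF \<phi>(1,2)] avg_value_eq Limsup_disc_value_eq w_star_eq
      by (intro exI[of _ \<phi>]) simp
    show "\<forall>x\<in>states M. 0 \<le> u_fun M x \<and> u_fun M x < \<infinity>"
    proof
      fix x assume "x \<in> S"
      from u_finite[OF this] show "0 \<le> u_fun M x \<and> u_fun M x < \<infinity>"
        unfolding u_fun_eq by (cases "u x") auto
    qed
    show "lsc_on (states M) (u_fun M)" by (rule u_fun_lsc_on)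
    show "\<forall>x\<in>states M. A_sup_star M x \<noteq> {} \<and> compact (A_sup_star M x)"
      using A_sup_star_compact_nonempty by blast
    show "Gr M (A_sup_star M) \<in> sets (restrict_space borel (states M \<times> actions M))"
      by (rule Gr_A_sup_star_sets)
    show "\<forall>\<phi>. stationary M \<phi> \<and> (\<forall>x\<in>states M. \<phi> x \<in> A_sup_star M x)
          \<longrightarrow> avg_optimal M (stat_policy M \<phi>) \<and> acoi M \<phi>"
      using optimal by (auto simp: acoi_def A_sup_star_def)
    show "\<exists>\<phi>. stationary M \<phi> \<and>
          (\<forall>x\<in>states M. \<phi> x \<in> A_sub_star M x \<and> A_sub_star M x \<subseteq> A_sup_star M x)"
      using \<phi> A_sup_star_compact_nonempty(3) by blast
    show "assumption_Wu M \<longrightarrow> inf_compact_on (states M) (u_fun M)"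
      using u_fun_inf_compact by blast
    show "\<forall>\<phi>. stationary M \<phi> \<and> acoi M \<phi> \<longrightarrow>
          (\<forall>x\<in>states M.
             avg_cost M (stat_policy M \<phi>) x = w_lower M \<and>
             ((\<lambda>\<alpha>. ereal (1 - \<alpha>) * disc_value M \<alpha> x) \<longlongrightarrow> w_lower M) (at_left 1) \<and>
             (\<lambda>N. fin_cost M N 1 (stat_policy M \<phi>) x / ereal (real N)) \<longlonglongrightarrow> w_lower M)"
      using avg_cost_acoi disc_value_tendsto fin_cost_tendsto w_lower_eq_w_upper by simp
  qed
qed

end
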